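(* Let $(M^n,g,X,\lambda)$ be a complete and noncompact quotient almost Yamabe soliton, i.e. $\frac12\mathcal{L}_Xg=\left(\log\frac{\sigma_k}{\sigma_l}-\lambda\right)g$ with $\sigma_k\cdot\sigma_l>0$ on $M$. Let $x_0\in M$ and $r>0$, and suppose that $$\int_{M^n\setminus B_r(x_0)}\frac{|X|}{d(x,x_0)}\,dv_g<\infty\quad\text{and}\quad\mathcal{L}_Xg\geqslant0,$$ where $d$ is the distance function with respect to $g$ and $B_r(x_0)$ is the ball of radius $r$ centered at $x_0$. Then $(M^n,g,X,\lambda)$ is trivial, i.e. $\mathcal{L}_Xg=0$.
   Context: Manifolds are smooth and connected, of dimension $n\geqslant 3$, without boundary. For a Riemannian manifold $(M^n,g)$ with Ricci tensor $\mathrm{Ric}_g$ and scalar curvature $R_g$, the Schouten tensor is $A_g=\frac{1}{n-2}\left(\mathrm{Ric}_g-\frac{R_g}{2(n-1)}g\right)$. The $\sigma_k$-curvature $\sigma_k=\sigma_k(g)$, $1\leqslant k\leqslant n$, is the $k$-th elementary symmetric function of the eigenvalues of the endomorphism $g^{-1}A_g$, and $\sigma_0=1$. Fix integers $k,l\in\{0,1,\dots,n\}$. A quotient almost Yamabe soliton $(M^n,g,X,\lambda)$ is a Riemannian manifold $(M^n,g)$ with a smooth vector field $X$ and a function $\lambda\in C^\infty(M)$ such that $\sigma_k\cdot\sigma_l>0$ on $M$ and $\frac12\mathcal{L}_Xg=\left(\log\frac{\sigma_k}{\sigma_l}-\lambda\right)g$, where $\mathcal{L}_Xg$ is the Lie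 derivative. It is trivial if $\mathcal{L}_Xg=0$. The condition $\mathcal{L}_Xg\geqslant0$ means that the symmetric $(0,2)$-tensor $\mathcal{L}_Xg$ is positive semidefinite at every point. *)

theory Defs
  imports "HOL-Analysis.Analysis" "HOL-Computational_Algebra.Polynomial"
begin

section \<open>Smooth functions on open subsets of Euclidean space\<close>

primrec Ck_on :: "nat \<Rightarrow> 'a set \<Rightarrow> ('a::euclidean_space \<Rightarrow> 'b::real_normed_vector) \<Rightarrow> bool" where
  "Ck_on 0 S f \<longleftrightarrow> continuous_on S f"
| "Ck_on (Suc k) S f \<longleftrightarrow>
     (\<forall>x\<in>S. f differentiable (at x)) \<and> (\<forall>v. Ck_on k S (\<lambda>x. frechet_derivative f (at x) v))"

text \<open>Only meaningful for open sets, since the derivatives are two-sided.\<close>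
definition smooth_on :: "'a set \<Rightarrow> ('a::euclidean_space \<Rightarrow> 'b::real_normed_vector) \<Rightarrow> bool" where
  "smooth_on S f \<longleftrightarrow> (\<forall>k. Ck_on k S f)"

section \<open>Smooth manifolds\<close>

text \<open>The manifold is a whole type, its topology being that of the type. A chart consists of an
  open domain and a coordinate map into the space \<^typ>\<open>real ^ 'n\<close>, so the dimension of the
  manifold is the cardinality of the index type. Values of coordinate maps (and of all fields
  below) outside the chart domain are irrelevant.\<close>

type_synonym ('a, 'n) chart = "'a set \<times> ('a \<Rightarrow> real ^ 'n)"

abbreviation chart_dom :: "('a, 'n) chart \<Rightarrow> 'a set" where
  "chart_dom c \<equiv> fst c"

abbreviation chart_map :: "('a, 'n) chart \<Rightarrow> 'a \<Rightarrow> real ^ 'n" where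
  "chart_map c \<equiv> snd c"

definition chart_inv :: "('a, 'n) chart \<Rightarrow> real ^ 'n \<Rightarrow> 'a" where
  "chart_inv c = inv_into (chart_dom c) (chart_map c)"

definition is_chart :: "('a::topological_space, 'n::finite) chart \<Rightarrow> bool" where
  "is_chart c \<longleftrightarrow> open (chart_dom c) \<and> open (chart_map c ` chart_dom c) \<and>
     homeomorphism (chart_dom c) (chart_map c ` chart_dom c) (chart_map c) (chart_inv c)"

definition smooth_manifold ::
  "('a::{second_countable_topology, t2_space}, 'n::finite) chart set \<Rightarrow> bool" where
  "smooth_manifold A \<longleftrightarrow>
     connected (UNIV :: 'a set) \<and>
     (\<forall>c\<in>A. is_chart c) \<and>
     (\<Union>c\<in>A. chart_dom c) = UNIV \<and>
     (\<forall>c\<in>A. \<forall>d\<in>A. smooth_on (chart_map c ` (chart_dom c \<inter> chart_dom d)) (chart_map d \<circ> chart_inv c))"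

text \<open>Used only to evaluate scalar quantities that do not depend on the choice of chart.\<close>
definition chart_at :: "('a, 'n) chart set \<Rightarrow> 'a \<Rightarrow> ('a, 'n) chart" where
  "chart_at A p = (SOME c. c \<in> A \<and> p \<in> chart_dom c)"

text \<open>Jacobian matrix at \<^term>\<open>p\<close> of the change of coordinates from \<^term>\<open>c\<close> to \<^term>\<open>d\<close>.\<close>
definition transition_jacobian ::
  "('a, 'n::finite) chart \<Rightarrow> ('a, 'n) chart \<Rightarrow> 'a \<Rightarrow> real ^ 'n ^ 'n" where
  "transition_jacobian c d p = jacobian (chart_map d \<circ> chart_inv c) (at (chart_map c p))"

text \<open>The partial derivative of \<^term>\<open>f\<close> with respect to the coordinate \<^term>\<open>i\<close> of \<^term>\<open>c\<close>.\<close>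
definition chart_partial ::
  "('a, 'n::finite) chart \<Rightarrow> 'n \<Rightarrow> ('a \<Rightarrow> real) \<Rightarrow> 'a \<Rightarrow> real" where
  "chart_partial c i f p = frechet_derivative (f \<circ> chart_inv c) (at (chart_map c p)) (axis i 1)"

definition smooth_function :: "('a, 'n::finite) chart set \<Rightarrow> ('a \<Rightarrow> real) \<Rightarrow> bool" where
  "smooth_function A f \<longleftrightarrow> (\<forall>c\<in>A. smooth_on (chart_map c ` chart_dom c) (f \<circ> chart_inv c))"

section \<open>Vector fields and Riemannian metrics\<close>

text \<open>Tensor fields are given by their components in every chart, subject to the transformation
  law of the respective tensor type.\<close>

type_synonym ('a, 'n) vfield = "('a, 'n) chart \<Rightarrow> 'a \<Rightarrow> real ^ 'n"

type_synonym ('a, 'n) tensor2 = "('a, 'n) chart \<Rightarrow> 'a \<Rightarrow> real ^ 'n ^ 'n"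

definition smooth_vector_field ::
  "('a, 'n::finite) chart set \<Rightarrow> ('a, 'n) vfield \<Rightarrow> bool" where
  "smooth_vector_field A X \<longleftrightarrow>
     (\<forall>c\<in>A. smooth_on (chart_map c ` chart_dom c) (X c \<circ> chart_inv c)) \<and>
     (\<forall>c\<in>A. \<forall>d\<in>A. \<forall>p \<in> chart_dom c \<inter> chart_dom d. X d p = transition_jacobian c d p *v X c p)"

definition riemannian_metric ::
  "('a, 'n::finite) chart set \<Rightarrow> ('a, 'n) tensor2 \<Rightarrow> bool" where
  "riemannian_metric A g \<longleftrightarrow>
     (\<forall>c\<in>A. smooth_on (chart_map c ` chart_dom c) (g c \<circ> chart_inv c)) \<and>
     (\<forall>c\<in>A. \<forall>d\<in>A. \<forall>p \<in> chart_dom c \<inter> chart_dom d.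
        g c p = transpose (transition_jacobian c d p) ** g d p ** transition_jacobian c d p) \<and>
     (\<forall>c\<in>A. \<forall>p\<in>chart_dom c. transpose (g c p) = g c p \<and> (\<forall>v. v \<noteq> 0 \<longrightarrow> v \<bullet> (g c p *v v) > 0))"

definition vector_norm ::
  "('a, 'n::finite) chart set \<Rightarrow> ('a, 'n) tensor2 \<Rightarrow> ('a, 'n) vfield \<Rightarrow> 'a \<Rightarrow> real" where
  "vector_norm A g X p =
     (let c = chart_at A p in sqrt (X c p \<bullet> (g c p *v X c p)))"

text \<open>Components of the Lie derivative of \<^term>\<open>g\<close> along \<^term>\<open>X\<close>:
  $X^m \partial_m g_{ij} + g_{mj} \partial_i X^m + g_{im} \partial_j X^m$.\<close>
definition lie_derivative ::
  "('a, 'n::finite) vfield \<Rightarrow> ('a, 'n) tensor2 \<Rightarrow> ('a, 'n) tensor2" where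
  "lie_derivative X g c p =
     (\<chi> i j. \<Sum>m\<in>UNIV. X c p $ m * chart_partial c m (\<lambda>q. g c q $ i $ j) p
                      + g c p $ m $ j * chart_partial c i (\<lambda>q. X c q $ m) p
                      + g c p $ i $ m * chart_partial c j (\<lambda>q. X c q $ m) p)"

section \<open>Curvature\<close>

text \<open>\<open>christoffel g c k i j p\<close> is the Christoffel symbol $\Gamma^k_{ij}$ of the Levi-Civita
  connection.\<close>
definition christoffel ::
  "('a, 'n::finite) tensor2 \<Rightarrow> ('a, 'n) chart \<Rightarrow> 'n \<Rightarrow> 'n \<Rightarrow> 'n \<Rightarrow> 'a \<Rightarrow> real" where
  "christoffel g c k i j p =
     (\<Sum>l\<in>UNIV. matrix_inv (g c p) $ k $ l *
        (chart_partial c i (\<lambda>q. g c q $ j $ l) p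
         + chart_partial c j (\<lambda>q. g c q $ i $ l) p
         - chart_partial c l (\<lambda>q. g c q $ i $ j) p)) / 2"

text \<open>Sign convention: the Ricci tensor of the round sphere is positive.\<close>
definition ricci :: "('a, 'n::finite) tensor2 \<Rightarrow> ('a, 'n) tensor2" where
  "ricci g c p =
     (\<chi> i j. \<Sum>k\<in>UNIV.
        chart_partial c k (christoffel g c k i j) p - chart_partial c j (christoffel g c k i k) p
        + (\<Sum>l\<in>UNIV. christoffel g c k k l p * christoffel g c l i j p
                   - christoffel g c k j l p * christoffel g c l i k p))"

definition scalar_curvature ::
  "('a, 'n::finite) tensor2 \<Rightarrow> ('a, 'n) chart \<Rightarrow> 'a \<Rightarrow> real" where
  "scalar_curvature g c p = (\<Sum>i\<in>UNIV. \<Sum>j\<in>UNIV. matrix_inv (g c p) $ i $ j * ricci g c p $ i $ j)"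

definition schouten :: "('a, 'n::finite) tensor2 \<Rightarrow> ('a, 'n) tensor2" where
  "schouten g c p =
     (1 / (real CARD('n) - 2)) *\<^sub>R
       (ricci g c p - (scalar_curvature g c p / (2 * (real CARD('n) - 1))) *\<^sub>R g c p)"

definition characteristic_polynomial :: "real ^ 'n ^ 'n::finite \<Rightarrow> real poly" where
  "characteristic_polynomial M = det (\<chi> i j. (if i = j then [:0, 1:] else 0) - [:M $ i $ j:])"

text \<open>Real eigenvalues, repeated according to algebraic multiplicity, in increasing order. For an
  endomorphism that is self-adjoint with respect to a metric these are all the eigenvalues.\<close>
definition eigenvalue_list :: "real ^ 'n ^ 'n::finite \<Rightarrow> real list" where
  "eigenvalue_list M = sorted_list_of_multiset (proots (characteristic_polynomial M))"

definition elementary_symmetric :: "nat \<Rightarrow> 'a::comm_semiring_1 list \<Rightarrow> 'a" where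
  "elementary_symmetric k xs = (\<Sum>S | S \<subseteq> {..<length xs} \<and> card S = k. \<Prod>i\<in>S. xs ! i)"

definition sigma_curvature ::
  "('a, 'n::finite) chart set \<Rightarrow> ('a, 'n) tensor2 \<Rightarrow> nat \<Rightarrow> 'a \<Rightarrow> real" where
  "sigma_curvature A g k p =
     (let c = chart_at A p in
      elementary_symmetric k (eigenvalue_list (matrix_inv (g c p) ** schouten g c p)))"

section \<open>Riemannian distance and volume\<close>

definition piecewise_C1_curve ::
  "('a::topological_space, 'n::finite) chart set \<Rightarrow> (real \<Rightarrow> 'a) \<Rightarrow> bool" where
  "piecewise_C1_curve A \<gamma> \<longleftrightarrow>
     continuous_on {0..1} \<gamma> \<and>
     (\<forall>c\<in>A. \<forall>a b. {a..b} \<subseteq> {0..1} \<and> \<gamma> ` {a..b} \<subseteq> chart_dom c \<longrightarrow>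
        (chart_map c \<circ> \<gamma>) piecewise_C1_differentiable_on {a..b})"

text \<open>The velocity is unspecified at finitely many parameters, which does not affect the
  integral.\<close>
definition curve_length ::
  "('a, 'n::finite) chart set \<Rightarrow> ('a, 'n) tensor2 \<Rightarrow> (real \<Rightarrow> 'a) \<Rightarrow> ennreal" where
  "curve_length A g \<gamma> =
     (\<integral>\<^sup>+ t\<in>{0..1}.
        ennreal (let c = chart_at A (\<gamma> t);
                     v = vector_derivative (chart_map c \<circ> \<gamma>) (at t)
                 in sqrt (v \<bullet> (g c (\<gamma> t) *v v))) \<partial>lborel)"

definition riemannian_distance ::
  "('a::topological_space, 'n::finite) chart set \<Rightarrow> ('a, 'n) tensor2 \<Rightarrow> 'a \<Rightarrow> 'a \<Rightarrow> real" where
  "riemannian_distance A g x y =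
     enn2real (INF \<gamma> \<in> {\<gamma>. piecewise_C1_curve A \<gamma> \<and> \<gamma> 0 = x \<and> \<gamma> 1 = y}. curve_length A g \<gamma>)"

text \<open>The unique Borel measure that is $\sqrt{\det g}\,dx$ in every chart.\<close>
definition riemannian_volume ::
  "('a::topological_space, 'n::finite) chart set \<Rightarrow> ('a, 'n) tensor2 \<Rightarrow> 'a measure" where
  "riemannian_volume A g =
     (THE \<mu>. sets \<mu> = sets borel \<and>
        (\<forall>c\<in>A. \<forall>B\<in>sets borel. B \<subseteq> chart_dom c \<longrightarrow>
           emeasure \<mu> B =
             (\<integral>\<^sup>+ x\<in>chart_map c ` B. ennreal (sqrt (det (g c (chart_inv c x)))) \<partial>lborel)))"

text \<open>Completeness is metric completeness of the Riemannian distance.\<close>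
definition complete_metric ::
  "('a::topological_space, 'n::finite) chart set \<Rightarrow> ('a, 'n) tensor2 \<Rightarrow> bool" where
  "complete_metric A g \<longleftrightarrow> Metric_space.mcomplete UNIV (riemannian_distance A g)"

section \<open>Quotient almost Yamabe solitons\<close>

definition quotient_almost_Yamabe_soliton ::
  "nat \<Rightarrow> nat \<Rightarrow> ('a::{second_countable_topology, t2_space}, 'n::finite) chart set \<Rightarrow>
   ('a, 'n) tensor2 \<Rightarrow> ('a, 'n) vfield \<Rightarrow> ('a \<Rightarrow> real) \<Rightarrow> bool" where
  "quotient_almost_Yamabe_soliton k l A g X lam \<longleftrightarrow>
     smooth_manifold A \<and> riemannian_metric A g \<and> smooth_vector_field A X \<and> smooth_function A lam \<and>
     (\<forall>p. sigma_curvature A g k p * sigma_curvature A g l p > 0) \<and>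
     (\<forall>c\<in>A. \<forall>p\<in>chart_dom c.
        (1/2) *\<^sub>R lie_derivative X g c p =
          (ln (sigma_curvature A g k p / sigma_curvature A g l p) - lam p) *\<^sub>R g c p)"

definition trivial_soliton ::
  "('a, 'n::finite) chart set \<Rightarrow> ('a, 'n) tensor2 \<Rightarrow> ('a, 'n) vfield \<Rightarrow> bool" where
  "trivial_soliton A g X \<longleftrightarrow> (\<forall>c\<in>A. \<forall>p\<in>chart_dom c. lie_derivative X g c p = 0)"

definition positive_semidefinite_tensor ::
  "('a, 'n::finite) chart set \<Rightarrow> ('a, 'n) tensor2 \<Rightarrow> bool" where
  "positive_semidefinite_tensor A h \<longleftrightarrow> (\<forall>c\<in>A. \<forall>p\<in>chart_dom c. \<forall>v. v \<bullet> (h c p *v v) \<ge> 0)"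

end

(* With phi = log (sigma_k / sigma_l) - lambda, the soliton equation reads L_X g = 2 phi g; the
   hypothesis L_X g >= 0 gives phi >= 0, and the trace of the equation gives div X = n phi. Let eta be
   the cutoff min(1, 2 - d(x0, .) / R), truncated at 0; closed balls are compact by Hopf-Rinow, so eta
   has compact support, and it is Lipschitz with constant 1 / R and constant off the annulus between R
   and 2 R. The divergence theorem for eta X therefore bounds the integral of eta n phi by a constant
   times the integral of |X| / d(x0, .) over the complement of a ball whose radius grows with R, which
   tends to 0 as R grows. Hence phi = 0.

   Distance functions are merely Lipschitz. Instead of differentiating eta almost everywhere, the
   divergence theorem is proved chart by chart with the partial derivatives of eta replaced by
   difference quotients, which the Lipschitz constant bounds uniformly. *)

theory Submission
  imports Defs
begin

section \<open>Differentiable functions and bump functions\<close>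

text \<open>The constants must not depend on the chart: as R grows, more and more charts are needed
  to cover the support of eta, and a chart-dependent constant would destroy the limit. Hence each
  estimate is made on a coordinate ball where \<open>g\<close> is within a factor 2 of its value at
  the centre, in a frame normalised for that value. Moving along a frame vector then costs at most
  sqrt 2 times the parameter in distance, and the coefficients of X are at most sqrt 2 |X|, so each
  of the n frame directions contributes at most 2 / R times the integral of |X|. A partition of
  unity adds the charts up without further loss: its sum is 1 on an open set containing the support
  of eta, so the derivatives of its members along X cancel. On the shell R / 2 <= d <= 3 R, which
  contains all points where small difference quotients of eta can be nonzero, 1 / R <= 3 / d; this
  gives the constant 6 n. Since phi is nonnegative, positivity of phi at one point would keep the
  left side above a fixed positive number for all large R. The analysis involves first derivatives
  of \<open>g\<close> and X, hence the notion \<open>C1_on\<close>.\<close>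

abbreviation C1_on :: "'a set \<Rightarrow> ('a::euclidean_space \<Rightarrow> 'b::real_normed_vector) \<Rightarrow> bool" where
  "C1_on \<equiv> Ck_on (Suc 0)"

lemma smooth_on_imp_C1_on: "smooth_on S f \<Longrightarrow> C1_on S f"
  unfolding smooth_on_def by blast

lemma C1_onD:
  assumes "C1_on S f"
  shows "x \<in> S \<Longrightarrow> (f has_derivative frechet_derivative f (at x)) (at x)"
    and "continuous_on S (\<lambda>x. frechet_derivative f (at x) v)"
  using assms by (auto simp: frechet_derivative_works)

lemma C1_onI:
  assumes "\<And>x. x \<in> S \<Longrightarrow> (f has_derivative f' x) (at x)"
    and "\<And>v. continuous_on S (\<lambda>x. f' x v)"
  shows "C1_on S f"
proof -
  have "frechet_derivative f (at x) = f' x" if "x \<in> S" for x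
    using frechet_derivative_at[OF assms(1)[OF that]] by simp
  then show ?thesis
    using assms by (auto simp: differentiable_def cong: continuous_on_cong)
qed

lemma C1_on_imp_continuous_on: "C1_on S f \<Longrightarrow> continuous_on S f"
  by (simp add: continuous_at_imp_continuous_on differentiable_imp_continuous_within)

lemma C1_on_cong:
  assumes "C1_on S f" "open S" "\<And>x. x \<in> S \<Longrightarrow> f x = h x"
  shows "C1_on S h"
proof (rule C1_onI)
  show "(h has_derivative frechet_derivative f (at x)) (at x)" if "x \<in> S" for x
    using has_derivative_transform_within_open[OF C1_onD(1)[OF assms(1) that] assms(2) that] assms(3) by blast
qed (rule C1_onD(2)[OF assms(1)])

text \<open>Derivatives are two-sided and continuity glues over open covers; this is how functions
  extended by zero are shown to be C1.\<close>

lemma C1_on_Un: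
  assumes "C1_on S f" "C1_on T f" "open S" "open T"
  shows "C1_on (S \<union> T) f"
  using assms by (auto intro: continuous_on_open_Un)

lemma frechet_expand:
  fixes f :: "'a::euclidean_space \<Rightarrow> 'b::real_normed_vector"
  assumes "f differentiable (at x)"
  shows "frechet_derivative f (at x) v = (\<Sum>b\<in>Basis. (v \<bullet> b) *\<^sub>R frechet_derivative f (at x) b)"
proof -
  have l: "linear (frechet_derivative f (at x))"
    using assms by (simp add: linear_frechet_derivative)
  have "frechet_derivative f (at x) v = frechet_derivative f (at x) (\<Sum>b\<in>Basis. (v \<bullet> b) *\<^sub>R b)"
    by (simp add: euclidean_representation)
  also have "\<dots> = (\<Sum>b\<in>Basis. (v \<bullet> b) *\<^sub>R frechet_derivative f (at x) b)"
    by (simp add: linear_sum[OF l] linear_cmul[OF l])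
  finally show ?thesis .
qed

text \<open>\<open>C1_on\<close> gives continuity of the derivative in the point for each fixed
  direction. Expanding the direction over \<open>Basis\<close> lets point and direction vary
  together, as velocities of curves and the field X require.\<close>

lemma C1_on_continuous_on_pair:
  fixes f :: "'a::euclidean_space \<Rightarrow> 'b::real_normed_vector"
  assumes f: "C1_on T f" and "continuous_on S p" "continuous_on S v" "p ` S \<subseteq> T"
  shows "continuous_on S (\<lambda>x. frechet_derivative f (at (p x)) (v x))"
proof -
  have "continuous_on S (\<lambda>x. \<Sum>b\<in>Basis. (v x \<bullet> b) *\<^sub>R frechet_derivative f (at (p x)) b)"
    by (intro continuous_intros assms continuous_on_compose2[OF C1_onD(2)[OF f]])
  moreover have "frechet_derivative f (at (p x)) (v x) = (\<Sum>b\<in>Basis. (v x \<bullet> b) *\<^sub>R frechet_derivative f (at (p x)) b)" if "x \<in> S" for x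
    using assms that by (intro frechet_expand) auto
  ultimately show ?thesis by (simp cong: continuous_on_cong)
qed

lemma C1_on_compose:
  fixes f :: "'a::euclidean_space \<Rightarrow> 'b::euclidean_space" and h :: "'b \<Rightarrow> 'c::real_normed_vector"
  assumes f: "C1_on S f" and h: "C1_on T h" and "f ` S \<subseteq> T"
  shows "C1_on S (\<lambda>x. h (f x))"
proof (rule C1_onI)
  show "((\<lambda>x. h (f x)) has_derivative (\<lambda>v. frechet_derivative h (at (f x)) (frechet_derivative f (at x) v))) (at x)"
    if "x \<in> S" for x
    using diff_chain_at[OF C1_onD(1)[OF f that] C1_onD(1)[OF h]] assms that by (auto simp: o_def)
  show "continuous_on S (\<lambda>x. frechet_derivative h (at (f x)) (frechet_derivative f (at x) v))" for v
    by (rule C1_on_continuous_on_pair[OF h C1_on_imp_continuous_on[OF f] C1_onD(2)[OF f] assms(3)])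
qed

lemma C1_on_const: "C1_on S (\<lambda>x. c)"
  by (rule C1_onI[of S _ "\<lambda>_ _. 0"]) auto

lemma C1_on_linear_compose:
  assumes f: "C1_on S f" and h: "bounded_linear h"
  shows "C1_on S (\<lambda>x. h (f x))"
  by (rule C1_onI[of S _ "\<lambda>x v. h (frechet_derivative f (at x) v)"])
    (use bounded_linear.has_derivative[OF h C1_onD(1)[OF f]]
      bounded_linear.continuous_on[OF h C1_onD(2)[OF f]] in auto)

lemma C1_on_add:
  assumes f: "C1_on S f" and h: "C1_on S h"
  shows "C1_on S (\<lambda>x. f x + h x)"
  by (rule C1_onI[of S _ "\<lambda>x v. frechet_derivative f (at x) v + frechet_derivative h (at x) v"])
    (auto intro!: has_derivative_add continuous_intros C1_onD[OF f] C1_onD[OF h])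

lemma C1_on_sum:
  assumes "\<And>i. i \<in> I \<Longrightarrow> C1_on S (f i)"
  shows "C1_on S (\<lambda>x. \<Sum>i\<in>I. f i x)"
  using assms by (induction I rule: infinite_finite_induct) (simp_all add: C1_on_const C1_on_add del: Ck_on.simps)

lemma C1_on_scaleR:
  fixes f :: "'a::euclidean_space \<Rightarrow> real"
  assumes f: "C1_on S f" and h: "C1_on S h"
  shows "C1_on S (\<lambda>x. f x *\<^sub>R h x)"
  by (rule C1_onI[of S _ "\<lambda>x v. f x *\<^sub>R frechet_derivative h (at x) v + frechet_derivative f (at x) v *\<^sub>R h x"])
    (auto intro!: has_derivative_scaleR continuous_intros C1_onD[OF f] C1_onD[OF h]
      C1_on_imp_continuous_on[OF f] C1_on_imp_continuous_on[OF h])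

lemma C1_on_mult:
  fixes f h :: "'a::euclidean_space \<Rightarrow> real"
  assumes "C1_on S f" and "C1_on S h"
  shows "C1_on S (\<lambda>x. f x * h x)"
  using C1_on_scaleR[OF assms] by simp

lemma C1_on_diff:
  assumes f: "C1_on S f" and h: "C1_on S h"
  shows "C1_on S (\<lambda>x. f x - h x)"
  using C1_on_add[OF f C1_on_linear_compose[OF h, of "\<lambda>x. - x"]] by (simp add: bounded_linear_minus bounded_linear_ident)

lemma C1_on_prod:
  fixes f :: "'i \<Rightarrow> 'a::euclidean_space \<Rightarrow> real"
  assumes "\<And>i. i \<in> I \<Longrightarrow> C1_on S (f i)"
  shows "C1_on S (\<lambda>x. \<Prod>i\<in>I. f i x)"
  using assms by (induction I rule: infinite_finite_induct) (simp_all add: C1_on_const C1_on_mult del: Ck_on.simps)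

lemma C1_on_det:
  fixes G :: "'a::euclidean_space \<Rightarrow> real ^ 'n ^ 'n"
  assumes "C1_on S G"
  shows "C1_on S (\<lambda>x. det (G x))"
  unfolding det_def
  by (intro C1_on_sum C1_on_mult C1_on_const C1_on_prod C1_on_linear_compose[OF assms]
     bounded_linear_compose[OF bounded_linear_vec_nth bounded_linear_vec_nth])

lemma C1_on_sqrt:
  assumes f: "C1_on S f" and "\<And>x. x \<in> S \<Longrightarrow> f x > 0"
  shows "C1_on S (\<lambda>x. sqrt (f x))"
  by (rule C1_onI[of S _ "\<lambda>x v. frechet_derivative f (at x) v * (inverse (sqrt (f x)) / 2)"])
    (use assms(2) in \<open>auto intro!: derivative_eq_intros continuous_intros C1_onD[OF f] 
      C1_on_imp_continuous_on[OF f] simp: less_imp_neq field_simps\<close>, force+)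

lemma C1_on_real_compose:
  fixes m :: "real \<Rightarrow> real"
  assumes f: "C1_on S f" and m: "\<And>s. (m has_field_derivative m' s) (at s)" "continuous_on UNIV m'"
  shows "C1_on S (\<lambda>x. m (f x))"
proof -
  have "C1_on UNIV m"
    by (rule C1_onI[of _ _ "\<lambda>x v. m' x * v"])
      (use m in \<open>auto simp: has_field_derivative_def intro!: continuous_intros\<close>)
  from C1_on_compose[OF f this] show ?thesis by simp
qed

section \<open>Bump functions of class C1, built from a truncated square\<close>

definition pos_square :: "real \<Rightarrow> real" where "pos_square s = (max 0 s)\<^sup>2"

lemma pos_square_deriv: "(pos_square has_field_derivative 2 * max 0 s) (at s)"
proof -
  consider "s > 0" | "s < 0" | "s = 0" by linarith
  then show ?thesis
  proof cases
    case 1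
    have "((\<lambda>s. s\<^sup>2) has_field_derivative 2 * max 0 s) (at s)"
      using 1 by (auto intro!: derivative_eq_intros)
    then show ?thesis
      by (rule has_field_derivative_transform_within_open[of _ _ _ "{0<..}"]) (use 1 in \<open>auto simp: pos_square_def\<close>)
  next
    case 2
    have "((\<lambda>s. 0) has_field_derivative 2 * max 0 s) (at s)"
      using 2 by (auto intro!: derivative_eq_intros)
    then show ?thesis
      by (rule has_field_derivative_transform_within_open[of _ _ _ "{..<0}"]) (use 2 in \<open>auto simp: pos_square_def\<close>)
  next
    case 3
    have "((\<lambda>h. pos_square h / h) \<longlongrightarrow> 0) (at 0)"
    proof (rule Lim_null_comparison[where g="\<lambda>h. \<bar>h\<bar>"])
      show "\<forall>\<^sub>F h in at 0. norm (pos_square h / h) \<le> \<bar>h\<bar>"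
        by (auto simp: pos_square_def eventually_at power2_eq_square max_def intro!: exI[of _ 1])
    qed (auto intro: tendsto_eq_intros)
    then show ?thesis using 3
      by (simp add: has_field_derivative_iff pos_square_def)
  qed
qed

lemma C1_on_pos_square:
  assumes "C1_on S f" shows "C1_on S (\<lambda>x. pos_square (f x))"
  by (rule C1_on_real_compose[OF assms pos_square_deriv]) (intro continuous_intros)

lemma C1_bump:
  fixes p :: "'a::euclidean_space"
  assumes "\<rho> > 0"
  obtains b :: "'a \<Rightarrow> real" where "C1_on UNIV b" "\<And>x. 0 \<le> b x" "\<And>x. b x \<le> 1"
    "\<And>x. x \<notin> ball p \<rho> \<Longrightarrow> b x = 0" "\<And>x. x \<in> ball p (\<rho>/2) \<Longrightarrow> b x = 1"
proof
  define q where "q = (\<lambda>x. pos_square (\<rho>\<^sup>2 - (x - p) \<bullet> (x - p)))"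
  \<comment> \<open>\<open>q\<close> vanishes off the ball, and \<open>b\<close> reaches 1 as soon
    as q >= \<rho>^4 / 2. On the half ball the argument of \<open>pos_square\<close> in
    \<open>q\<close> is at least 3/4 \<rho>^2, hence q >= 9/16 \<rho>^4, which is enough. The outer
    \<open>pos_square\<close> removes the excess and keeps the function C1.\<close>
  define b where "b = (\<lambda>x. 1 - pos_square (1 - 2/\<rho>^4 * q x))"
  have sq: "C1_on UNIV (\<lambda>x. (x - p) \<bullet> (x - p))"
    by (rule C1_onI[of _ _ "\<lambda>x v. (x - p) \<bullet> v + v \<bullet> (x - p)"])
      (auto intro!: derivative_eq_intros continuous_intros)
  show "C1_on UNIV b" unfolding b_def q_def
    by (intro C1_on_diff C1_on_const C1_on_pos_square C1_on_mult sq)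
  have q0: "q x \<ge> 0" for x by (simp add: q_def pos_square_def)
  have ps: "0 \<le> pos_square s" "s \<le> 1 \<Longrightarrow> pos_square s \<le> 1" for s
    by (auto simp: pos_square_def power2_eq_square max_def mult_le_one)
  show "b x \<le> 1" for x using ps by (simp add: b_def)
  show "0 \<le> b x" for x using ps(2)[of "1 - 2/\<rho>^4 * q x"] q0 assms by (simp add: b_def)
  show "b x = 0" if "x \<notin> ball p \<rho>" for x
  proof -
    have "\<rho> \<le> norm (x - p)" using that by (simp add: dist_norm norm_minus_commute)
    then have "\<rho>\<^sup>2 \<le> (norm (x - p))\<^sup>2" using assms by (simp add: power_mono)
    then have "q x = 0" by (simp add: q_def pos_square_def dot_square_norm)
    then show ?thesis by (simp add: b_def pos_square_def)
  qed
  show "b x = 1" if "x \<in> ball p (\<rho>/2)" for x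
  proof -
    have "norm (x - p) \<le> \<rho>/2" using that by (simp add: dist_norm norm_minus_commute)
    then have "(norm (x - p))\<^sup>2 \<le> (\<rho>/2)\<^sup>2" by (simp add: power_mono)
    then have *: "3/4 * \<rho>\<^sup>2 \<le> \<rho>\<^sup>2 - (x - p) \<bullet> (x - p)"
      by (simp add: dot_square_norm power2_eq_square field_simps)
    then have "(3/4 * \<rho>\<^sup>2)\<^sup>2 \<le> q x" unfolding q_def pos_square_def
      by (intro power_mono) (auto simp: le_max_iff_disj)
    then have "9/16 * \<rho>^4 \<le> q x" by (simp add: power_mult_distrib power2_eq_square field_simps eval_nat_numeral)
    moreover have "\<rho>^4 > 0" using assms by simp
    ultimately have "\<rho>^4 \<le> 2 * q x" by linarith
    then have "1 - 2/\<rho>^4 * q x \<le> 0" using assms by (simp add: field_simps)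
    then show ?thesis by (simp add: b_def pos_square_def)
  qed
qed

section \<open>Jacobi's formula for the derivative of a determinant\<close>

lemma det_has_derivative_id:
  "(det has_derivative (\<lambda>H::real^'n^'n. trace H)) (at (mat 1))"
proof -
  have nth: "((\<lambda>M::real^'n^'n. M $ i $ j) has_derivative (\<lambda>H. H $ i $ j)) F" for i j F
    by (rule bounded_linear_imp_has_derivative[OF bounded_linear_compose[OF bounded_linear_vec_nth bounded_linear_vec_nth]])
  define T where "T = (\<lambda>p (H::real^'n^'n). \<Sum>i\<in>UNIV. H$i$p i * (\<Prod>j\<in>UNIV-{i}. (mat 1 :: real^'n^'n)$j$p j))"
  have "((\<lambda>M. \<Prod>i\<in>UNIV. M$i$p i) has_derivative T p) (at (mat 1 :: real^'n^'n))" for p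
    unfolding T_def by (rule has_derivative_prod) (rule nth)
  then have "((\<lambda>M. \<Sum>p | p permutes UNIV. of_int (sign p) * (\<Prod>i\<in>UNIV. M$i$p i))
     has_derivative (\<lambda>H. \<Sum>p | p permutes UNIV. of_int (sign p) * T p H)) (at (mat 1 :: real^'n^'n))"
    by (intro has_derivative_sum has_derivative_mult_right)
  moreover have "(\<Sum>p | p permutes UNIV. of_int (sign p) * T p H) = trace H" for H
  proof -
    \<comment> \<open>A permutation other than \<open>id\<close> moves at least two points. After
      one factor of its product is differentiated, an off-diagonal entry of the identity matrix
      remains among the others.\<close>
    have T0: "T p H = 0" if p: "p permutes UNIV" "p \<noteq> id" for p
      unfolding T_def
    proof (rule sum.neutral, rule ballI)
      fix i
      obtain k where k: "p k \<noteq> k" using p(2) by (metis eq_id_iff)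
      have "\<exists>j. j \<noteq> i \<and> p j \<noteq> j"
      proof (cases "k = i")
        case True
        have "p (p k) \<noteq> p k" using k p(1) permutes_inj by (metis injD)
        then show ?thesis using True k by metis
      qed (use k in auto)
      then obtain j where "j \<noteq> i" "p j \<noteq> j" by blast
      then have "(\<Prod>j\<in>UNIV-{i}. (mat 1 :: real^'n^'n)$j$p j) = 0"
        by (intro prod_zero) (auto simp: mat_def intro!: bexI[of _ j])
      then show "H$i$p i * (\<Prod>j\<in>UNIV-{i}. (mat 1 :: real^'n^'n)$j$p j) = 0" by simp
    qed
    have "(\<Sum>p | p permutes UNIV. of_int (sign p) * T p H) = (\<Sum>p\<in>{id}. of_int (sign p) * T p H)"
      by (rule sum.mono_neutral_right) (auto simp: T0 permutes_id)
    also have "\<dots> = trace H" by (simp add: T_def trace_def mat_def sign_id)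
    finally show ?thesis .
  qed
  ultimately show ?thesis by (simp add: det_def[abs_def])
qed

lemma matrix_inv_mult:
  fixes M :: "real ^ 'n ^ 'n"
  assumes "invertible M"
  shows "M ** matrix_inv M = mat 1" "matrix_inv M ** M = mat 1"
  using someI_ex[of "\<lambda>M'. M ** M' = mat 1 \<and> M' ** M = mat 1"] assms
  unfolding invertible_def matrix_inv_def by blast+

text \<open>Multiplying by the inverse of \<open>G x\<close> moves the base point to the identity
  matrix, where the derivative of \<open>det\<close> is the trace; the factor
  \<open>det (G x)\<close> undoes this normalisation.\<close>

lemma has_derivative_det:
  fixes G :: "'a::real_normed_vector \<Rightarrow> real ^ 'n ^ 'n"
  assumes G: "(G has_derivative G') (at x)" and inv: "invertible (G x)"
  shows "((\<lambda>y. det (G y)) has_derivative (\<lambda>v. det (G x) * trace (matrix_inv (G x) ** G' v))) (at x)"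
proof -
  let ?B = "matrix_inv (G x)"
  have B: "?B ** G x = mat 1" "G x ** ?B = mat 1" using matrix_inv_mult[OF inv] by auto
  have bl: "bounded_linear (\<lambda>M::real^'n^'n. ?B ** M)"
    by (rule linear_conv_bounded_linear[THEN iffD1], rule linearI)
       (simp_all add: matrix_add_ldistrib matrix_scalar_ac scalar_mult_eq_scaleR[symmetric] scalar_matrix_assoc vec_eq_iff matrix_matrix_mult_def sum_distrib_left algebra_simps sum.distrib)
  have "((\<lambda>y. ?B ** G y) has_derivative (\<lambda>v. ?B ** G' v)) (at x)"
    by (rule bounded_linear.has_derivative[OF bl G])
  then have "((\<lambda>y. det (?B ** G y)) has_derivative (\<lambda>v. trace (?B ** G' v))) (at x)"
    using diff_chain_at[of "\<lambda>y. ?B ** G y" "\<lambda>v. ?B ** G' v" x det trace] B det_has_derivative_id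
    by (simp add: o_def)
  then have "((\<lambda>y. det (G x) * det (?B ** G y)) has_derivative (\<lambda>v. det (G x) * trace (?B ** G' v))) (at x)"
    by (rule has_derivative_mult_right)
  moreover have "det (G x) * det (?B ** G y) = det (G y)" for y
    by (metis B(2) det_mul matrix_mul_assoc matrix_mul_lid)
  ultimately show ?thesis by simp
qed

section \<open>Quadratic forms and integration by parts\<close>

lemma norm_matrix_vector_le:
  fixes H :: "real ^ 'n ^ 'm"
  shows "norm (H *v v) \<le> norm H * norm v"
proof -
  have "norm (H *v v) \<le> L2_set (\<lambda>i. norm (H $ i) * norm v) UNIV"
    unfolding norm_vec_def[of "H *v v"]
    by (intro L2_set_mono) (auto simp: matrix_vector_mul_component Cauchy_Schwarz_ineq2)
  also have "\<dots> = norm H * norm v"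
    by (simp add: norm_vec_def[of H] L2_set_left_distrib)
  finally show ?thesis .
qed

lemma abs_quadratic_form_le:
  fixes H :: "real ^ 'n ^ 'n"
  shows "\<bar>v \<bullet> (H *v v)\<bar> \<le> norm H * (v \<bullet> v)"
proof -
  have "\<bar>v \<bullet> (H *v v)\<bar> \<le> norm v * norm (H *v v)" by (rule Cauchy_Schwarz_ineq2)
  also have "\<dots> \<le> norm v * (norm H * norm v)" by (intro mult_left_mono norm_matrix_vector_le) auto
  finally show ?thesis by (simp add: dot_square_norm power2_eq_square mult_ac)
qed

lemma quadratic_form_scaleR: "(c *\<^sub>R v) \<bullet> (P *v (c *\<^sub>R v)) = c\<^sup>2 * (v \<bullet> (P *v v))"
  for P :: "real ^ 'n ^ 'n"
  by (simp add: matrix_vector_mult_scaleR power2_eq_square)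

lemma continuous_on_quadratic_form:
  fixes P :: "'a::topological_space \<Rightarrow> real ^ 'n ^ 'n"
  assumes "continuous_on S P" "continuous_on S v"
  shows "continuous_on S (\<lambda>x. v x \<bullet> (P x *v v x))"
proof -
  have "continuous_on S (\<lambda>x. \<Sum>i\<in>UNIV. v x $ i * (\<Sum>j\<in>UNIV. P x $ i $ j * v x $ j))"
    by (intro continuous_intros continuous_on_component assms)
  then show ?thesis by (simp add: inner_vec_def matrix_vector_mult_def)
qed

text \<open>The form attains a positive minimum on the compact product of \<open>K\<close> with the
  unit sphere; homogeneity of degree two extends the bound to all vectors.\<close>

lemma pos_def_lower_bound:
  fixes P :: "'a::topological_space \<Rightarrow> real ^ 'n ^ 'n"
  assumes K: "compact K" and P: "continuous_on K P" and pos: "\<And>x v. x \<in> K \<Longrightarrow> v \<noteq> 0 \<Longrightarrow> v \<bullet> (P x *v v) > 0"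
  obtains m where "m > 0" "\<And>x v. x \<in> K \<Longrightarrow> m * (v \<bullet> v) \<le> v \<bullet> (P x *v v)"
proof (cases "K = {}")
  case True
  then show ?thesis by (intro that[of 1]) auto
next
  case False
  let ?S = "K \<times> sphere (0::real^'n) 1"
  have "compact ?S" using K by (intro compact_Times) auto
  moreover have "?S \<noteq> {}" using False by (auto intro!: exI[of _ "axis undefined 1"])
  moreover have "continuous_on ?S (\<lambda>z. snd z \<bullet> (P (fst z) *v snd z))"
    by (intro continuous_on_quadratic_form continuous_on_compose2[OF P] continuous_intros) auto
  ultimately have "\<exists>z\<in>?S. \<forall>y\<in>?S. snd z \<bullet> (P (fst z) *v snd z) \<le> snd y \<bullet> (P (fst y) *v snd y)"
    by (rule continuous_attains_inf)
  then obtain z where z: "z \<in> ?S" and min: "\<And>y. y \<in> ?S \<Longrightarrow> snd z \<bullet> (P (fst z) *v snd z) \<le> snd y \<bullet> (P (fst y) *v snd y)"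
    by blast
  let ?m = "snd z \<bullet> (P (fst z) *v snd z)"
  show ?thesis
  proof (rule that)
    show "?m > 0" using z by (intro pos) (auto simp: mem_Times_iff)
    show "?m * (v \<bullet> v) \<le> v \<bullet> (P x *v v)" if "x \<in> K" for x v
    proof (cases "v = 0")
      case False
      define c where "c = norm v"
      have c: "c > 0" using False by (simp add: c_def)
      define w where "w = (1/c) *\<^sub>R v"
      have v: "v = c *\<^sub>R w" using c by (simp add: w_def)
      have "norm w = 1" using c by (simp add: w_def c_def)
      then have "?m \<le> w \<bullet> (P x *v w)" using min[of "(x, w)"] that by simp
      then have "c\<^sup>2 * ?m \<le> c\<^sup>2 * (w \<bullet> (P x *v w))" by (simp add: mult_left_mono)
      then show ?thesis unfolding v quadratic_form_scaleR
        using \<open>norm w = 1\<close> by (simp add: power2_eq_square mult_ac norm_eq_1)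
    qed simp
  qed
qed

text \<open>If m bounds the form at \<open>p\<close> from below on unit vectors, changing the matrix
  by less than m / 2 changes the form by at most half its value at \<open>p\<close>. The ratio 2 is
  universal, which keeps later constants independent of point and chart.\<close>

lemma pos_def_locally_comparable:
  fixes G :: "'a::metric_space \<Rightarrow> real ^ 'n ^ 'n"
  assumes "open S" "p \<in> S" "continuous_on S G" and pos: "\<And>v. v \<noteq> 0 \<Longrightarrow> v \<bullet> (G p *v v) > 0"
  obtains \<rho> where "\<rho> > 0" "ball p \<rho> \<subseteq> S" 
    "\<And>x v. x \<in> ball p \<rho> \<Longrightarrow> v \<bullet> (G x *v v) \<le> 2 * (v \<bullet> (G p *v v)) \<and> v \<bullet> (G p *v v) \<le> 2 * (v \<bullet> (G x *v v))"
proof -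
  obtain m where m: "m > 0" "\<And>v. m * (v \<bullet> v) \<le> v \<bullet> (G p *v v)"
    by (rule pos_def_lower_bound[of "{p}" G]) (use pos in auto)
  obtain e where e: "e > 0" "ball p e \<subseteq> S" using assms(1,2) by (meson openE)
  obtain d where d: "d > 0" "\<And>x. x \<in> S \<Longrightarrow> dist x p < d \<Longrightarrow> dist (G x) (G p) < m/2"
    using assms(2,3) m(1) unfolding continuous_on_iff by (meson half_gt_zero)
  show ?thesis
  proof (rule that[of "min e d"])
    show "min e d > 0" "ball p (min e d) \<subseteq> S" using e d by auto
    fix x and v :: "real^'n" assume x: "x \<in> ball p (min e d)"
    then have "x \<in> S" "dist x p < d" using e by (auto simp: dist_commute)
    from d(2)[OF this] have "norm (G x - G p) < m/2" by (simp add: dist_norm)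
    then have "norm (G x - G p) * (v \<bullet> v) \<le> m/2 * (v \<bullet> v)" by (intro mult_right_mono) auto
    with abs_quadratic_form_le[of v "G x - G p"]
    have "\<bar>v \<bullet> (G x *v v) - v \<bullet> (G p *v v)\<bar> \<le> m/2 * (v \<bullet> v)"
      by (simp add: matrix_vector_mult_diff_rdistrib inner_diff_right)
    moreover have "m/2 * (v \<bullet> v) \<le> (v \<bullet> (G p *v v)) / 2" using m(2)[of v] by simp
    ultimately show "v \<bullet> (G x *v v) \<le> 2 * (v \<bullet> (G p *v v)) \<and> v \<bullet> (G p *v v) \<le> 2 * (v \<bullet> (G x *v v))"
    proof -
      assume *: "\<bar>v \<bullet> (G x *v v) - v \<bullet> (G p *v v)\<bar> \<le> m/2 * (v \<bullet> v)"
        "m/2 * (v \<bullet> v) \<le> (v \<bullet> (G p *v v)) / 2"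
      have "0 \<le> m/2 * (v \<bullet> v)" using m(1) by simp
      with * show ?thesis by linarith
    qed
  qed
qed

text \<open>An Auerbach basis: a matrix of maximal determinant among those with rows in the unit ball of
  the norm. It replaces an orthonormal basis, whose construction would need Gram--Schmidt.\<close>
lemma auerbach_basis:
  fixes P :: "real ^ 'n ^ 'n"
  assumes pos: "\<And>v. v \<noteq> 0 \<Longrightarrow> v \<bullet> (P *v v) > 0"
  obtains E :: "real ^ 'n ^ 'n" where "invertible E" "\<And>a. E $ a \<bullet> (P *v E $ a) \<le> 1"
    "\<And>x a. \<bar>x $ a\<bar> \<le> sqrt ((transpose E *v x) \<bullet> (P *v (transpose E *v x)))"
proof -
  have "\<exists>m>0. \<forall>v. m * (v \<bullet> v) \<le> v \<bullet> (P *v v)"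
  proof -
    have "continuous_on {0::real} (\<lambda>_. P)" by simp
    from pos_def_lower_bound[OF _ this] pos show ?thesis by (metis compact_insert compact_empty insertI1)
  qed
  then obtain m where m: "m > 0" "\<And>v. m * (v \<bullet> v) \<le> v \<bullet> (P *v v)" by blast
  \<comment> \<open>The competitors are the matrices whose rows all lie in the unit ball of
    \<open>P\<close>. The set is closed, and bounded through m, so |det| attains a maximum on
    it.\<close>
  define K where "K = {M::real^'n^'n. \<forall>a. M $ a \<bullet> (P *v M $ a) \<le> 1}"
  have "closed {M::real^'n^'n. M $ a \<bullet> (P *v M $ a) \<le> 1}" for a
    by (intro closed_Collect_le continuous_on_quadratic_form continuous_intros)
  moreover have "K = (\<Inter>a. {M. M $ a \<bullet> (P *v M $ a) \<le> 1})" by (auto simp: K_def)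
  ultimately have "closed K" by auto
  moreover have "bounded K"
  proof -
    have "norm M \<le> (\<Sum>a\<in>(UNIV::'n set). sqrt (1/m))" if "M \<in> K" for M
    proof -
      have "norm (M $ a) \<le> sqrt (1/m)" for a
      proof (rule real_le_rsqrt)
        have "m * (M $ a \<bullet> M $ a) \<le> 1" using m(2)[of "M $ a"] that order_trans by (fastforce simp: K_def)
        then show "(norm (M $ a))\<^sup>2 \<le> 1/m" using m(1) by (simp add: dot_square_norm field_simps)
      qed
      then have "(\<Sum>a\<in>UNIV. norm (M $ a)) \<le> (\<Sum>a\<in>(UNIV::'n set). sqrt (1/m))" by (intro sum_mono) auto
      moreover have "norm M \<le> (\<Sum>a\<in>UNIV. norm (M $ a))"
        unfolding norm_vec_def[of M] by (rule L2_set_le_sum) simp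
      ultimately show ?thesis by linarith
    qed
    then show ?thesis unfolding bounded_iff by blast
  qed
  ultimately have cK: "compact K" by (simp add: compact_eq_bounded_closed)
  have cdet: "continuous_on K (\<lambda>M. \<bar>det M\<bar>)"
    unfolding det_def by (intro continuous_intros)
  \<comment> \<open>A multiple of the identity small enough to lie in \<open>K\<close>; its nonzero
    determinant shows that the maximum is nonzero. The summand 1 avoids division by zero.\<close>
  define c where "c = 1 / sqrt (norm P + 1)"
  have c: "c > 0" "c\<^sup>2 * norm P \<le> 1" 
  proof -
    have "norm P + 1 > 0" by (simp add: add_nonneg_pos)
    then show "c > 0" "c\<^sup>2 * norm P \<le> 1" by (simp_all add: c_def power_divide)
  qed
  have cK1: "(c *\<^sub>R mat 1 :: real^'n^'n) \<in> K"
  proof -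
    have "(c *\<^sub>R mat 1 :: real^'n^'n) $ a = c *\<^sub>R axis a 1" for a
      by (simp add: vec_eq_iff mat_def axis_def)
    moreover have "axis a 1 \<bullet> (P *v axis a 1) \<le> norm P" for a :: 'n
      using abs_quadratic_form_le[of "axis a 1" P] by (simp add: inner_axis_axis)
    then have "c\<^sup>2 * (axis a 1 \<bullet> (P *v axis a 1)) \<le> 1" for a :: 'n
      using c(2) mult_left_mono[of "axis a 1 \<bullet> (P *v axis a 1)" "norm P" "c\<^sup>2"] by (meson order_trans zero_le_power2)
    ultimately show ?thesis unfolding K_def by (simp only: quadratic_form_scaleR mem_Collect_eq simp_thms)
  qed
  have "det (c *\<^sub>R mat 1 :: real^'n^'n) \<noteq> 0"
    using c by (subst det_diagonal) (auto simp: mat_def)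
  obtain E where E: "E \<in> K" and max: "\<And>M. M \<in> K \<Longrightarrow> \<bar>det M\<bar> \<le> \<bar>det E\<bar>"
    using continuous_attains_sup[OF cK _ cdet] cK1 by blast
  have dE: "det E \<noteq> 0" using max[OF cK1] \<open>det (c *\<^sub>R mat 1 :: real^'n^'n) \<noteq> 0\<close> by auto
  show ?thesis
  proof (rule that)
    show "invertible E" using dE by (simp add: invertible_det_nz)
    show "E $ a \<bullet> (P *v E $ a) \<le> 1" for a using E by (simp add: K_def)
    fix x :: "real^'n" and a
    define v where "v = transpose E *v x"
    have v: "v = (\<Sum>i\<in>UNIV. x $ i *s row i E)"
      by (simp add: v_def vec_eq_iff matrix_vector_mult_def transpose_def row_def mult_ac)
    define q where "q = v \<bullet> (P *v v)"
    show "\<bar>x $ a\<bar> \<le> sqrt ((transpose E *v x) \<bullet> (P *v (transpose E *v x)))"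
      unfolding v_def[symmetric]
    proof (cases "v = 0")
      case True
      have "det (\<chi> i. if i = a then v else row i E) = x $ a * det E"
        unfolding v by (rule cramer_lemma_transpose)
      moreover have "det (\<chi> i. if i = a then v else row i E) = 0"
        by (rule det_zero_row(2)[of a]) (simp add: True row_def vec_eq_iff)
      ultimately have "x $ a * det E = 0" by simp
      then show "\<bar>x $ a\<bar> \<le> sqrt (v \<bullet> (P *v v))" using dE True by simp
    next
      case False
      then have q: "q > 0" unfolding q_def by (rule pos)
      define y where "y = (1 / sqrt q) *\<^sub>R x"
      define w where "w = (\<Sum>i\<in>UNIV. y $ i *s row i E)"
      have w: "w = (1 / sqrt q) *\<^sub>R v"
        unfolding w_def v y_def by (simp add: scaleR_right.sum scalar_mult_eq_scaleR)
      have "w \<bullet> (P *v w) = 1" unfolding w quadratic_form_scaleR q_def[symmetric]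
        using q by (simp add: power_divide)
      \<comment> \<open>Exchanging row \<open>a\<close> for the normalised vector \<open>w\<close>
        stays in \<open>K\<close> and, by Cramer's rule, multiplies the determinant by
        \<open>y $ a\<close>; maximality forces this factor to be at most 1 in absolute
        value.\<close>
      then have "(\<chi> i. if i = a then w else row i E) \<in> K"
        using E by (auto simp: K_def row_def)
      from max[OF this] have "\<bar>y $ a * det E\<bar> \<le> \<bar>det E\<bar>"
        using cramer_lemma_transpose[of a y E] by (simp add: w_def cong: if_cong)
      then have "\<bar>y $ a\<bar> \<le> 1" using dE by (simp add: abs_mult)
      then show "\<bar>x $ a\<bar> \<le> sqrt (v \<bullet> (P *v v))" using q by (simp add: y_def q_def[symmetric])
    qed
  qed
qed

section \<open>Integration by parts with difference quotients\<close>

lemma integrable_indicator_compact: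
  fixes K :: "'a::euclidean_space set"
  assumes "compact K"
  shows "integrable lborel (\<lambda>x. C * indicator K x :: real)"
  using assms emeasure_bounded_finite[OF compact_imp_bounded[OF assms]]
  by (intro integrable_mult_right integrable_real_indicator) (auto simp: compact_imp_closed borel_closed)

lemma integrable_compact_support:
  fixes f :: "'a::euclidean_space \<Rightarrow> real"
  assumes "f \<in> borel_measurable borel" "compact K" "\<And>x. x \<notin> K \<Longrightarrow> f x = 0" "\<And>x. \<bar>f x\<bar> \<le> C"
  shows "integrable lborel f"
proof (rule Bochner_Integration.integrable_bound)
  show "integrable lborel (\<lambda>x. C * indicator K x)"
    by (rule integrable_indicator_compact[OF assms(2)])
  show "AE x in lborel. norm (f x) \<le> norm (C * indicator K x)"
  proof (rule AE_I2)
    fix x show "norm (f x) \<le> norm (C * indicator K x)"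
      using assms(3)[of x] assms(4)[of x] by (cases "x \<in> K") auto
  qed
qed (use assms in simp)

text \<open>Integration by parts against a test function \<open>W\<close>, with the derivative of \<open>\<eta>\<close> replaced by its
  difference quotients; \<open>\<eta>\<close> itself need not be differentiable anywhere.\<close>
lemma integral_directional_derivative_bound:
  fixes W :: "'a::euclidean_space \<Rightarrow> real"
  assumes W: "C1_on UNIV W" and K: "compact K" "\<And>x. x \<notin> K \<Longrightarrow> W x = 0"
    and \<eta>: "\<eta> \<in> borel_measurable borel" "\<And>x. \<bar>\<eta> x\<bar> \<le> 1"
    and \<delta>: "0 < \<delta>" "\<And>h x. 0 < h \<Longrightarrow> h < \<delta> \<Longrightarrow> W x \<noteq> 0 \<Longrightarrow> \<bar>\<eta> (x + h *\<^sub>R e) - \<eta> x\<bar> \<le> h * B x"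
    and B: "integrable lborel (\<lambda>x. \<bar>W x\<bar> * B x)"
  shows "integrable lborel (\<lambda>x. \<eta> x * frechet_derivative W (at x) e)"
    and "\<bar>\<integral>x. \<eta> x * frechet_derivative W (at x) e \<partial>lborel\<bar> \<le> (\<integral>x. \<bar>W x\<bar> * B x \<partial>lborel)"
proof -
  define D where "D = (\<lambda>x. frechet_derivative W (at x) e)"
  have cW: "continuous_on UNIV W" by (rule C1_on_imp_continuous_on[OF W])
  have cD: "continuous_on UNIV D" unfolding D_def by (rule C1_onD(2)[OF W])
  have mW: "W \<in> borel_measurable borel" and mD: "D \<in> borel_measurable borel"
    using cW cD by (auto intro: borel_measurable_continuous_onI)
  have der: "((\<lambda>t. W (x + t *\<^sub>R e)) has_field_derivative D (x + t *\<^sub>R e)) (at t)" for x t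
  proof -
    have "((\<lambda>t. W (x + t *\<^sub>R e)) has_derivative (\<lambda>s. frechet_derivative W (at (x + t *\<^sub>R e)) (s *\<^sub>R e))) (at t)"
      by (rule has_derivative_compose[OF _ C1_onD(1)[OF W]]) (auto intro!: derivative_eq_intros)
    moreover have "frechet_derivative W (at y) (s *\<^sub>R e) = D y * s" for y s
      unfolding D_def using linear_frechet_derivative[of W "at y"] W by (simp add: linear_cmul)
    ultimately show ?thesis by (simp add: has_field_derivative_def)
  qed
  have D0: "D x = 0" if "x \<notin> K" for x
  proof -
    have "((\<lambda>x. 0) has_derivative (\<lambda>v. 0)) (at x)" by simp
    then have "(W has_derivative (\<lambda>v. 0)) (at x)"
      by (rule has_derivative_transform_within_open[of _ _ _ _ "- K"])
         (use K that in \<open>auto simp: compact_imp_closed\<close>)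
    from frechet_derivative_at[OF this, symmetric] show ?thesis by (simp add: D_def)
  qed
  obtain C where C: "\<And>x. \<bar>D x\<bar> \<le> C"
  proof -
    have "compact (D ` K)" by (rule compact_continuous_image) (auto intro: continuous_on_subset[OF cD] K)
    then obtain C where C: "\<And>y. y \<in> D ` K \<Longrightarrow> norm y \<le> C" using compact_imp_bounded bounded_iff by metis
    have "\<bar>D x\<bar> \<le> max C 0" for x using D0[of x] C[of "D x"] by (cases "x \<in> K") auto
    then show ?thesis by (rule that)
  qed
  have C0: "C \<ge> 0" using C[of 0] by linarith
  obtain CW where CW: "\<And>x. \<bar>W x\<bar> \<le> CW"
  proof -
    have "compact (W ` K)" by (rule compact_continuous_image) (auto intro: continuous_on_subset[OF cW] K)
    then obtain C where C: "\<And>y. y \<in> W ` K \<Longrightarrow> norm y \<le> C" using compact_imp_bounded bounded_iff by metis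
    have "\<bar>W x\<bar> \<le> max C 0" for x using K(2)[of x] C[of "W x"] by (cases "x \<in> K") auto
    then show ?thesis by (rule that)
  qed
  \<comment> \<open>The offset 2 keeps every step strictly below \<delta>, including the one for k =
    0.\<close>
  define h where "h = (\<lambda>k::nat. \<delta> / real (k + 2))"
  have h: "0 < h k" "h k < \<delta>" for k using \<delta>(1) by (auto simp: h_def field_simps add_pos_nonneg)
  have h0: "h \<longlonglongrightarrow> 0" unfolding h_def
    using LIMSEQ_ignore_initial_segment[OF lim_const_over_n[of \<delta>], of 2] by simp
  \<comment> \<open>The set swept out by \<open>K\<close> under translations along \<open>e\<close>
    up to parameter \<delta>. It contains the supports of all quotients below, so one multiple of
    its indicator dominates them.\<close>
  define K' where "K' = (\<lambda>(x, s). x + s *\<^sub>R e) ` (K \<times> {0..\<delta>})"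
  have cK': "compact K'" unfolding K'_def using K(1)
    by (intro compact_continuous_image compact_Times) (auto intro!: continuous_intros simp: case_prod_unfold)
  \<comment> \<open>A backward quotient of \<open>W\<close>: translating the integral by the step
    turns it into a forward quotient of \<eta>, which is the one bounded by hypothesis.\<close>
  define q where "q = (\<lambda>k x. \<eta> x * ((W x - W (x - h k *\<^sub>R e)) / h k))"
  have lim: "(\<lambda>k. q k x) \<longlonglongrightarrow> \<eta> x * D x" for x
  proof -
    have "((\<lambda>t. (W (x + t *\<^sub>R e) - W x) / t) \<longlongrightarrow> D x) (at 0)"
      using der[of x 0] by (simp add: has_field_derivative_iff)
    moreover have "filterlim (\<lambda>k. - h k) (at 0) sequentially"
      unfolding filterlim_at using h tendsto_minus[OF h0] by (auto simp: less_imp_neq[symmetric])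
    ultimately have "(\<lambda>k. (W (x + (- h k) *\<^sub>R e) - W x) / (- h k)) \<longlonglongrightarrow> D x"
      by (rule filterlim_compose)
    moreover have "(W (x + (- h k) *\<^sub>R e) - W x) / (- h k) = (W x - W (x - h k *\<^sub>R e)) / h k" for k
      using h(1)[of k] by (simp add: field_simps)
    ultimately show ?thesis unfolding q_def by (intro tendsto_intros) simp
  qed
  have qbound: "\<bar>q k x\<bar> \<le> C * indicator K' x" for k x
  proof (cases "x \<in> K'")
    case True
    have "\<exists>z>0. z < h k \<and> W (x - h k *\<^sub>R e + h k *\<^sub>R e) - W (x - h k *\<^sub>R e + 0 *\<^sub>R e) = (h k - 0) * D (x - h k *\<^sub>R e + z *\<^sub>R e)"
      by (rule MVT2) (use h in \<open>auto intro: der\<close>)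
    then obtain z where "W x - W (x - h k *\<^sub>R e) = h k * D (x - h k *\<^sub>R e + z *\<^sub>R e)" by auto
    then have "\<bar>(W x - W (x - h k *\<^sub>R e)) / h k\<bar> \<le> C" using h(1)[of k] C by (simp add: abs_mult)
    then have "\<bar>q k x\<bar> \<le> 1 * C" unfolding q_def abs_mult using \<eta>(2) C0 by (intro mult_mono) auto
    then show ?thesis using True by simp
  next
    case False
    have "x \<notin> K" using False \<delta>(1) unfolding K'_def by (force simp: image_iff)
    moreover have "x - h k *\<^sub>R e \<notin> K"
    proof
      assume "x - h k *\<^sub>R e \<in> K"
      then have "x \<in> K'" unfolding K'_def using h[of k] by (intro image_eqI[of _ _ "(x - h k *\<^sub>R e, h k)"]) auto
      with False show False by simp
    qed
    ultimately show ?thesis using False by (simp add: q_def K(2))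
  qed
  have mq: "q k \<in> borel_measurable borel" for k
    unfolding q_def using mW \<eta>(1) by measurable
  have iK': "integrable lborel (\<lambda>x. C * indicator K' x)"
    by (rule integrable_indicator_compact[OF cK'])
  have "integrable lborel (\<lambda>x. \<eta> x * D x)"
  proof (rule integrable_compact_support[OF _ K(1)])
    show "\<bar>\<eta> x * D x\<bar> \<le> 1 * C" for x unfolding abs_mult using \<eta>(2) C C0 by (intro mult_mono) auto
  qed (use D0 mD \<eta> in auto)
  then show "integrable lborel (\<lambda>x. \<eta> x * frechet_derivative W (at x) e)" by (simp add: D_def)
  have conv: "(\<lambda>k. integral\<^sup>L lborel (q k)) \<longlonglongrightarrow> (\<integral>x. \<eta> x * D x \<partial>lborel)"
    by (rule integral_dominated_convergence[where w="\<lambda>x. C * indicator K' x"])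
      (use mq mD \<eta> lim iK' qbound in auto)
  have "\<bar>integral\<^sup>L lborel (q k)\<bar> \<le> (\<integral>x. \<bar>W x\<bar> * B x \<partial>lborel)" for k
  proof -
    have bd: "\<bar>\<eta> y * W x\<bar> \<le> 1 * CW" for x y unfolding abs_mult using \<eta>(2) CW C0 by (intro mult_mono) auto
    have i1: "integrable lborel (\<lambda>x. \<eta> x * W x)"
      by (rule integrable_compact_support[OF _ K(1) _ bd]) (use K(2) mW \<eta> in auto)
    have i2: "integrable lborel (\<lambda>x. \<eta> (x + h k *\<^sub>R e) * W x)"
      by (rule integrable_compact_support[OF _ K(1) _ bd]) (use K(2) mW \<eta> in auto)
    have sh: "lborel = distr lborel borel (\<lambda>x. h k *\<^sub>R e + x)" using lborel_distr_plus[of "h k *\<^sub>R e"] by simp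
    have m3: "(\<lambda>x. \<eta> x * W (x - h k *\<^sub>R e)) \<in> borel_measurable borel" using mW \<eta>(1) by measurable
    have i3: "integrable lborel (\<lambda>x. \<eta> x * W (x - h k *\<^sub>R e))"
      by (subst sh, subst integrable_distr_eq) (use m3 i2 in \<open>auto simp: add.commute\<close>)
    \<comment> \<open>Translation invariance of Lebesgue measure moves the shift from
      \<open>W\<close> to \<eta>; this is the discrete form of integration by parts.\<close>
    have e3: "(\<integral>x. \<eta> x * W (x - h k *\<^sub>R e) \<partial>lborel) = (\<integral>x. \<eta> (x + h k *\<^sub>R e) * W x \<partial>lborel)"
      by (subst sh, subst integral_distr) (use m3 in \<open>auto simp: add.commute\<close>)
    have "integral\<^sup>L lborel (q k) = (\<integral>x. (\<eta> x * W x - \<eta> x * W (x - h k *\<^sub>R e)) / h k \<partial>lborel)"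
      by (simp add: q_def algebra_simps)
    also have "\<dots> = (\<integral>x. (\<eta> x - \<eta> (x + h k *\<^sub>R e)) * W x / h k \<partial>lborel)"
      using i1 i2 i3 e3 by (simp add: left_diff_distrib)
    also have "\<bar>\<dots>\<bar> \<le> (\<integral>x. \<bar>(\<eta> x - \<eta> (x + h k *\<^sub>R e)) * W x / h k\<bar> \<partial>lborel)"
      by (rule integral_abs_bound)
    also have "\<dots> \<le> (\<integral>x. \<bar>W x\<bar> * B x \<partial>lborel)"
    proof (rule integral_mono)
      show "integrable lborel (\<lambda>x. \<bar>(\<eta> x - \<eta> (x + h k *\<^sub>R e)) * W x / h k\<bar>)"
        using i1 i2 by (simp add: left_diff_distrib)
      show "\<bar>(\<eta> x - \<eta> (x + h k *\<^sub>R e)) * W x / h k\<bar> \<le> \<bar>W x\<bar> * B x" for x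
      proof (cases "W x = 0")
        case False
        have "\<bar>\<eta> x - \<eta> (x + h k *\<^sub>R e)\<bar> \<le> h k * B x" using \<delta>(2)[OF h False] by (simp add: abs_minus_commute)
        then have "\<bar>\<eta> x - \<eta> (x + h k *\<^sub>R e)\<bar> * \<bar>W x\<bar> \<le> (h k * B x) * \<bar>W x\<bar>" by (rule mult_right_mono) simp
        then show ?thesis using h(1)[of k] by (simp add: abs_mult pos_divide_le_eq mult_ac)
      qed simp
    qed (rule B)
    finally show ?thesis .
  qed
  then have "\<bar>\<integral>x. \<eta> x * D x \<partial>lborel\<bar> \<le> (\<integral>x. \<bar>W x\<bar> * B x \<partial>lborel)"
    by (intro LIMSEQ_le_const2[OF tendsto_rabs[OF conv]]) auto
  then show "\<bar>\<integral>x. \<eta> x * frechet_derivative W (at x) e \<partial>lborel\<bar> \<le> (\<integral>x. \<bar>W x\<bar> * B x \<partial>lborel)"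
    by (simp add: D_def)
qed

section \<open>Change of variables\<close>

text \<open>The change of variables theorems of the library need a well-ordered index type; a copy of a
  finite type is well-ordered through an arbitrary enumeration.\<close>

typedef 'n wo = "UNIV :: 'n set" morphisms of_wo to_wo
  by simp

lemma bij_of_wo: "bij (of_wo :: 'n wo \<Rightarrow> 'n)"
  by (metis UNIV_I bijI' of_wo_inject to_wo_inverse)

instantiation wo :: (finite) "{finite, wellorder}"
begin

definition wo_rank :: "'a wo \<Rightarrow> nat" where
  "wo_rank = (\<lambda>x. (SOME f :: 'a \<Rightarrow> nat. inj f) (of_wo x))"

definition less_eq_wo :: "'a wo \<Rightarrow> 'a wo \<Rightarrow> bool" where
  "less_eq_wo x y \<longleftrightarrow> wo_rank x \<le> wo_rank y"

definition less_wo :: "'a wo \<Rightarrow> 'a wo \<Rightarrow> bool" where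
  "less_wo x y \<longleftrightarrow> wo_rank x < wo_rank y"

instance
proof
  have "\<exists>f :: 'a \<Rightarrow> nat. inj f"
    using finite_imp_inj_to_nat_seg[of "UNIV :: 'a set"] by auto
  then have "inj (SOME f :: 'a \<Rightarrow> nat. inj f)" by (rule someI_ex)
  then have inj: "wo_rank x = wo_rank y \<Longrightarrow> x = y" for x y :: "'a wo"
    unfolding wo_rank_def by (simp add: inj_eq of_wo_inject)
  show "finite (UNIV :: 'a wo set)"
    by (rule bij_betw_finite[THEN iffD2, OF bij_of_wo]) simp
  fix x y z :: "'a wo"
  show "(x < y) = (x \<le> y \<and> \<not> y \<le> x)" by (auto simp: less_wo_def less_eq_wo_def)
  show "x \<le> x" by (simp add: less_eq_wo_def)
  show "x \<le> y \<Longrightarrow> y \<le> z \<Longrightarrow> x \<le> z" by (simp add: less_eq_wo_def)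
  show "x \<le> y \<Longrightarrow> y \<le> x \<Longrightarrow> x = y" by (simp add: less_eq_wo_def inj)
  show "x \<le> y \<or> y \<le> x" by (auto simp: less_eq_wo_def)
  fix P :: "'a wo \<Rightarrow> bool" and a
  assume *: "\<And>x. (\<And>y. y < x \<Longrightarrow> P y) \<Longrightarrow> P x"
  show "P a"
    by (induction a rule: measure_induct_rule[of wo_rank]) (rule *, simp add: less_wo_def)
qed

end

section \<open>Renaming coordinates by the well-ordered copy of the index type\<close>

definition vec_wo :: "real ^ 'n \<Rightarrow> real ^ 'n wo" where
  "vec_wo x = (\<chi> i. x $ of_wo i)"

definition vec_unwo :: "real ^ 'n wo \<Rightarrow> real ^ 'n" where
  "vec_unwo x = (\<chi> i. x $ to_wo i)"

lemma vec_wo_inverse [simp]: "vec_unwo (vec_wo x) = x" "vec_wo (vec_unwo y) = y"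
  by (simp_all add: vec_wo_def vec_unwo_def of_wo_inverse to_wo_inverse vec_eq_iff)

lemma bounded_linear_vec_wo: "bounded_linear (vec_wo :: real ^ 'n \<Rightarrow> real ^ 'n wo)"
  by (rule linear_conv_bounded_linear[THEN iffD1], rule linearI) (simp_all add: vec_wo_def vec_eq_iff)

lemma bounded_linear_vec_unwo: "bounded_linear (vec_unwo :: real ^ 'n wo \<Rightarrow> real ^ 'n)"
  by (rule linear_conv_bounded_linear[THEN iffD1], rule linearI) (simp_all add: vec_unwo_def vec_eq_iff)

lemma vec_wo_measurable [measurable]:
  "vec_wo \<in> borel_measurable borel" "vec_unwo \<in> borel_measurable borel"
  by (auto intro!: borel_measurable_continuous_onI linear_continuous_on bounded_linear_vec_wo bounded_linear_vec_unwo)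

lemma prod_Basis_vec: "(\<Prod>b\<in>(Basis :: (real ^ 'n) set). f b) = (\<Prod>i\<in>UNIV. f (axis i 1))"
proof -
  have "(Basis :: (real ^ 'n) set) = range (\<lambda>i. axis i 1)" by (auto simp: Basis_vec_def)
  moreover have "inj (\<lambda>i::'n. axis i (1::real))" by (auto simp: inj_def axis_eq_axis)
  ultimately show ?thesis using prod.reindex[of "\<lambda>i::'n. axis i (1::real)" UNIV f] by (simp add: o_def)
qed

text \<open>Lebesgue measure is determined by its values on boxes, and renaming coordinates only
  permutes the factors in the product of side lengths.\<close>

lemma distr_vec_wo: "distr lborel borel vec_wo = (lborel :: (real ^ ('n::finite) wo) measure)"
proof (rule lborel_eqI[symmetric])
  fix l u :: "real ^ 'n wo"
  assume lu: "\<And>b. b \<in> Basis \<Longrightarrow> l \<bullet> b \<le> u \<bullet> b"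
  have lu': "l $ i \<le> u $ i" for i using lu[of "axis i 1"] by (simp add: inner_axis)
  have vi: "vec_wo -` box l u = box (vec_unwo l) (vec_unwo u)"
    unfolding interval_cart set_eq_iff vec_wo_def vec_unwo_def
    by (auto simp: of_wo_inverse to_wo_inverse) (metis to_wo_inverse UNIV_I, metis to_wo_inverse UNIV_I, metis of_wo_inverse, metis of_wo_inverse)
  have "emeasure (distr lborel borel vec_wo) (box l u) = emeasure lborel (box (vec_unwo l) (vec_unwo u))"
    by (subst emeasure_distr) (auto simp: vi)
  also have "\<dots> = (\<Prod>b\<in>Basis. (vec_unwo u - vec_unwo l) \<bullet> b)"
    by (rule emeasure_lborel_box) (use lu' in \<open>auto simp: Basis_vec_def inner_axis vec_unwo_def\<close>)
  also have "(\<Prod>b\<in>Basis. (vec_unwo u - vec_unwo l) \<bullet> b) = (\<Prod>i\<in>UNIV. u $ to_wo i - l $ to_wo i)"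
    by (simp add: prod_Basis_vec inner_axis vec_unwo_def)
  also have "\<dots> = (\<Prod>i\<in>UNIV. u $ i - l $ i)"
    by (rule prod.reindex_bij_witness[of _ of_wo to_wo]) (auto simp: of_wo_inverse to_wo_inverse)
  also have "\<dots> = (\<Prod>b\<in>Basis. (u - l) \<bullet> b)" by (simp add: prod_Basis_vec inner_axis)
  finally show "emeasure (distr lborel borel vec_wo) (box l u) = ennreal (\<Prod>b\<in>Basis. (u - l) \<bullet> b)" .
qed simp

lemma emeasure_vec_wo_image:
  fixes S :: "(real ^ 'n::finite) set"
  assumes S: "S \<in> sets borel"
  shows "vec_wo ` S \<in> sets borel" "emeasure lborel (vec_wo ` S) = emeasure lborel S"
proof -
  have eq: "vec_wo ` S = vec_unwo -` S" by (force simp: image_iff intro: vec_wo_inverse[symmetric])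
  show b: "vec_wo ` S \<in> sets borel" unfolding eq
    using measurable_sets[OF vec_wo_measurable(2) S] by simp
  have "emeasure lborel (vec_wo ` S) = emeasure (distr lborel borel vec_wo) (vec_wo ` S)" by (simp add: distr_vec_wo)
  also have "\<dots> = emeasure lborel (vec_wo -` vec_wo ` S)"
    using b by (subst emeasure_distr) auto
  also have "vec_wo -` vec_wo ` S = S" by (metis inj_vimage_image_eq inj_on_inverseI vec_wo_inverse(1))
  finally show "emeasure lborel (vec_wo ` S) = emeasure lborel S" .
qed

text \<open>Conjugation by the renaming is a sign-preserving bijection between the permutations of
  the two index types, so the Leibniz sums agree term by term.\<close>

lemma det_vec_wo:
  fixes M :: "real ^ 'n ^ 'n"
  shows "det (\<chi> i j. M $ of_wo i $ of_wo j) = det M"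
proof -
  define F where "F = map_permutation UNIV (to_wo :: 'n \<Rightarrow> 'n wo)"
  have bt: "bij (to_wo :: 'n \<Rightarrow> 'n wo)" by (rule o_bij[of of_wo]) (auto simp: of_wo_inverse to_wo_inverse)
  have io: "inv (to_wo :: 'n \<Rightarrow> 'n wo) = of_wo"
    by (rule inv_unique_comp) (auto simp: of_wo_inverse to_wo_inverse)
  have Fp: "F p = to_wo \<circ> p \<circ> of_wo" for p
    using bt by (simp add: F_def map_permutation_def io bij_is_surj restrict_id_def fun_eq_iff)
  define G where "G = (\<lambda>q::'n wo \<Rightarrow> 'n wo. of_wo \<circ> q \<circ> to_wo)"
  have bo: "bij (of_wo :: 'n wo \<Rightarrow> 'n)" by (rule bij_of_wo)
  have perm: "p permutes UNIV \<longleftrightarrow> bij p" for p :: "'b \<Rightarrow> 'b" by (simp add: permutes_def bij_iff)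
  have "det (\<chi> i j. M $ of_wo i $ of_wo j)
     = (\<Sum>q | q permutes UNIV. of_int (sign q) * (\<Prod>i\<in>UNIV. M $ of_wo i $ of_wo (q i)))"
    by (simp add: det_def)
  also have "\<dots> = (\<Sum>p | p permutes UNIV. of_int (sign p) * (\<Prod>i\<in>UNIV. M $ i $ p i))"
  proof (rule sum.reindex_bij_witness[of _ F G])
    fix p :: "'n \<Rightarrow> 'n" assume p: "p \<in> {p. p permutes UNIV}"
    then show "F p \<in> {q. q permutes UNIV}" unfolding Fp mem_Collect_eq perm using bt bo by (intro bij_comp)
    show "G (F p) = p" by (simp add: G_def Fp fun_eq_iff to_wo_inverse)
  next
    fix q :: "'n wo \<Rightarrow> 'n wo" assume q: "q \<in> {q. q permutes UNIV}"
    then show Gq: "G q \<in> {p. p permutes UNIV}" unfolding G_def mem_Collect_eq perm using bt bo by (intro bij_comp)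
    show FG: "F (G q) = q" by (simp add: G_def Fp fun_eq_iff of_wo_inverse)
    have "sign (F (G q)) = sign (G q)" unfolding F_def
      by (rule sign_map_permutation) (use bt Gq in \<open>auto simp: bij_is_inj\<close>)
    moreover have "(\<Prod>i\<in>UNIV. M $ of_wo i $ of_wo (q i)) = (\<Prod>i\<in>UNIV. M $ i $ G q i)"
      by (rule prod.reindex_bij_witness[of _ to_wo of_wo]) (auto simp: of_wo_inverse to_wo_inverse G_def)
    ultimately show "of_int (sign (G q)) * (\<Prod>i\<in>UNIV. M $ i $ G q i) =
       (of_int (sign q) * (\<Prod>i\<in>UNIV. M $ of_wo i $ of_wo (q i)) :: real)"
      unfolding FG by simp
  qed
  finally show ?thesis by (simp add: det_def)
qed

text \<open>The underlying theorem speaks of finite measures and convergent integrals. Finiteness of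
  either side implies finiteness of the other, so the two sides agree when finite and are infinite
  together.\<close>

lemma emeasure_differentiable_image_wo:
  fixes f :: "real ^ 'n::{finite,wellorder} \<Rightarrow> real ^ 'n::_"
  assumes S: "S \<in> sets borel" and fS: "f ` S \<in> sets borel"
    and der: "\<And>x. x \<in> S \<Longrightarrow> (f has_derivative f' x) (at x)" and inj: "inj_on f S"
    and meas: "(\<lambda>x. \<bar>det (matrix (f' x))\<bar> * indicator S x) \<in> borel_measurable borel"
  shows "emeasure lborel (f ` S) = (\<integral>\<^sup>+x. ennreal \<bar>det (matrix (f' x))\<bar> * indicator S x \<partial>lborel)" (is "_ = ?I")
proof -
  note iff = has_measure_differentiable_image[of S f f', OF _ has_derivative_at_withinI[OF der] inj]
  have fin: "emeasure lborel (f ` S) = ?I" if lt: "emeasure lborel (f ` S) < \<infinity>"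
  proof -
    have "f ` S \<in> lmeasurable" using lt fS by (simp add: fmeasurable_def)
    then have "((\<lambda>x. \<bar>det (matrix (f' x))\<bar>) has_integral measure lebesgue (f ` S)) S"
      by (intro iffD1[OF iff]) (use S in auto)
    then have "?I = ennreal (measure lebesgue (f ` S))" by (intro nn_integral_has_integral_lebesgue') auto
    also have "\<dots> = emeasure lebesgue (f ` S)" using lt fS by (simp add: emeasure_eq_ennreal_measure)
    finally show ?thesis using fS by simp
  qed
  have fin': "emeasure lborel (f ` S) < \<infinity>" if lt: "?I < \<infinity>"
  proof -
    have eq: "?I = (\<integral>\<^sup>+x. ennreal (\<bar>det (matrix (f' x))\<bar> * indicator S x) \<partial>lborel)"
      by (intro nn_integral_cong) (auto simp: indicator_def)
    have "integrable lborel (\<lambda>x. \<bar>det (matrix (f' x))\<bar> * indicator S x)"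
      using meas lt unfolding eq by (intro integrableI_nonneg) auto
    from has_integral_integral_lborel[OF this]
    obtain m where "((\<lambda>x. \<bar>det (matrix (f' x))\<bar> * indicator S x) has_integral m) UNIV" by blast
    moreover have "(\<lambda>x. \<bar>det (matrix (f' x))\<bar> * indicator S x) = (\<lambda>x. if x \<in> S then \<bar>det (matrix (f' x))\<bar> else 0)"
      by (auto simp: indicator_def)
    ultimately have "((\<lambda>x. \<bar>det (matrix (f' x))\<bar>) has_integral m) S" by simp
    then have "f ` S \<in> lmeasurable" using iff S by auto
    then show ?thesis using fS by (simp add: fmeasurable_def)
  qed
  show ?thesis
  proof (cases "emeasure lborel (f ` S) < \<infinity>")
    case False
    then have "\<not> ?I < \<infinity>" using fin' by blast
    with False show ?thesis by (simp add: less_top[symmetric])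
  qed (rule fin)
qed

lemma emeasure_differentiable_image:
  fixes f :: "real ^ 'n \<Rightarrow> real ^ 'n"
  assumes S: "S \<in> sets borel" and fS: "f ` S \<in> sets borel"
    and der: "\<And>x. x \<in> S \<Longrightarrow> (f has_derivative f' x) (at x)" and inj: "inj_on f S"
    and meas: "(\<lambda>x. \<bar>det (matrix (f' x))\<bar> * indicator S x) \<in> borel_measurable borel"
  shows "emeasure lborel (f ` S) = (\<integral>\<^sup>+x. ennreal \<bar>det (matrix (f' x))\<bar> * indicator S x \<partial>lborel)"
proof -
  define F where "F = (\<lambda>x. vec_wo (f (vec_unwo x)))"
  define F' where "F' = (\<lambda>x v. vec_wo (f' (vec_unwo x) (vec_unwo v)))"
  have im: "F ` vec_wo ` S = vec_wo ` f ` S" by (simp add: F_def image_image)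
  have ind: "indicator (vec_wo ` S) x = indicator S (vec_unwo x)" for x
    by (force simp: indicator_def image_iff intro: vec_wo_inverse[symmetric])
  have au: "vec_unwo (axis j 1) = axis (of_wo j) 1" for j :: "'n wo"
    by (auto simp: vec_unwo_def axis_def vec_eq_iff of_wo_inverse to_wo_inverse)
  have "matrix (F' x) = (\<chi> i j. matrix (f' (vec_unwo x)) $ of_wo i $ of_wo j)" for x
    by (simp add: matrix_def F'_def au vec_wo_def vec_eq_iff)
  then have dt: "det (matrix (F' x)) = det (matrix (f' (vec_unwo x)))" for x by (simp add: det_vec_wo)
  have "emeasure lborel (f ` S) = emeasure lborel (F ` vec_wo ` S)"
    unfolding im by (rule emeasure_vec_wo_image(2)[OF fS, symmetric])
  also have "\<dots> = (\<integral>\<^sup>+x. ennreal \<bar>det (matrix (F' x))\<bar> * indicator (vec_wo ` S) x \<partial>lborel)"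
  proof (rule emeasure_differentiable_image_wo)
    show "vec_wo ` S \<in> sets borel" "F ` vec_wo ` S \<in> sets borel"
      unfolding im by (rule emeasure_vec_wo_image(1), fact)+
    show "inj_on F (vec_wo ` S)"
    proof (rule inj_onI)
      fix x y assume "x \<in> vec_wo ` S" "y \<in> vec_wo ` S" "F x = F y"
      then have "vec_unwo x \<in> S" "vec_unwo y \<in> S" "f (vec_unwo x) = f (vec_unwo y)"
        by (auto simp: F_def) (metis vec_wo_inverse(1))
      then show "x = y" using inj by (metis inj_onD vec_wo_inverse(2))
    qed
    show "(F has_derivative F' x) (at x)" if "x \<in> vec_wo ` S" for x
    proof -
      have "(f has_derivative f' (vec_unwo x)) (at (vec_unwo x))" using der that by auto
      from has_derivative_compose[OF bounded_linear_imp_has_derivative[OF bounded_linear_vec_unwo] this]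
      show ?thesis unfolding F_def F'_def
        by (rule bounded_linear.has_derivative[OF bounded_linear_vec_wo])
    qed
    show "(\<lambda>x. \<bar>det (matrix (F' x))\<bar> * indicator (vec_wo ` S) x) \<in> borel_measurable borel"
      unfolding dt ind using measurable_compose[OF vec_wo_measurable(2) meas] by simp
  qed
  also have "\<dots> = (\<integral>\<^sup>+x. ennreal \<bar>det (matrix (F' x))\<bar> * indicator (vec_wo ` S) x \<partial>distr lborel borel vec_wo)"
    by (simp add: distr_vec_wo)
  also have "\<dots> = (\<integral>\<^sup>+x. ennreal \<bar>det (matrix (f' x))\<bar> * indicator S x \<partial>lborel)"
  proof -
    have "(\<lambda>x. ennreal (\<bar>det (matrix (f' x))\<bar> * indicator S x)) \<in> borel_measurable borel" using meas by measurable
    then have "(\<lambda>x. ennreal \<bar>det (matrix (f' x))\<bar> * indicator S x) \<in> borel_measurable borel"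
      by (simp add: ennreal_mult'' ennreal_indicator)
    from measurable_compose[OF vec_wo_measurable(2) this]
    have "(\<lambda>x. ennreal \<bar>det (matrix (F' x))\<bar> * indicator (vec_wo ` S) x) \<in> borel_measurable borel"
      by (simp add: dt ind)
    then show ?thesis by (subst nn_integral_distr) (simp_all add: dt ind)
  qed
  finally show ?thesis .
qed

text \<open>The volume formula for images of Borel subsets of \<open>V\<close> says that Lebesgue
  measure on the image is the push-forward of the Jacobian density; integrating \<open>f\<close>
  against this identity of measures gives the formula.\<close>

lemma nn_integral_change_of_variables:
  fixes \<tau> :: "real ^ 'n \<Rightarrow> real ^ 'n"
  assumes V: "open V" "open (\<tau> ` V)" and hom: "homeomorphism V (\<tau> ` V) \<tau> \<sigma>"
    and der: "\<And>x. x \<in> V \<Longrightarrow> (\<tau> has_derivative \<tau>' x) (at x)"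
    and cont: "continuous_on V (\<lambda>x. det (matrix (\<tau>' x)))"
    and f: "f \<in> borel_measurable borel"
  shows "(\<integral>\<^sup>+y. f y * indicator (\<tau> ` V) y \<partial>lborel)
    = (\<integral>\<^sup>+x. f (\<tau> x) * (ennreal \<bar>det (matrix (\<tau>' x))\<bar> * indicator V x) \<partial>lborel)"
proof -
  \<comment> \<open>Extending \<tau> by zero makes it a Borel map on the whole space; the density
    \<open>J\<close> vanishes off \<open>V\<close>, so the added values carry no mass.\<close>
  define T where "T = (\<lambda>x. indicator V x *\<^sub>R \<tau> x)"
  have T: "T \<in> borel_measurable borel" unfolding T_def
    by (intro borel_measurable_continuous_on_indicator homeomorphism_cont1[OF hom]) (use V in auto)
  define J where "J = (\<lambda>x. ennreal \<bar>det (matrix (\<tau>' x))\<bar> * indicator V x)"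
  have J0: "(\<lambda>x. indicator V x *\<^sub>R det (matrix (\<tau>' x))) \<in> borel_measurable borel"
    by (intro borel_measurable_continuous_on_indicator cont) (use V in auto)
  have Jeq: "J x = ennreal \<bar>indicator V x *\<^sub>R det (matrix (\<tau>' x))\<bar>" for x
    by (auto simp: J_def indicator_def)
  have J: "J \<in> borel_measurable borel" unfolding Jeq[abs_def] using J0 by measurable
  have "density lborel (indicator (\<tau> ` V)) = distr (density lborel J) borel T"
  proof (rule measure_eqI)
    fix B assume "B \<in> sets (density lborel (indicator (\<tau> ` V)))"
    then have B: "B \<in> sets borel" by simp
    define S where "S = V \<inter> T -` B"
    have S: "S \<in> sets borel" unfolding S_def using measurable_sets[OF T B] V by auto
    have im: "\<tau> ` S = B \<inter> \<tau> ` V" by (auto simp: S_def T_def)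
    have "emeasure (density lborel (indicator (\<tau> ` V))) B = (\<integral>\<^sup>+x. indicator (\<tau> ` V) x * indicator B x \<partial>lborel)"
      using V B by (intro emeasure_density) auto
    also have "\<dots> = (\<integral>\<^sup>+x. indicator (\<tau> ` S) x \<partial>lborel)"
      unfolding im by (intro nn_integral_cong) (auto simp: indicator_def)
    also have "\<dots> = emeasure lborel (\<tau> ` S)" using V B by (intro nn_integral_indicator) (auto simp: im)
    also have "\<dots> = (\<integral>\<^sup>+x. ennreal \<bar>det (matrix (\<tau>' x))\<bar> * indicator S x \<partial>lborel)"
    proof (rule emeasure_differentiable_image[OF S])
      show "\<tau> ` S \<in> sets borel" unfolding im using V B by auto
      show "inj_on \<tau> S" using hom unfolding S_def by (metis Int_lower1 homeomorphism_apply1 inj_on_inverseI inj_on_subset)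
      show "(\<tau> has_derivative \<tau>' x) (at x)" if "x \<in> S" for x using der that by (auto simp: S_def)
      have "(\<lambda>x. \<bar>indicator V x *\<^sub>R det (matrix (\<tau>' x))\<bar> * indicator S x) \<in> borel_measurable borel"
        using J0 S by measurable
      also have "(\<lambda>x. \<bar>indicator V x *\<^sub>R det (matrix (\<tau>' x))\<bar> * indicator S x) = (\<lambda>x. \<bar>det (matrix (\<tau>' x))\<bar> * indicator S x)"
        by (auto simp: S_def indicator_def)
      finally show "(\<lambda>x. \<bar>det (matrix (\<tau>' x))\<bar> * indicator S x) \<in> borel_measurable borel" .
    qed
    also have "\<dots> = (\<integral>\<^sup>+x. J x * indicator (T -` B) x \<partial>lborel)"
      by (intro nn_integral_cong) (auto simp: J_def S_def indicator_def)
    also have "\<dots> = emeasure (density lborel J) (T -` B)"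
      using J measurable_sets[OF T B] by (intro emeasure_density[symmetric]) auto
    also have "\<dots> = emeasure (distr (density lborel J) borel T) B"
      using B T by (subst emeasure_distr) auto
    finally show "emeasure (density lborel (indicator (\<tau> ` V))) B = emeasure (distr (density lborel J) borel T) B" .
  qed simp
  then have "(\<integral>\<^sup>+y. f y \<partial>density lborel (indicator (\<tau> ` V))) = (\<integral>\<^sup>+y. f y \<partial>distr (density lborel J) borel T)" by simp
  also have "\<dots> = (\<integral>\<^sup>+x. f (T x) \<partial>density lborel J)"
    using T f by (intro nn_integral_distr) auto
  also have "\<dots> = (\<integral>\<^sup>+x. J x * f (T x) \<partial>lborel)"
    using J T f by (intro nn_integral_density) auto
  also have "\<dots> = (\<integral>\<^sup>+x. f (\<tau> x) * (ennreal \<bar>det (matrix (\<tau>' x))\<bar> * indicator V x) \<partial>lborel)"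
    by (intro nn_integral_cong) (auto simp: J_def T_def indicator_def mult.commute)
  finally have e1: "(\<integral>\<^sup>+y. f y \<partial>density lborel (indicator (\<tau> ` V))) =
    (\<integral>\<^sup>+x. f (\<tau> x) * (ennreal \<bar>det (matrix (\<tau>' x))\<bar> * indicator V x) \<partial>lborel)" .
  have "(\<integral>\<^sup>+y. f y \<partial>density lborel (indicator (\<tau> ` V))) = (\<integral>\<^sup>+y. indicator (\<tau> ` V) y * f y \<partial>lborel)"
    using V f by (intro nn_integral_density) auto
  with e1 have "(\<integral>\<^sup>+y. indicator (\<tau> ` V) y * f y \<partial>lborel) =
    (\<integral>\<^sup>+x. f (\<tau> x) * (ennreal \<bar>det (matrix (\<tau>' x))\<bar> * indicator V x) \<partial>lborel)" by simp
  moreover have "(\<integral>\<^sup>+y. f y * indicator (\<tau> ` V) y \<partial>lborel) = (\<integral>\<^sup>+y. indicator (\<tau> ` V) y * f y \<partial>lborel)"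
    by (intro nn_integral_cong mult.commute)
  ultimately show ?thesis by simp
qed

section \<open>The Riemannian volume measure\<close>

lemma inner_transpose: "v \<bullet> (transpose J *v w) = (J *v v) \<bullet> w" for J :: "real ^ 'n ^ 'm"
  by (metis dot_lmul_matrix inner_commute transpose_matrix_vector)

lemma pos_def_invertible:
  fixes P :: "real ^ 'n ^ 'n"
  assumes "\<And>v. v \<noteq> 0 \<Longrightarrow> v \<bullet> (P *v v) > 0"
  shows "invertible P"
proof -
  have "P *v v = 0 \<Longrightarrow> v = 0" for v using assms[of v] by force
  then show ?thesis by (metis matrix_left_invertible_ker invertible_left_inverse)
qed

text \<open>The segment from the identity to \<open>P\<close> consists of positive definite, hence
  invertible, matrices, so the determinant cannot change sign along it.\<close>

lemma pos_def_det_pos: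
  fixes P :: "real ^ 'n ^ 'n"
  assumes pos: "\<And>v. v \<noteq> 0 \<Longrightarrow> v \<bullet> (P *v v) > 0"
  shows "det P > 0"
proof (rule ccontr)
  assume "\<not> det P > 0"
  define F where "F = (\<lambda>t::real. (1 - t) *\<^sub>R (mat 1 :: real^'n^'n) + t *\<^sub>R P)"
  have "continuous_on {0..1} (\<lambda>t. det (F t))"
    unfolding F_def det_def by (intro continuous_intros)
  moreover have "det (F 1) \<le> 0" "0 \<le> det (F 0)" using \<open>\<not> det P > 0\<close> by (simp_all add: F_def)
  ultimately obtain t where t: "0 \<le> t" "t \<le> 1" "det (F t) = 0"
    using IVT2'[of "\<lambda>t. det (F t)" 1 0 0] by auto
  have "v \<bullet> (F t *v v) > 0" if "v \<noteq> 0" for v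
  proof -
    have "v \<bullet> (F t *v v) = (1 - t) * (v \<bullet> v) + t * (v \<bullet> (P *v v))"
      by (simp add: F_def matrix_vector_mult_add_rdistrib scaleR_matrix_vector_assoc[symmetric] inner_add_right)
    moreover have "v \<bullet> v > 0" "v \<bullet> (P *v v) > 0" using that pos by auto
    ultimately show ?thesis using t
      by (cases "t = 0") (auto intro: add_nonneg_pos)
  qed
  from pos_def_invertible[OF this] show False using t by (simp add: invertible_det_nz)
qed

abbreviation chart_im :: "('a, 'n) chart \<Rightarrow> (real ^ 'n) set" where
  "chart_im c \<equiv> chart_map c ` chart_dom c"

abbreviation transition :: "('a, 'n) chart \<Rightarrow> ('a, 'n) chart \<Rightarrow> real ^ 'n \<Rightarrow> real ^ 'n" where
  "transition c d \<equiv> chart_map d \<circ> chart_inv c"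

locale riemannian_manifold =
  fixes A :: "('a::{second_countable_topology, t2_space}, 'n::finite) chart set"
    and g :: "('a, 'n) tensor2"
  assumes manifold: "smooth_manifold A" and metric: "riemannian_metric A g"
begin

section \<open>Charts, transition maps and the metric in coordinates\<close>

lemma chart:
  assumes "c \<in> A"
  shows chart_open: "open (chart_dom c)" "open (chart_im c)"
    and chart_homeo: "homeomorphism (chart_dom c) (chart_im c) (chart_map c) (chart_inv c)"
    and chart_inv_map: "p \<in> chart_dom c \<Longrightarrow> chart_inv c (chart_map c p) = p"
    and chart_map_inv: "y \<in> chart_im c \<Longrightarrow> chart_map c (chart_inv c y) = y"
    and chart_inv_dom: "y \<in> chart_im c \<Longrightarrow> chart_inv c y \<in> chart_dom c"
    and chart_map_cont: "continuous_on (chart_dom c) (chart_map c)"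
    and chart_inv_cont: "continuous_on (chart_im c) (chart_inv c)"
proof -
  have c: "is_chart c" using manifold assms by (auto simp: smooth_manifold_def)
  then show "open (chart_dom c)" "open (chart_im c)"
    and h: "homeomorphism (chart_dom c) (chart_im c) (chart_map c) (chart_inv c)"
    by (auto simp: is_chart_def)
  show "p \<in> chart_dom c \<Longrightarrow> chart_inv c (chart_map c p) = p" by (rule homeomorphism_apply1[OF h])
  show "y \<in> chart_im c \<Longrightarrow> chart_map c (chart_inv c y) = y" by (rule homeomorphism_apply2[OF h])
  show "y \<in> chart_im c \<Longrightarrow> chart_inv c y \<in> chart_dom c" using homeomorphism_image2[OF h] by blast
  show "continuous_on (chart_dom c) (chart_map c)" by (rule homeomorphism_cont1[OF h])
  show "continuous_on (chart_im c) (chart_inv c)" by (rule homeomorphism_cont2[OF h])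
qed

lemma chart_at: "chart_at A p \<in> A" "p \<in> chart_dom (chart_at A p)"
proof -
  have "p \<in> (\<Union>c\<in>A. chart_dom c)" using manifold unfolding smooth_manifold_def by blast
  then have "\<exists>c. c \<in> A \<and> p \<in> chart_dom c" by blast
  from someI_ex[OF this] show "chart_at A p \<in> A" "p \<in> chart_dom (chart_at A p)"
    unfolding chart_at_def by auto
qed

lemma open_chart_image:
  assumes "c \<in> A" "open U" "U \<subseteq> chart_dom c"
  shows "open (chart_map c ` U)"
proof -
  have "openin (top_of_set (chart_dom c)) U" using assms chart_open[OF assms(1)] by (simp add: openin_open_eq)
  from homeomorphism_imp_open_map[OF chart_homeo[OF assms(1)] this]
  show ?thesis using chart_open[OF assms(1)] by (simp add: openin_open_eq)
qed

lemma transition_C1_on: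
  "c \<in> A \<Longrightarrow> d \<in> A \<Longrightarrow> C1_on (chart_map c ` (chart_dom c \<inter> chart_dom d)) (transition c d)"
  using manifold smooth_on_imp_C1_on unfolding smooth_manifold_def by blast

lemma transition_homeo:
  assumes c: "c \<in> A" and d: "d \<in> A"
  defines "U \<equiv> chart_dom c \<inter> chart_dom d"
  shows "homeomorphism (chart_map c ` U) (chart_map d ` U) (transition c d) (transition d c)"
proof (rule homeomorphismI)
  show "continuous_on (chart_map c ` U) (transition c d)"
    by (intro continuous_on_compose continuous_on_subset[OF chart_inv_cont[OF c]] continuous_on_subset[OF chart_map_cont[OF d]])
      (auto simp: U_def chart_inv_map[OF c])
  show "continuous_on (chart_map d ` U) (transition d c)"
    by (intro continuous_on_compose continuous_on_subset[OF chart_inv_cont[OF d]] continuous_on_subset[OF chart_map_cont[OF c]])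
      (auto simp: U_def chart_inv_map[OF d])
qed (auto simp: U_def chart_inv_map[OF c] chart_inv_map[OF d])

lemma transition_has_derivative:
  assumes "c \<in> A" "d \<in> A" "p \<in> chart_dom c" "p \<in> chart_dom d"
  shows "(transition c d has_derivative (\<lambda>v. transition_jacobian c d p *v v)) (at (chart_map c p))"
proof -
  have "transition c d differentiable at (chart_map c p)"
    using transition_C1_on[OF assms(1,2)] assms(3,4) by auto
  then show ?thesis unfolding transition_jacobian_def by (simp only: jacobian_works)
qed

lemma transition_jacobian_cont:
  assumes c: "c \<in> A" and d: "d \<in> A"
  shows "continuous_on (chart_map c ` (chart_dom c \<inter> chart_dom d)) 
     (\<lambda>y. transition_jacobian c d (chart_inv c y))" (is "continuous_on ?V _")
proof -
  have "continuous_on ?V (\<lambda>y. \<chi> i j. frechet_derivative (transition c d) (at y) (axis j 1) $ i)"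
    by (intro continuous_intros continuous_on_component C1_onD(2)[OF transition_C1_on[OF c d]])
  then show ?thesis
    by (rule continuous_on_eq)
      (auto simp: transition_jacobian_def jacobian_def matrix_def chart_inv_map[OF c])
qed

lemma metric_C1_on: "c \<in> A \<Longrightarrow> C1_on (chart_im c) (g c \<circ> chart_inv c)"
  using metric smooth_on_imp_C1_on unfolding riemannian_metric_def by blast

lemma metric_cont: "c \<in> A \<Longrightarrow> continuous_on (chart_dom c) (g c)"
  using continuous_on_compose2[OF C1_on_imp_continuous_on[OF metric_C1_on] chart_map_cont, of c c]
  by (auto simp: chart_inv_map cong: continuous_on_cong)

lemma metric_pos: "c \<in> A \<Longrightarrow> p \<in> chart_dom c \<Longrightarrow> v \<noteq> 0 \<Longrightarrow> v \<bullet> (g c p *v v) > 0"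
  using metric unfolding riemannian_metric_def by blast

lemma metric_nonneg: "c \<in> A \<Longrightarrow> p \<in> chart_dom c \<Longrightarrow> v \<bullet> (g c p *v v) \<ge> 0"
  using metric_pos[of c p v] by (cases "v = 0") auto

lemma metric_transform:
  "c \<in> A \<Longrightarrow> d \<in> A \<Longrightarrow> p \<in> chart_dom c \<Longrightarrow> p \<in> chart_dom d \<Longrightarrow>
    g c p = transpose (transition_jacobian c d p) ** g d p ** transition_jacobian c d p"
  using metric unfolding riemannian_metric_def by blast

lemma metric_form_transform:
  assumes "c \<in> A" "d \<in> A" "p \<in> chart_dom c" "p \<in> chart_dom d"
  shows "(transition_jacobian c d p *v v) \<bullet> (g d p *v (transition_jacobian c d p *v v)) = v \<bullet> (g c p *v v)"
  by (simp only: metric_transform[OF assms] matrix_vector_mul_assoc[symmetric] inner_transpose)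

lemma metric_det_pos: "c \<in> A \<Longrightarrow> p \<in> chart_dom c \<Longrightarrow> det (g c p) > 0"
  by (rule pos_def_det_pos) (rule metric_pos)

section \<open>The volume density and the measure carried by one chart\<close>

definition vol :: "('a, 'n) chart \<Rightarrow> real ^ 'n \<Rightarrow> real" where
  "vol c y = sqrt (det (g c (chart_inv c y)))"

lemma vol_C1_on:
  assumes c: "c \<in> A" shows "C1_on (chart_im c) (vol c)"
proof -
  have "C1_on (chart_im c) (\<lambda>y. sqrt (det ((g c \<circ> chart_inv c) y)))"
    by (intro C1_on_sqrt C1_on_det metric_C1_on c) (use chart_inv_dom[OF c] metric_det_pos[OF c] in auto)
  then show ?thesis unfolding vol_def[abs_def] by (simp only: o_apply)
qed

lemma vol_pos: "c \<in> A \<Longrightarrow> y \<in> chart_im c \<Longrightarrow> vol c y > 0"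
  using chart_inv_dom metric_det_pos by (simp add: vol_def)

lemma vol_cont: "c \<in> A \<Longrightarrow> continuous_on (chart_im c) (vol c)"
  by (rule C1_on_imp_continuous_on[OF vol_C1_on])

lemma vol_measurable:
  "c \<in> A \<Longrightarrow> (\<lambda>y. indicator (chart_im c) y * vol c y) \<in> borel_measurable borel"
  using borel_measurable_continuous_on_indicator[OF borel_open[OF chart_open(2)] vol_cont] by simp

text \<open>A total version of \<open>chart_inv\<close> with an explicit constant off the chart
  image, which makes it a Borel map on the whole coordinate space.\<close>

definition param :: "('a, 'n) chart \<Rightarrow> real ^ 'n \<Rightarrow> 'a" where
  "param c y = (if y \<in> chart_im c then chart_inv c y else undefined)"

lemma param_measurable: "c \<in> A \<Longrightarrow> param c \<in> borel_measurable borel"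
  unfolding param_def[abs_def]
  by (intro borel_measurable_continuous_on_if chart_inv_cont) (use chart_open in auto)

definition chart_measure :: "('a, 'n) chart \<Rightarrow> 'a measure" where
  "chart_measure c = distr (density lborel (\<lambda>y. ennreal (indicator (chart_im c) y * vol c y))) borel (param c)"

lemma sets_chart_measure [simp, measurable_cong]: "sets (chart_measure c) = sets borel"
  by (simp add: chart_measure_def)

lemma nn_integral_chart_measure:
  assumes c: "c \<in> A" and f: "f \<in> borel_measurable borel"
  shows "(\<integral>\<^sup>+p. f p \<partial>chart_measure c) = (\<integral>\<^sup>+y. ennreal (vol c y) * f (chart_inv c y) * indicator (chart_im c) y \<partial>lborel)"
proof -
  have "(\<integral>\<^sup>+p. f p \<partial>chart_measure c) = (\<integral>\<^sup>+y. f (param c y) \<partial>density lborel (\<lambda>y. ennreal (indicator (chart_im c) y * vol c y)))"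
    unfolding chart_measure_def using param_measurable[OF c] f by (intro nn_integral_distr) auto
  also have "\<dots> = (\<integral>\<^sup>+y. ennreal (indicator (chart_im c) y * vol c y) * f (param c y) \<partial>lborel)"
    using vol_measurable[OF c] param_measurable[OF c] f by (intro nn_integral_density) auto
  also have "\<dots> = (\<integral>\<^sup>+y. ennreal (vol c y) * f (chart_inv c y) * indicator (chart_im c) y \<partial>lborel)"
    by (intro nn_integral_cong) (auto simp: param_def indicator_def)
  finally show ?thesis .
qed

lemma emeasure_chart_measure':
  assumes c: "c \<in> A" and B: "B \<in> sets borel"
  shows "emeasure (chart_measure c) B = (\<integral>\<^sup>+y. ennreal (vol c y) * indicator B (chart_inv c y) * indicator (chart_im c) y \<partial>lborel)"
  using nn_integral_chart_measure[OF c, of "indicator B"] B by simp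

lemma emeasure_chart_measure:
  assumes c: "c \<in> A" and B: "B \<in> sets borel" "B \<subseteq> chart_dom c"
  shows "emeasure (chart_measure c) B = (\<integral>\<^sup>+x\<in>chart_map c ` B. ennreal (sqrt (det (g c (chart_inv c x)))) \<partial>lborel)"
  unfolding emeasure_chart_measure'[OF c B(1)] vol_def
  using B(2) by (intro nn_integral_cong) 
    (auto simp: indicator_def chart_inv_map[OF c] image_iff dest: chart_map_inv[OF c] subsetD)

lemma det_metric_transform:
  assumes "c \<in> A" "d \<in> A" "p \<in> chart_dom c" "p \<in> chart_dom d"
  shows "vol c (chart_map c p) = \<bar>det (transition_jacobian c d p)\<bar> * vol d (chart_map d p)"
proof -
  have "det (g c p) = (det (transition_jacobian c d p))\<^sup>2 * det (g d p)"
    by (subst metric_transform[OF assms]) (simp add: det_mul det_transpose power2_eq_square)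
  then show ?thesis using assms by (simp add: vol_def chart_inv_map real_sqrt_mult)
qed

text \<open>Under the transition map the Jacobian factor of the change of variables is exactly the
  factor by which the square roots of the metric determinants differ.\<close>

lemma chart_measure_consistent:
  assumes c: "c \<in> A" and d: "d \<in> A" and B: "B \<in> sets borel" "B \<subseteq> chart_dom c" "B \<subseteq> chart_dom d"
  shows "emeasure (chart_measure c) B = emeasure (chart_measure d) B"
proof -
  define U where "U = chart_dom c \<inter> chart_dom d"
  define V where "V = chart_map c ` U"
  define f where "f = (\<lambda>y. ennreal (indicator (chart_im d) y * vol d y) * indicator B (param d y))"
  have im: "transition c d ` V = chart_map d ` U" unfolding V_def U_def by (rule homeomorphism_image1[OF transition_homeo[OF c d]])
  have oU: "open U" unfolding U_def using chart_open(1)[OF c] chart_open(1)[OF d] by (rule open_Int)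
  have "(\<lambda>y. indicator B (param d y) :: ennreal) \<in> borel_measurable borel"
    by (rule measurable_compose[OF param_measurable[OF d]]) (use B(1) in simp)
  then have f: "f \<in> borel_measurable borel"
    unfolding f_def using vol_measurable[OF d] by measurable
  have "emeasure (chart_measure d) B = (\<integral>\<^sup>+y. f y * indicator (transition c d ` V) y \<partial>lborel)"
    unfolding emeasure_chart_measure'[OF d B(1)] im
  proof (intro nn_integral_cong)
    fix y
    show "ennreal (vol d y) * indicator B (chart_inv d y) * indicator (chart_im d) y = f y * indicator (chart_map d ` U) y"
    proof (cases "y \<in> chart_im d")
      case True
      then obtain q where q: "q \<in> chart_dom d" "y = chart_map d q" by blast
      have "y \<in> chart_map d ` U" if "q \<in> B" using that q B by (auto simp: U_def)
      then show ?thesis using q True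
        by (auto simp: f_def param_def chart_inv_map[OF d] indicator_def)
    qed (auto simp: f_def U_def indicator_def)
  qed
  also have "\<dots> = (\<integral>\<^sup>+x. f (transition c d x) * (ennreal \<bar>det (matrix (\<lambda>v. transition_jacobian c d (chart_inv c x) *v v))\<bar> * indicator V x) \<partial>lborel)"
  proof (rule nn_integral_change_of_variables)
    show "open V" unfolding V_def by (rule open_chart_image[OF c oU]) (simp add: U_def)
    show "open (transition c d ` V)" unfolding im by (rule open_chart_image[OF d oU]) (simp add: U_def)
    show "homeomorphism V (transition c d ` V) (transition c d) (transition d c)"
      unfolding im unfolding V_def U_def by (rule transition_homeo[OF c d])
    show "(transition c d has_derivative (\<lambda>v. transition_jacobian c d (chart_inv c x) *v v)) (at x)" if "x \<in> V" for x
      using that transition_has_derivative[OF c d] by (auto simp: V_def U_def chart_inv_map[OF c])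
    have "continuous_on V (\<lambda>x. det (transition_jacobian c d (chart_inv c x)))"
      unfolding det_def V_def U_def
      by (intro continuous_intros continuous_on_component transition_jacobian_cont c d)
    then show "continuous_on V (\<lambda>x. det (matrix (\<lambda>v. transition_jacobian c d (chart_inv c x) *v v)))" by simp
  qed (rule f)
  also have "\<dots> = emeasure (chart_measure c) B"
    unfolding emeasure_chart_measure'[OF c B(1)]
  proof (intro nn_integral_cong)
    fix x
    show "f (transition c d x) * (ennreal \<bar>det (matrix (\<lambda>v. transition_jacobian c d (chart_inv c x) *v v))\<bar> * indicator V x)
      = ennreal (vol c x) * indicator B (chart_inv c x) * indicator (chart_im c) x"
    proof (cases "x \<in> V")
      case True
      then obtain p where p: "p \<in> chart_dom c" "p \<in> chart_dom d" "x = chart_map c p" by (auto simp: V_def U_def)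
      have "vol c x = \<bar>det (transition_jacobian c d p)\<bar> * vol d (chart_map d p)"
        using det_metric_transform[OF c d p(1,2)] p by simp
      then show ?thesis using p True
        by (simp add: f_def chart_inv_map[OF c] chart_inv_map[OF d] param_def ennreal_mult' mult_ac)
    next
      case False
      then have "x \<notin> chart_im c \<or> chart_inv c x \<notin> B"
        using B by (auto simp: V_def U_def chart_inv_map[OF c])
      then show ?thesis using False by auto
    qed
  qed
  finally show ?thesis by simp
qed

section \<open>Existence and uniqueness of the volume measure\<close>

definition is_volume :: "'a measure \<Rightarrow> bool" where
  "is_volume \<mu> \<longleftrightarrow> sets \<mu> = sets borel \<and> (\<forall>c\<in>A. \<forall>B\<in>sets borel. B \<subseteq> chart_dom c \<longrightarrow>
     emeasure \<mu> B = (\<integral>\<^sup>+ x\<in>chart_map c ` B. ennreal (sqrt (det (g c (chart_inv c x)))) \<partial>lborel))"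

text \<open>Lindelof's property of second countable spaces. The enumeration may repeat charts, so a
  finite subatlas is covered as well.\<close>

lemma countable_atlas:
  obtains c :: "nat \<Rightarrow> ('a, 'n) chart" where "\<And>i. c i \<in> A" "(\<Union>i. chart_dom (c i)) = UNIV"
proof -
  have "open S" if "S \<in> chart_dom ` A" for S using that chart_open(1) by (elim imageE) simp
  from Lindelof[OF this] obtain F where F: "F \<subseteq> chart_dom ` A" "countable F" "\<Union>F = \<Union>(chart_dom ` A)" by blast
  have U: "\<Union>F = UNIV" using F(3) manifold unfolding smooth_manifold_def by argo
  obtain B where B: "countable B" "B \<subseteq> A" "F = chart_dom ` B"
    using countable_subset_image[THEN iffD1, of F chart_dom A] F(1,2) by blast
  have "B \<noteq> {}" using U B by blast
  then have r: "range (from_nat_into B) = B" using B(1) by (rule range_from_nat_into)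
  show ?thesis
  proof (rule that)
    show "from_nat_into B i \<in> A" for i using from_nat_into[OF \<open>B \<noteq> {}\<close>] B(2) by blast
    have "(\<Union>i. chart_dom (from_nat_into B i)) = \<Union>(chart_dom ` range (from_nat_into B))" by (simp only: image_image)
    then show "(\<Union>i. chart_dom (from_nat_into B i)) = UNIV" unfolding r using U B(3) by simp
  qed
qed

text \<open>Disjointing countably many chart domains cuts every Borel set into pieces that each lie
  in one chart, where the measure is prescribed.\<close>

lemma is_volume_unique:
  assumes \<mu>: "is_volume \<mu>" and \<nu>: "is_volume \<nu>"
  shows "\<mu> = \<nu>"
proof (rule measure_eqI)
  obtain c :: "nat \<Rightarrow> ('a, 'n) chart" where c: "\<And>i. c i \<in> A" "(\<Union>i. chart_dom (c i)) = UNIV" by (rule countable_atlas) blast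
  define D where "D = disjointed (\<lambda>i. chart_dom (c i))"
  have D: "D i \<in> sets borel" "D i \<subseteq> chart_dom (c i)" for i
    unfolding D_def using chart_open(1)[OF c(1)] disjointed_subset[of "\<lambda>i. chart_dom (c i)" i]
    by (auto simp: disjointed_def)
  have UD: "(\<Union>i. D i) = UNIV" using c(2) by (simp add: D_def UN_disjointed_eq)
  fix B assume "B \<in> sets \<mu>"
  then have B: "B \<in> sets borel" using \<mu> by (simp add: is_volume_def)
  have disj: "disjoint_family (\<lambda>i. B \<inter> D i)"
    using disjoint_family_disjointed[of "\<lambda>i. chart_dom (c i)"] by (auto simp: D_def disjoint_family_on_def)
  have s: "(\<Sum>i. emeasure \<kappa> (B \<inter> D i)) = emeasure \<kappa> B" if "is_volume \<kappa>" for \<kappa>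
  proof -
    have "(\<Sum>i. emeasure \<kappa> (B \<inter> D i)) = emeasure \<kappa> (\<Union>i. B \<inter> D i)"
      using that B D disj by (intro suminf_emeasure) (auto simp: is_volume_def)
    moreover have "(\<Union>i. B \<inter> D i) = B" using UD by blast
    ultimately show ?thesis by simp
  qed
  have "emeasure \<mu> (B \<inter> D i) = emeasure \<nu> (B \<inter> D i)" for i
  proof -
    have "B \<inter> D i \<in> sets borel" "B \<inter> D i \<subseteq> chart_dom (c i)" using B D by auto
    then show ?thesis using \<mu> \<nu> c(1)[of i] unfolding is_volume_def by auto
  qed
  then show "emeasure \<mu> B = emeasure \<nu> B" using s[OF \<mu>] s[OF \<nu>] by simp
qed (use \<mu> \<nu> in \<open>simp add: is_volume_def\<close>)

text \<open>Each chosen chart contributes its measure on its own piece of the disjointed atlas.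
  Consistency on overlaps makes the sum agree with the measure of every chart of \<open>A\<close>,
  not only of the chosen ones.\<close>

lemma is_volume_exists: "\<exists>\<mu>. is_volume \<mu>"
proof -
  obtain c :: "nat \<Rightarrow> ('a, 'n) chart" where c: "\<And>i. c i \<in> A" "(\<Union>i. chart_dom (c i)) = UNIV" by (rule countable_atlas) blast
  define D where "D = disjointed (\<lambda>i. chart_dom (c i))"
  have D: "D i \<in> sets borel" "D i \<subseteq> chart_dom (c i)" for i
    unfolding D_def using chart_open(1)[OF c(1)] disjointed_subset[of "\<lambda>i. chart_dom (c i)" i]
    by (auto simp: disjointed_def)
  have UD: "(\<Union>i. D i) = UNIV" using c(2) by (simp add: D_def UN_disjointed_eq)
  have dD: "disjoint_family D" using disjoint_family_disjointed by (simp add: D_def)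
  define m where "m = (\<lambda>B. \<Sum>i. emeasure (chart_measure (c i)) (B \<inter> D i))"
  define \<mu> where "\<mu> = measure_of UNIV (sets borel) m"
  have sets: "sets \<mu> = sets borel"
    unfolding \<mu>_def using sets.sigma_sets_eq[of "borel :: 'a measure"] by (simp add: sets_measure_of)
  have em: "emeasure \<mu> B = m B" if B: "B \<in> sets borel" for B
  proof (rule emeasure_measure_of[OF \<mu>_def])
    show "sets borel \<subseteq> Pow UNIV" by auto
    show "B \<in> sets \<mu>" using B sets by simp
    show "positive (sets \<mu>) m" by (simp add: positive_def m_def)
    show "countably_additive (sets \<mu>) m"
    proof (rule countably_additiveI)
      fix F :: "nat \<Rightarrow> 'a set" assume F: "range F \<subseteq> sets \<mu>" "disjoint_family F" 
      \<comment> \<open>Tonelli's theorem with the counting measure, to interchange the two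
        sums.\<close>
      have "(\<Sum>j. m (F j)) = (\<integral>\<^sup>+j. (\<Sum>i. emeasure (chart_measure (c i)) (F j \<inter> D i)) \<partial>count_space UNIV)"
        unfolding m_def by (simp add: nn_integral_count_space_nat)
      also have "\<dots> = (\<Sum>i. \<integral>\<^sup>+j. emeasure (chart_measure (c i)) (F j \<inter> D i) \<partial>count_space UNIV)"
        by (rule nn_integral_suminf) simp
      also have "\<dots> = (\<Sum>i. emeasure (chart_measure (c i)) ((\<Union>j. F j) \<inter> D i))"
      proof (rule suminf_cong)
        fix i
        have "(\<integral>\<^sup>+j. emeasure (chart_measure (c i)) (F j \<inter> D i) \<partial>count_space UNIV) = (\<Sum>j. emeasure (chart_measure (c i)) (F j \<inter> D i))"
          by (rule nn_integral_count_space_nat)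
        also have "\<dots> = emeasure (chart_measure (c i)) (\<Union>j. F j \<inter> D i)"
          using F D by (intro suminf_emeasure) (auto simp: sets disjoint_family_on_def)
        also have "(\<Union>j. F j \<inter> D i) = (\<Union>j. F j) \<inter> D i" by blast
        finally show "(\<integral>\<^sup>+j. emeasure (chart_measure (c i)) (F j \<inter> D i) \<partial>count_space UNIV)
          = emeasure (chart_measure (c i)) ((\<Union>j. F j) \<inter> D i)" .
      qed
      finally show "(\<Sum>j. m (F j)) = m (\<Union>j. F j)" by (simp add: m_def)
    qed
  qed
  have "emeasure \<mu> B = emeasure (chart_measure d) B" if d: "d \<in> A" and B: "B \<in> sets borel" "B \<subseteq> chart_dom d" for d B
  proof -
    have "emeasure \<mu> B = (\<Sum>i. emeasure (chart_measure d) (B \<inter> D i))"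
      unfolding em[OF B(1)] m_def
      by (intro suminf_cong chart_measure_consistent c d) (use B D in auto)
    also have "\<dots> = emeasure (chart_measure d) (\<Union>i. B \<inter> D i)"
    proof (rule suminf_emeasure)
      show "disjoint_family (\<lambda>i. B \<inter> D i)" using dD unfolding disjoint_family_on_def by blast
    qed (use B D in auto)
    also have "(\<Union>i. B \<inter> D i) = B" using UD by blast
    finally show ?thesis .
  qed
  then have "is_volume \<mu>" unfolding is_volume_def using sets emeasure_chart_measure by auto
  then show ?thesis ..
qed

abbreviation \<mu> :: "'a measure" where "\<mu> \<equiv> riemannian_volume A g"

lemma is_volume_\<mu>: "is_volume \<mu>"
proof -
  \<comment> \<open>\<open>riemannian_volume\<close> is the definite description of this very
    property, so it has a meaning once exactly one such measure exists.\<close>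
  have "\<exists>!\<nu>. is_volume \<nu>" using is_volume_exists is_volume_unique by blast
  from theI'[OF this] show ?thesis unfolding is_volume_def riemannian_volume_def .
qed

lemma sets_\<mu> [simp, measurable_cong]: "sets \<mu> = sets borel"
  using is_volume_\<mu> by (simp add: is_volume_def)

lemma density_\<mu>_chart:
  assumes c: "c \<in> A"
  shows "density \<mu> (indicator (chart_dom c)) = chart_measure c"
proof (rule measure_eqI)
  fix B assume "B \<in> sets (density \<mu> (indicator (chart_dom c)))"
  then have B: "B \<in> sets borel" by simp
  have o: "chart_dom c \<in> sets borel" using chart_open[OF c] by simp
  have "emeasure (density \<mu> (indicator (chart_dom c))) B = (\<integral>\<^sup>+p. indicator (B \<inter> chart_dom c) p \<partial>\<mu>)"
    using B o by (subst emeasure_density) (auto simp: indicator_inter_arith mult.commute simp del: nn_integral_indicator intro!: nn_integral_cong)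
  also have "\<dots> = emeasure \<mu> (B \<inter> chart_dom c)" using B o by simp
  also have "\<dots> = emeasure (chart_measure c) (B \<inter> chart_dom c)"
    using is_volume_\<mu> c B o emeasure_chart_measure[OF c, of "B \<inter> chart_dom c"] unfolding is_volume_def by auto
  also have "\<dots> = emeasure (chart_measure c) B"
    using B o unfolding emeasure_chart_measure'[OF c B] emeasure_chart_measure'[OF c sets.Int[OF B o]]
    by (intro nn_integral_cong) (auto simp: indicator_def chart_inv_map[OF c])
  finally show "emeasure (density \<mu> (indicator (chart_dom c))) B = emeasure (chart_measure c) B" .
qed simp

text \<open>As \<open>f\<close> vanishes off the chart, multiplying by the indicator of the chart
  domain changes nothing, and \<mu> may be replaced by the push-forward from coordinates.\<close>

lemma integral_\<mu>_chart:
  fixes f :: "'a \<Rightarrow> real"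
  assumes c: "c \<in> A" and f: "f \<in> borel_measurable borel" and f0: "\<And>p. p \<notin> chart_dom c \<Longrightarrow> f p = 0"
  shows "integral\<^sup>L \<mu> f = (\<integral>y. indicator (chart_im c) y * (vol c y * f (chart_inv c y)) \<partial>lborel)" (is ?eq)
    and "integrable \<mu> f \<longleftrightarrow> integrable lborel (\<lambda>y. indicator (chart_im c) y * (vol c y * f (chart_inv c y)))" (is ?int)
proof -
  let ?i = "indicator (chart_dom c) :: 'a \<Rightarrow> real"
  have o: "chart_dom c \<in> sets borel" using chart_open[OF c] by simp
  have cm: "density \<mu> (\<lambda>p. ennreal (?i p)) = chart_measure c"
    using density_\<mu>_chart[OF c] by (simp add: ennreal_indicator)
  have fi: "?i p *\<^sub>R f p = f p" for p using f0[of p] by (auto simp: indicator_def)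
  let ?v = "\<lambda>y. indicator (chart_im c) y * vol c y"
  have v0: "0 \<le> ?v y" for y using vol_pos[OF c, of y] by (auto simp: indicator_def)
  have eq: "?v y *\<^sub>R f (param c y) = indicator (chart_im c) y * (vol c y * f (chart_inv c y))" for y
    by (auto simp: param_def indicator_def)
  have fp: "(\<lambda>y. f (param c y)) \<in> borel_measurable borel" 
    by (rule measurable_compose[OF param_measurable[OF c] f])
  have "integral\<^sup>L \<mu> f = integral\<^sup>L (chart_measure c) f"
    using integral_density[of f \<mu> ?i] f o by (simp add: cm[symmetric] fi del: real_scaleR_def)
  also have "\<dots> = (\<integral>y. f (param c y) \<partial>density lborel ?v)"
    unfolding chart_measure_def using param_measurable[OF c] f by (intro integral_distr) auto
  also have "\<dots> = (\<integral>y. ?v y *\<^sub>R f (param c y) \<partial>lborel)"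
    using fp vol_measurable[OF c] v0 by (intro integral_density) auto
  finally show ?eq unfolding eq .
  have "integrable \<mu> f \<longleftrightarrow> integrable (chart_measure c) f"
    using integrable_density[of f \<mu> ?i] f o by (simp add: cm[symmetric] fi del: real_scaleR_def)
  also have "\<dots> \<longleftrightarrow> integrable (density lborel ?v) (\<lambda>y. f (param c y))"
    unfolding chart_measure_def using param_measurable[OF c] f by (intro integrable_distr_eq) auto
  also have "\<dots> \<longleftrightarrow> integrable lborel (\<lambda>y. ?v y *\<^sub>R f (param c y))"
    using fp vol_measurable[OF c] v0 by (intro integrable_density) auto
  finally show ?int unfolding eq .
qed

end

section \<open>Arc length\<close>

text \<open>The increment is controlled by an arbitrary majorant of the derivative: the derivative of a
  piecewise \<open>C1\<close> curve may be unbounded near the exceptional points.\<close>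
lemma norm_increment_le_nn_integral:
  fixes f :: "real \<Rightarrow> 'b::euclidean_space"
  assumes S: "finite S" and ab: "a \<le> b" and cont: "continuous_on {a..b} f"
    and der: "\<And>t. t \<in> {a<..<b} - S \<Longrightarrow> (f has_vector_derivative f' t) (at t)"
    and le: "\<And>t. t \<in> {a<..<b} - S \<Longrightarrow> norm (f' t) \<le> h t"
    and h: "h \<in> borel_measurable borel" "\<And>t. 0 \<le> h t"
  shows "ennreal (norm (f b - f a)) \<le> (\<integral>\<^sup>+t. ennreal (h t) * indicator {a..b} t \<partial>lborel)" (is "_ \<le> ?I")
proof (cases "?I < \<infinity>")
  case True
  define k where "k = (\<lambda>t. h t * indicator {a..b} t)"
  have Ik: "?I = (\<integral>\<^sup>+t. ennreal (k t) \<partial>lborel)"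
    by (intro nn_integral_cong) (auto simp: k_def indicator_def)
  have k: "k \<in> borel_measurable borel" "\<And>t. 0 \<le> k t" using h by (auto simp: k_def)
  have ik: "integrable lborel k"
    using True k unfolding Ik by (intro integrableI_nonneg) auto
  have "(k has_integral integral\<^sup>L lborel k) UNIV" by (rule has_integral_integral_lborel[OF ik])
  moreover have "k = (\<lambda>t. if t \<in> {a..b} then h t else 0)" by (auto simp: k_def indicator_def)
  ultimately have "((\<lambda>t. if t \<in> {a..b} then h t else 0) has_integral integral\<^sup>L lborel k) UNIV" by simp
  then have hI: "(h has_integral integral\<^sup>L lborel k) {a..b}" unfolding has_integral_restrict_UNIV .
  \<comment> \<open>Testing against the direction of the increment reduces the vector inequality to
    one between integrals of real functions.\<close>
  define u where "u = sgn (f b - f a)"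
  have "(f' has_integral (f b - f a)) {a..b}"
    by (rule fundamental_theorem_of_calculus_interior_strong[OF S ab der cont])
  from has_integral_linear[OF this bounded_linear_inner_right[of u]]
  have "((\<lambda>t. u \<bullet> f' t) has_integral u \<bullet> (f b - f a)) {a..b}" by (simp add: o_def)
  then have uf: "((\<lambda>t. if t \<in> {a<..<b} - S then u \<bullet> f' t else 0) has_integral u \<bullet> (f b - f a)) {a..b}"
    by (rule has_integral_spike_finite[of "insert a (insert b S)", rotated 2]) (use S in auto)
  have "u \<bullet> (f b - f a) \<le> integral\<^sup>L lborel k"
  proof -
    have "u \<bullet> f' t \<le> h t" if "t \<in> {a<..<b} - S" for t
    proof -
      have "u \<bullet> f' t \<le> norm u * norm (f' t)" by (rule norm_cauchy_schwarz)
      also have "\<dots> \<le> 1 * norm (f' t)" by (rule mult_right_mono) (simp_all add: u_def norm_sgn)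
      finally show ?thesis using le[OF that] by simp
    qed
    then show ?thesis using h(2) by (intro has_integral_le[OF uf hI]) auto
  qed
  moreover have "u \<bullet> (f b - f a) = norm (f b - f a)"
    by (cases "f b = f a") (simp_all add: u_def sgn_div_norm dot_square_norm power2_eq_square)
  moreover have "?I = ennreal (integral\<^sup>L lborel k)"
    unfolding Ik by (rule nn_integral_eq_integral[OF ik]) (use k in auto)
  ultimately show ?thesis by (simp add: ennreal_leI)
qed (simp add: less_top[symmetric])

text \<open>The functions agree on the closed interval only, whereas derivatives are two-sided; the
  two end points are therefore added to the exceptional set.\<close>

lemma piecewise_C1_differentiable_on_cong:
  assumes f: "f piecewise_C1_differentiable_on {s..t}" and eq: "\<And>x. x \<in> {s..t} \<Longrightarrow> f x = h x"
  shows "h piecewise_C1_differentiable_on {s..t}"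
proof -
  obtain S D where S: "finite S" and D: "\<And>x. x \<in> {s..t} - S \<Longrightarrow> (f has_vector_derivative D x) (at x)" "continuous_on ({s..t} - S) D"
    using f unfolding piecewise_C1_differentiable_on_def C1_differentiable_on_def by blast
  have "(h has_vector_derivative D x) (at x)" if x: "x \<in> {s..t} - (S \<union> {s, t})" for x
  proof (rule has_vector_derivative_transform_within_open[of f _ _ "{s<..<t}"])
    show "(f has_vector_derivative D x) (at x)" using D(1) x by auto
  qed (use x eq in auto)
  moreover have "continuous_on ({s..t} - (S \<union> {s, t})) D" by (rule continuous_on_subset[OF D(2)]) auto
  ultimately have "h C1_differentiable_on {s..t} - (S \<union> {s, t})" unfolding C1_differentiable_on_def by blast
  moreover have "continuous_on {s..t} h"
  proof (rule continuous_on_eq[OF _ eq])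
    show "continuous_on {s..t} f" using f unfolding piecewise_C1_differentiable_on_def by blast
  qed
  ultimately show ?thesis unfolding piecewise_C1_differentiable_on_def using S
    by (intro conjI exI[of _ "S \<union> {s, t}"]) auto
qed

context riemannian_manifold
begin

section \<open>Speed and regular parameters of a piecewise C1 curve\<close>

definition speed :: "(real \<Rightarrow> 'a) \<Rightarrow> real \<Rightarrow> real" where
  "speed \<gamma> t = (let c = chart_at A (\<gamma> t); v = vector_derivative (chart_map c \<circ> \<gamma>) (at t)
     in sqrt (v \<bullet> (g c (\<gamma> t) *v v)))"

lemma curve_length_speed: "curve_length A g \<gamma> = (\<integral>\<^sup>+t\<in>{0..1}. ennreal (speed \<gamma> t) \<partial>lborel)"
  by (simp add: curve_length_def speed_def)

text \<open>The parameters near which the curve is C1 in some chart. The neighbourhood is open and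
  lies in the unit interval, so 0 and 1 never belong to this set.\<close>

definition regular :: "(real \<Rightarrow> 'a) \<Rightarrow> real set" where
  "regular \<gamma> = {t. \<exists>c\<in>A. \<exists>I. open I \<and> t \<in> I \<and> I \<subseteq> {0..1} \<and> \<gamma> ` I \<subseteq> chart_dom c \<and> continuous_on I \<gamma> \<and>
     (chart_map c \<circ> \<gamma>) C1_differentiable_on I}"

lemma open_regular: "open (regular \<gamma>)"
  unfolding open_subopen[of "regular \<gamma>"] unfolding regular_def by blast

text \<open>Near each parameter the curve stays in one chart and has finitely many exceptional
  points there; compactness of the unit interval leaves finitely many in total.\<close>

lemma finite_irregular:
  assumes \<gamma>: "piecewise_C1_curve A \<gamma>"
  shows "finite ({0..1} - regular \<gamma>)"
proof -
  have cont: "continuous_on {0..1} \<gamma>" using \<gamma> by (simp add: piecewise_C1_curve_def)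
  have "\<exists>T. open T \<and> t \<in> T \<and> finite (T \<inter> ({0..1} - regular \<gamma>))" if t: "t \<in> {0..1}" for t
  proof -
    let ?c = "chart_at A (\<gamma> t)"
    have c: "?c \<in> A" "\<gamma> t \<in> chart_dom ?c" by (rule chart_at)+
    obtain d where d: "d > 0" "\<And>s. s \<in> {0..1} \<Longrightarrow> dist s t < d \<Longrightarrow> \<gamma> s \<in> chart_dom ?c"
      using cont chart_open(1)[OF c(1)] c(2) t unfolding continuous_on_topological
      by (metis (no_types, lifting) open_dist dist_commute)
    \<comment> \<open>Half of \<open>d\<close> keeps the closed interval within the strict bound
      that guarantees the chart; clipping to the unit interval is why 0 and 1 join the exceptional
      points below.\<close>
    define a where "a = max 0 (t - d/2)"
    define b where "b = min 1 (t + d/2)"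
    have ab: "{a..b} \<subseteq> {0..1}" by (auto simp: a_def b_def)
    have im: "\<gamma> ` {a..b} \<subseteq> chart_dom ?c"
    proof clarify
      fix s assume "s \<in> {a..b}"
      then show "\<gamma> s \<in> chart_dom ?c" using d(1) by (intro d(2)) (auto simp: a_def b_def dist_real_def)
    qed
    have "(chart_map ?c \<circ> \<gamma>) piecewise_C1_differentiable_on {a..b}"
      using \<gamma> c(1) ab im unfolding piecewise_C1_curve_def by blast
    then obtain S where S: "finite S" "(chart_map ?c \<circ> \<gamma>) C1_differentiable_on {a..b} - S"
      unfolding piecewise_C1_differentiable_on_def by blast
    have "s \<in> regular \<gamma>" if s: "s \<in> {a<..<b} - S" for s
    proof -
      have "open ({a<..<b} - S)" using S(1) by (intro open_Diff) (auto simp: finite_imp_closed)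
      moreover have "{a<..<b} - S \<subseteq> {a..b}" by auto
      ultimately show ?thesis unfolding regular_def using s c(1) ab im
        by (auto intro!: bexI[of _ ?c] exI[of _ "{a<..<b} - S"] continuous_on_subset[OF cont]
           C1_differentiable_on_subset[OF S(2)])
    qed
    note reg = this
    have "{t - d/2<..<t + d/2} \<inter> ({0..1} - regular \<gamma>) \<subseteq> S \<union> {0, 1}"
    proof
      fix x assume x: "x \<in> {t - d/2<..<t + d/2} \<inter> ({0..1} - regular \<gamma>)"
      show "x \<in> S \<union> {0, 1}"
      proof (rule ccontr)
        assume "x \<notin> S \<union> {0, 1}"
        then have "x \<in> {a<..<b} - S" using x by (auto simp: a_def b_def)
        from reg[OF this] x show False by blast
      qed
    qed
    moreover have "finite (S \<union> {0, 1})" using S by auto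
    ultimately have "finite ({t - d/2<..<t + d/2} \<inter> ({0..1} - regular \<gamma>))" using finite_subset by blast
    then show ?thesis using d(1) by (intro exI[of _ "{t - d/2<..<t + d/2}"]) auto
  qed
  then obtain T where T: "\<forall>t\<in>{0..1}. open (T t) \<and> t \<in> T t \<and> finite (T t \<inter> ({0..1} - regular \<gamma>))"
    using bchoice[of "{0..1::real}" "\<lambda>t T. open T \<and> t \<in> T \<and> finite (T \<inter> ({0..1} - regular \<gamma>))"] by blast
  have "\<exists>D\<subseteq>{0..1}. finite D \<and> {0..1::real} \<subseteq> (\<Union>t\<in>D. T t)"
    by (rule compactE_image[OF compact_Icc[of "0::real" 1], of "{0..1}" T]) (use T in blast)+
  then obtain D where D: "D \<subseteq> {0..1}" "finite D" "{0..1} \<subseteq> (\<Union>t\<in>D. T t)" by blast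
  have "{0..1} - regular \<gamma> \<subseteq> (\<Union>t\<in>D. T t \<inter> ({0..1} - regular \<gamma>))" using D by auto
  moreover have "finite (\<Union>t\<in>D. T t \<inter> ({0..1} - regular \<gamma>))" using D T by blast
  ultimately show ?thesis by (rule finite_subset)
qed

lemma AE_regular:
  assumes "piecewise_C1_curve A \<gamma>"
  shows "AE t in lborel. t \<in> {0..1} \<longrightarrow> t \<in> regular \<gamma>"
  using AE_not_in[OF finite_imp_null_set_lborel[OF finite_irregular[OF assms]]] by eventually_elim auto

text \<open>Transition maps carry the C1 property from the chart that witnesses regularity to any
  other chart at the same point, on the parameters mapped into both domains.\<close>

lemma regular_chart:
  assumes t: "t \<in> regular \<gamma>" and c: "c \<in> A" "\<gamma> t \<in> chart_dom c"
  obtains I where "open I" "t \<in> I" "I \<subseteq> regular \<gamma>" "\<gamma> ` I \<subseteq> chart_dom c" "continuous_on I \<gamma>"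
    "(chart_map c \<circ> \<gamma>) C1_differentiable_on I"
proof -
  obtain d I where d: "d \<in> A" and I: "open I" "t \<in> I" "I \<subseteq> {0..1}" "\<gamma> ` I \<subseteq> chart_dom d" "continuous_on I \<gamma>"
    "(chart_map d \<circ> \<gamma>) C1_differentiable_on I" using t by (auto simp: regular_def)
  define J where "J = I \<inter> \<gamma> -` chart_dom c"
  have J: "open J" unfolding J_def
    using continuous_open_preimage[OF I(5,1) chart_open(1)[OF c(1)]] .
  have JI: "J \<subseteq> I" by (auto simp: J_def)
  obtain D where D: "\<And>s. s \<in> I \<Longrightarrow> ((chart_map d \<circ> \<gamma>) has_vector_derivative D s) (at s)" "continuous_on I D"
    using I(6) by (auto simp: C1_differentiable_on_def)
  have "(chart_map c \<circ> \<gamma>) C1_differentiable_on J"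
    unfolding C1_differentiable_on_def
  proof (intro exI conjI ballI)
    let ?D = "\<lambda>s. frechet_derivative (transition d c) (at (chart_map d (\<gamma> s))) (D s)"
    fix s assume s: "s \<in> J"
    then have s': "s \<in> I" "\<gamma> s \<in> chart_dom d" "\<gamma> s \<in> chart_dom c" using I by (auto simp: J_def)
    have "(transition d c has_derivative frechet_derivative (transition d c) (at (chart_map d (\<gamma> s)))) (at ((chart_map d \<circ> \<gamma>) s))"
      using C1_onD(1)[OF transition_C1_on[OF d c(1)]] s' by auto
    from vector_derivative_diff_chain_within[OF has_vector_derivative_at_within[OF D(1)[OF s'(1)]] has_derivative_at_withinI[OF this], of UNIV]
    have "((transition d c \<circ> (chart_map d \<circ> \<gamma>)) has_vector_derivative ?D s) (at s)" by (simp only:)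
    then show "((chart_map c \<circ> \<gamma>) has_vector_derivative ?D s) (at s)"
      by (rule has_vector_derivative_transform_within_open[OF _ J s])
        (use I d in \<open>auto simp: J_def chart_inv_map image_subset_iff\<close>)
  next
    show "continuous_on J (\<lambda>s. frechet_derivative (transition d c) (at (chart_map d (\<gamma> s))) (D s))"
    proof (rule C1_on_continuous_on_pair[OF transition_C1_on[OF d c(1)]])
      show "continuous_on J (\<lambda>s. chart_map d (\<gamma> s))"
        by (rule continuous_on_compose2[OF chart_map_cont[OF d] continuous_on_subset[OF I(5) JI]]) (use I JI in auto)
      show "continuous_on J D" by (rule continuous_on_subset[OF D(2) JI])
      show "(\<lambda>s. chart_map d (\<gamma> s)) ` J \<subseteq> chart_map d ` (chart_dom d \<inter> chart_dom c)" using I by (auto simp: J_def)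
    qed
  qed
  moreover have gJ: "\<gamma> ` J \<subseteq> chart_dom c" by (auto simp: J_def)
  moreover have cJ: "continuous_on J \<gamma>" by (rule continuous_on_subset[OF I(5) JI])
  ultimately have "J \<subseteq> regular \<gamma>" unfolding regular_def using J JI I(3) c(1) by blast
  then show ?thesis using that[OF J] gJ cJ \<open>_ C1_differentiable_on J\<close> I(2) c(2) by (auto simp: J_def)
qed

text \<open>Velocities transform by the Jacobian of the transition map, under which the metric form
  is invariant; this frees \<open>speed\<close> from the choice made by
  \<open>chart_at\<close>.\<close>

lemma speed_chart:
  assumes t: "t \<in> regular \<gamma>" and c: "c \<in> A" "\<gamma> t \<in> chart_dom c"
  defines "v \<equiv> vector_derivative (chart_map c \<circ> \<gamma>) (at t)"
  shows "((chart_map c \<circ> \<gamma>) has_vector_derivative v) (at t)" "speed \<gamma> t = sqrt (v \<bullet> (g c (\<gamma> t) *v v))"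
proof -
  obtain I where I: "open I" "t \<in> I" "\<gamma> ` I \<subseteq> chart_dom c" "(chart_map c \<circ> \<gamma>) C1_differentiable_on I" 
    using regular_chart[OF t c] by metis
  show der: "((chart_map c \<circ> \<gamma>) has_vector_derivative v) (at t)"
    using I(2,4) by (auto simp: C1_differentiable_on_eq v_def vector_derivative_works)
  let ?d = "chart_at A (\<gamma> t)"
  have d: "?d \<in> A" "\<gamma> t \<in> chart_dom ?d" by (rule chart_at)+
  have "(transition c ?d has_derivative (\<lambda>v. transition_jacobian c ?d (\<gamma> t) *v v)) (at ((chart_map c \<circ> \<gamma>) t))"
    using transition_has_derivative[OF c(1) d(1) c(2) d(2)] by simp
  from vector_derivative_diff_chain_within[OF has_vector_derivative_at_within[OF der] has_derivative_at_withinI[OF this], of UNIV]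
  have "((transition c ?d \<circ> (chart_map c \<circ> \<gamma>)) has_vector_derivative transition_jacobian c ?d (\<gamma> t) *v v) (at t)" by (simp only:)
  then have "((chart_map ?d \<circ> \<gamma>) has_vector_derivative transition_jacobian c ?d (\<gamma> t) *v v) (at t)"
    by (rule has_vector_derivative_transform_within_open[OF _ I(1,2)])
      (use I(3) c in \<open>auto simp: chart_inv_map image_subset_iff\<close>)
  then have "vector_derivative (chart_map ?d \<circ> \<gamma>) (at t) = transition_jacobian c ?d (\<gamma> t) *v v"
    by (rule vector_derivative_at)
  then show "speed \<gamma> t = sqrt (v \<bullet> (g c (\<gamma> t) *v v))"
    unfolding speed_def Let_def using metric_form_transform[OF c(1) d(1) c(2) d(2)] by simp
qed

lemma speed_nonneg: "0 \<le> speed \<gamma> t"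
  unfolding speed_def Let_def by (intro real_sqrt_ge_zero metric_nonneg chart_at)

lemma continuous_on_speed: "continuous_on (regular \<gamma>) (speed \<gamma>)"
proof -
  have "isCont (speed \<gamma>) t" if t: "t \<in> regular \<gamma>" for t
  proof -
    let ?c = "chart_at A (\<gamma> t)"
    have c: "?c \<in> A" "\<gamma> t \<in> chart_dom ?c" by (rule chart_at)+
    obtain I where I: "open I" "t \<in> I" "I \<subseteq> regular \<gamma>" "\<gamma> ` I \<subseteq> chart_dom ?c" "continuous_on I \<gamma>"
       "(chart_map ?c \<circ> \<gamma>) C1_differentiable_on I"
      using regular_chart[OF t c] by metis
    let ?v = "\<lambda>s. vector_derivative (chart_map ?c \<circ> \<gamma>) (at s)"
    have "continuous_on I (\<lambda>s. sqrt (?v s \<bullet> (g ?c (\<gamma> s) *v ?v s)))"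
      using I by (intro continuous_on_real_sqrt continuous_on_quadratic_form continuous_on_compose2[OF metric_cont[OF c(1)] I(5)])
        (auto simp: C1_differentiable_on_eq)
    then have "continuous_on I (speed \<gamma>)"
      by (rule continuous_on_eq) (use I c in \<open>auto intro!: speed_chart(2)[symmetric]\<close>)
    then show ?thesis using I(1,2) continuous_on_eq_continuous_at by blast
  qed
  then show ?thesis by (simp add: continuous_at_imp_continuous_on)
qed

text \<open>\<open>speed\<close> is continuous on the open set of regular parameters; cutting it to
  0 elsewhere gives a Borel function on the line, and changes it at finitely many points of the unit
  interval.\<close>

definition rspeed :: "(real \<Rightarrow> 'a) \<Rightarrow> real \<Rightarrow> real" where
  "rspeed \<gamma> t = indicator (regular \<gamma>) t * speed \<gamma> t"

lemma rspeed_measurable [measurable]: "rspeed \<gamma> \<in> borel_measurable borel"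
  using borel_measurable_continuous_on_indicator[OF borel_open[OF open_regular] continuous_on_speed]
  by (simp add: rspeed_def[abs_def])

lemma rspeed_nonneg: "0 \<le> rspeed \<gamma> t"
  by (simp add: rspeed_def speed_nonneg)

section \<open>Additivity and reparametrisation of arc length\<close>

definition arc_length :: "(real \<Rightarrow> 'a) \<Rightarrow> real set \<Rightarrow> ennreal" where
  "arc_length \<gamma> I = (\<integral>\<^sup>+t. ennreal (rspeed \<gamma> t) * indicator I t \<partial>lborel)"

lemma curve_length_arc:
  assumes "piecewise_C1_curve A \<gamma>" shows "curve_length A g \<gamma> = arc_length \<gamma> {0..1}"
  unfolding curve_length_speed arc_length_def
  by (rule nn_integral_cong_AE) (use AE_regular[OF assms] in \<open>eventually_elim, auto simp: rspeed_def indicator_def\<close>)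

lemma arc_length_Un:
  assumes "I \<in> sets borel" "J \<in> sets borel" "I \<inter> J = {}"
  shows "arc_length \<gamma> (I \<union> J) = arc_length \<gamma> I + arc_length \<gamma> J"
  unfolding arc_length_def using assms
  by (subst nn_integral_add[symmetric]) (auto intro!: nn_integral_cong simp: indicator_def)

lemma arc_length_point: "arc_length \<gamma> (insert a I) = arc_length \<gamma> I"
  unfolding arc_length_def
  by (rule nn_integral_cong_AE) (use AE_lborel_singleton[of a] in \<open>eventually_elim, auto simp: indicator_def\<close>)

lemma arc_length_split:
  assumes "a \<le> b" "b \<le> c"
  shows "arc_length \<gamma> {a..c} = arc_length \<gamma> {a..b} + arc_length \<gamma> {b..c}"
proof -
  have "{b..c} = insert b {b<..c}" "{a..c} = {a..b} \<union> {b<..c}" using assms by auto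
  moreover have "{a..b} \<inter> {b<..c} = {}" by auto
  ultimately show ?thesis using arc_length_Un[of "{a..b}" "{b<..c}" \<gamma>] arc_length_point[of \<gamma> b "{b<..c}"] by simp
qed

text \<open>The factor may have either sign, so this serves both for restricting a curve to a
  subinterval and for reversing it. The modulus of the factor in the speed is the one in the affine
  substitution of the integral.\<close>

lemma curve_affine:
  assumes \<gamma>: "piecewise_C1_curve A \<gamma>" and m: "m \<noteq> 0" and sub: "(\<lambda>t. m * t + a) ` {0..1} \<subseteq> {0..1}"
  shows "piecewise_C1_curve A (\<lambda>t. \<gamma> (m * t + a))"
    and "curve_length A g (\<lambda>t. \<gamma> (m * t + a)) = arc_length \<gamma> ((\<lambda>t. m * t + a) ` {0..1})"
proof -
  let ?l = "\<lambda>t. m * t + a"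
  show "piecewise_C1_curve A (\<lambda>t. \<gamma> (m * t + a))"
    unfolding piecewise_C1_curve_def
  proof (intro conjI ballI allI impI)
    show "continuous_on {0..1} (\<lambda>t. \<gamma> (m * t + a))"
      using \<gamma> sub by (auto simp: piecewise_C1_curve_def intro!: continuous_on_compose2[of "{0..1}" \<gamma>] continuous_intros)
    fix c s t assume c: "c \<in> A" and st: "{s..t} \<subseteq> {0..1} \<and> (\<lambda>t. \<gamma> (m * t + a)) ` {s..t} \<subseteq> chart_dom c"
    obtain s' t' where l: "?l ` {s..t} = {s'..t'}"
      using image_affinity_atLeastAtMost[of m a s t] by (metis atLeastatMost_empty_iff2)
    have "?l ` {s..t} \<subseteq> {0..1}" using st sub by blast
    then have "(chart_map c \<circ> \<gamma>) piecewise_C1_differentiable_on ?l ` {s..t}"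
      using \<gamma> c st unfolding l piecewise_C1_curve_def by (metis image_comp image_image l)
    from piecewise_C1_differentiable_affine[OF this]
    show "(chart_map c \<circ> (\<lambda>t. \<gamma> (m * t + a))) piecewise_C1_differentiable_on {s..t}" by (simp add: o_def)
  qed
  have sp: "speed (\<lambda>t. \<gamma> (m * t + a)) t = \<bar>m\<bar> * speed \<gamma> (?l t)" if t: "?l t \<in> regular \<gamma>" for t
  proof -
    let ?c = "chart_at A (\<gamma> (?l t))"
    have "(chart_map ?c \<circ> \<gamma>) differentiable at (?l t)"
      using speed_chart(1)[OF t chart_at] by (rule differentiableI_vector)
    from vector_derivative_chain_at[of ?l t, OF _ this]
    have "vector_derivative ((chart_map ?c \<circ> \<gamma>) \<circ> ?l) (at t) = vector_derivative ?l (at t) *\<^sub>R vector_derivative (chart_map ?c \<circ> \<gamma>) (at (?l t))"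
      by simp
    moreover have "vector_derivative ?l (at t) = m"
      by (intro vector_derivative_at) (auto intro!: derivative_eq_intros simp: has_real_derivative_iff_has_vector_derivative[symmetric])
    ultimately have "vector_derivative (chart_map ?c \<circ> (\<lambda>t. \<gamma> (m * t + a))) (at t) = m *\<^sub>R vector_derivative (chart_map ?c \<circ> \<gamma>) (at (?l t))"
      by (simp add: o_def)
    then show ?thesis unfolding speed_def Let_def
      by (simp only: quadratic_form_scaleR real_sqrt_mult real_sqrt_abs)
  qed
  define h where "h = (\<lambda>t. ennreal (rspeed \<gamma> t) * indicator (?l ` {0..1}) t)"
  have "?l ` {0..1} \<in> sets borel" by (simp add: image_affinity_atLeastAtMost)
  then have h: "h \<in> borel_measurable borel" unfolding h_def by measurable
  have "finite {t. ?l t \<in> {0..1} - regular \<gamma>}"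
    using finite_vimageI[OF finite_irregular[OF \<gamma>], of ?l] m by (auto simp: vimage_def inj_def)
  from AE_not_in[OF finite_imp_null_set_lborel[OF this]]
  have "AE t in lborel. ennreal (speed (\<lambda>t. \<gamma> (m * t + a)) t) * indicator {0..1} t = ennreal \<bar>m\<bar> * h (a + m * t)"
  proof eventually_elim
    case (elim t)
    show ?case
    proof (cases "t \<in> {0..1}")
      case True
      then have "?l t \<in> regular \<gamma>" using elim sub by blast
      moreover have "indicator (?l ` {0..1}) (?l t) = (1 :: ennreal)" using True by (intro indicator_simps(1) imageI)
      ultimately show ?thesis using True sp
        by (auto simp: h_def rspeed_def ennreal_mult' add.commute[of a])
    next
      case False
      then have "?l t \<notin> ?l ` {0..1}" using m by auto
      then show ?thesis using False by (simp add: h_def add.commute[of a])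
    qed
  qed
  then have "curve_length A g (\<lambda>t. \<gamma> (m * t + a)) = (\<integral>\<^sup>+t. ennreal \<bar>m\<bar> * h (a + m * t) \<partial>lborel)"
    unfolding curve_length_speed by (rule nn_integral_cong_AE)
  also have "\<dots> = ennreal \<bar>m\<bar> * (\<integral>\<^sup>+t. h (a + m * t) \<partial>lborel)"
    using h by (intro nn_integral_cmult) auto
  also have "\<dots> = (\<integral>\<^sup>+t. h t \<partial>lborel)" by (rule nn_integral_real_affine[OF h m, symmetric])
  finally show "curve_length A g (\<lambda>t. \<gamma> (m * t + a)) = arc_length \<gamma> (?l ` {0..1})"
    by (simp add: arc_length_def h_def)
qed

text \<open>Agreement on the closed interval yields equal derivatives in its interior; the end
  points form a null set.\<close>

lemma curve_length_cong:
  assumes "\<And>t. t \<in> {0..1} \<Longrightarrow> \<gamma> t = \<delta> t"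
  shows "curve_length A g \<gamma> = curve_length A g \<delta>"
proof -
  have "speed \<gamma> t = speed \<delta> t" if t: "t \<in> {0<..<1}" for t
  proof -
    have "eventually (\<lambda>s. s \<in> {0<..<1::real}) (nhds t)" using t by (intro eventually_nhds_in_open) auto
    then have "eventually (\<lambda>s. s \<in> UNIV \<longrightarrow> (chart_map c \<circ> \<gamma>) s = (chart_map c \<circ> \<delta>) s) (nhds t)" for c :: "('a, 'n) chart"
      by eventually_elim (simp add: assms)
    then have "vector_derivative (chart_map c \<circ> \<gamma>) (at t) = vector_derivative (chart_map c \<circ> \<delta>) (at t)" for c :: "('a, 'n) chart"
      by (rule vector_derivative_cong_eq) auto
    moreover have "\<gamma> t = \<delta> t" using assms t by auto
    ultimately show ?thesis unfolding speed_def Let_def by (simp only:)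
  qed
  then have *: "t \<in> {0<..<1} \<Longrightarrow> speed \<gamma> t = speed \<delta> t" for t .
  have "AE t in lborel. t \<noteq> (0::real)" "AE t in lborel. t \<noteq> (1::real)" by (rule AE_lborel_singleton)+
  then have "AE t in lborel. t \<in> {0..1} \<longrightarrow> t \<in> {0<..<1::real}" by eventually_elim auto
  then have "AE t in lborel. ennreal (speed \<gamma> t) * indicator {0..1} t = ennreal (speed \<delta> t) * indicator {0..1} t"
    by (rule eventually_mono) (use * in \<open>auto simp: indicator_def\<close>)
  then show ?thesis unfolding curve_length_speed by (rule nn_integral_cong_AE)
qed

text \<open>Each of the two curves is an affine reparametrisation of one half of the joined curve,
  so the length formula reduces to splitting one integral at 1/2.\<close>

lemma curve_join:
  assumes \<gamma>: "piecewise_C1_curve A \<gamma>" and \<delta>: "piecewise_C1_curve A \<delta>" and eq: "\<gamma> 1 = \<delta> 0"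
  shows "piecewise_C1_curve A (\<gamma> +++ \<delta>)" 
    and "curve_length A g (\<gamma> +++ \<delta>) = curve_length A g \<gamma> + curve_length A g \<delta>"
proof -
  show j: "piecewise_C1_curve A (\<gamma> +++ \<delta>)"
    unfolding piecewise_C1_curve_def
  proof (intro conjI ballI allI impI)
    have "path \<gamma>" "path \<delta>" using \<gamma> \<delta> by (auto simp: piecewise_C1_curve_def path_def)
    then show "continuous_on {0..1} (\<gamma> +++ \<delta>)"
      using path_join_imp[of \<gamma> \<delta>] eq by (simp add: path_def pathfinish_def pathstart_def)
    fix c s t assume c: "c \<in> A" and "{s..t} \<subseteq> {0..1} \<and> (\<gamma> +++ \<delta>) ` {s..t} \<subseteq> chart_dom c"
    then have st: "{s..t} \<subseteq> {0..1}" "(\<gamma> +++ \<delta>) ` {s..t} \<subseteq> chart_dom c" by auto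
    let ?f = "\<lambda>x. (chart_map c \<circ> \<gamma>) (2 *\<^sub>R x + 0)" and ?h = "\<lambda>x. (chart_map c \<circ> \<delta>) (2 *\<^sub>R x + (-1))"
    have part1: "?f piecewise_C1_differentiable_on {u..w}" if uw: "{u..w} \<subseteq> {s..t}" "w \<le> 1/2" for u w
    proof -
      have "(\<gamma> +++ \<delta>) x = \<gamma> (2 * x)" if "x \<in> {u..w}" for x using that uw by (auto simp: joinpaths_def)
      note join = this
      have "\<gamma> y \<in> chart_dom c" if "y \<in> {2*u..2*w}" for y
      proof -
        have "y / 2 \<in> {u..w}" using that by auto
        then show ?thesis using join[of "y / 2"] imageI[of "y / 2" "{s..t}" "\<gamma> +++ \<delta>"] st(2) uw(1) by auto
      qed
      then have "\<gamma> ` {2*u..2*w} \<subseteq> chart_dom c" by blast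
      moreover have "{2*u..2*w} \<subseteq> {0..1}" using st(1) uw by auto
      ultimately have "(chart_map c \<circ> \<gamma>) piecewise_C1_differentiable_on {2*u..2*w}"
        using \<gamma> c unfolding piecewise_C1_curve_def by blast
      moreover have "(\<lambda>x. 2 * x + 0) ` {u..w} = {2*u..2*w}" by (subst image_affinity_atLeastAtMost) auto
      ultimately show ?thesis using piecewise_C1_differentiable_affine[of "chart_map c \<circ> \<gamma>" 2 0 "{u..w}"] by (simp add: o_def)
    qed
    have part2: "?h piecewise_C1_differentiable_on {u..w}" if uw: "{u..w} \<subseteq> {s..t}" "1/2 \<le> u" for u w
    proof -
      have "(\<gamma> +++ \<delta>) x = \<delta> (2 * x - 1)" if "x \<in> {u..w}" for x 
      proof (cases "x = 1/2")
        case True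
        show ?thesis unfolding True joinpaths_def by (simp add: eq)
      next
        case False
        then show ?thesis using that uw by (auto simp: joinpaths_def)
      qed
      note join = this
      have "\<delta> y \<in> chart_dom c" if "y \<in> {2*u-1..2*w-1}" for y
      proof -
        have y: "(y + 1) / 2 \<in> {u..w}" using that by auto
        have e: "2 * ((y + 1) / 2) - 1 = y" by (simp add: field_simps)
        have "(\<gamma> +++ \<delta>) ((y + 1) / 2) = \<delta> y" using join[OF y] unfolding e .
        moreover have "(y + 1) / 2 \<in> {s..t}" using y uw(1) by blast
        ultimately show ?thesis using st(2) by (metis image_subset_iff)
      qed
      then have "\<delta> ` {2*u-1..2*w-1} \<subseteq> chart_dom c" by blast
      moreover have "{2*u-1..2*w-1} \<subseteq> {0..1}" using st(1) uw by auto
      ultimately have "(chart_map c \<circ> \<delta>) piecewise_C1_differentiable_on {2*u-1..2*w-1}"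
        using \<delta> c unfolding piecewise_C1_curve_def by blast
      moreover have "(\<lambda>x. 2 * x + (-1)) ` {u..w} = {2*u-1..2*w-1}" by (subst image_affinity_atLeastAtMost) auto
      ultimately show ?thesis using piecewise_C1_differentiable_affine[of "chart_map c \<circ> \<delta>" 2 "-1" "{u..w}"] by (simp add: o_def)
    qed
    have ff: "chart_map c \<circ> (\<gamma> +++ \<delta>) = (\<lambda>x. if x \<le> 1/2 then ?f x else ?h x)"
      by (auto simp: joinpaths_def fun_eq_iff)
    have e0: "?f (1/2) = ?h (1/2)" using eq by simp
    consider "t < s" | "s \<le> t" "t \<le> 1/2" | "s \<le> t" "1/2 \<le> s" | "s \<le> 1/2" "1/2 \<le> t" by linarith
    then show "(chart_map c \<circ> (\<gamma> +++ \<delta>)) piecewise_C1_differentiable_on {s..t}"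
    proof cases
      case 1
      then show ?thesis by (auto simp: piecewise_C1_differentiable_on_def intro!: exI[of _ "{}"])
    next
      case 2
      show ?thesis unfolding ff
        by (rule piecewise_C1_differentiable_on_cong[OF part1[of s t]]) (use 2 in auto)
    next
      case 3
      show ?thesis unfolding ff
      proof (rule piecewise_C1_differentiable_on_cong[OF part2[of s t]])
        show "?h x = (if x \<le> 1/2 then ?f x else ?h x)" if "x \<in> {s..t}" for x
        proof (cases "x = 1/2")
          case True
          show ?thesis unfolding True using e0 by simp
        qed (use that 3 in auto)
      qed (use 3 in auto)
    next
      case 4
      show ?thesis unfolding ff
        by (rule piecewise_C1_differentiable_cases[OF part1 part2]) (use 4 e0 in auto)
    qed
  qed
  show "curve_length A g (\<gamma> +++ \<delta>) = curve_length A g \<gamma> + curve_length A g \<delta>"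
  proof -
    have "curve_length A g \<gamma> = curve_length A g (\<lambda>t. (\<gamma> +++ \<delta>) (1/2 * t + 0))"
      by (rule curve_length_cong) (auto simp: joinpaths_def)
    also have "\<dots> = arc_length (\<gamma> +++ \<delta>) ((\<lambda>t. 1/2 * t + 0) ` {0..1})"
      by (rule curve_affine(2)[OF j]) auto
    also have "(\<lambda>t. 1/2 * t + 0) ` {0..1} = {0..1/2::real}" by (subst image_affinity_atLeastAtMost) auto
    finally have 1: "curve_length A g \<gamma> = arc_length (\<gamma> +++ \<delta>) {0..1/2}" .
    have "curve_length A g \<delta> = curve_length A g (\<lambda>t. (\<gamma> +++ \<delta>) (1/2 * t + 1/2))"
    proof (rule curve_length_cong)
      fix t :: real assume t: "t \<in> {0..1}"
      have e: "2 * (1/2 * t + 1/2) - 1 = t" by (simp add: field_simps)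
      show "\<delta> t = (\<gamma> +++ \<delta>) (1/2 * t + 1/2)"
        unfolding joinpaths_def e using t eq by (cases "t = 0") auto
    qed
    also have "\<dots> = arc_length (\<gamma> +++ \<delta>) ((\<lambda>t. 1/2 * t + 1/2) ` {0..1})"
      by (rule curve_affine(2)[OF j]) auto
    also have "(\<lambda>t. 1/2 * t + 1/2) ` {0..1} = {1/2..1::real}" by (subst image_affinity_atLeastAtMost) auto
    finally have 2: "curve_length A g \<delta> = arc_length (\<gamma> +++ \<delta>) {1/2..1}" .
    show ?thesis unfolding 1 2 curve_length_arc[OF j] by (rule arc_length_split) auto
  qed
qed

end

section \<open>The Riemannian distance\<close>

context riemannian_manifold
begin

section \<open>Coordinate segments and the extended distance\<close>

lemma open_chart_inv_image:
  assumes c: "c \<in> A" and W: "open W" "W \<subseteq> chart_im c"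
  shows "open (chart_inv c ` W)"
proof -
  have "chart_inv c ` W = chart_dom c \<inter> chart_map c -` W"
  proof (intro equalityI subsetI)
    fix x assume "x \<in> chart_inv c ` W"
    then obtain y where "y \<in> W" "x = chart_inv c y" by blast
    then show "x \<in> chart_dom c \<inter> chart_map c -` W"
      using W(2) chart_inv_dom[OF c, of y] chart_map_inv[OF c, of y] by auto
  next
    fix x assume x: "x \<in> chart_dom c \<inter> chart_map c -` W"
    then show "x \<in> chart_inv c ` W" using chart_inv_map[OF c, of x] by (intro image_eqI[of _ _ "chart_map c x"]) auto
  qed
  then show ?thesis using continuous_open_preimage[OF chart_map_cont[OF c] chart_open(1)[OF c] W(1)] by simp
qed

text \<open>Over the unit parameter interval the coordinate velocity is the constant vector
  \<open>z - y\<close>, so \<open>K\<close> bounds the speed and thereby the length.\<close>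

lemma segment_curve:
  assumes c: "c \<in> A" and seg: "closed_segment y z \<subseteq> chart_im c" and K: "0 \<le> K"
    and bd: "\<And>w. w \<in> closed_segment y z \<Longrightarrow> (z - y) \<bullet> (g c (chart_inv c w) *v (z - y)) \<le> K\<^sup>2"
  defines "\<gamma> \<equiv> \<lambda>t. chart_inv c (y + t *\<^sub>R (z - y))"
  shows "piecewise_C1_curve A \<gamma>" and "curve_length A g \<gamma> \<le> ennreal K"
proof -
  let ?p = "\<lambda>t. y + t *\<^sub>R (z - y)"
  have p: "?p t \<in> closed_segment y z" if "t \<in> {0..1}" for t
    using that unfolding closed_segment_def by (auto simp: algebra_simps intro!: exI[of _ t])
  have der: "(?p has_vector_derivative (z - y)) (at t)" for t
    by (auto intro!: derivative_eq_intros)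
  have cp: "continuous_on T ?p" for T by (intro continuous_intros)
  have chain: "((chart_map d \<circ> \<gamma>) has_vector_derivative frechet_derivative (transition c d) (at (?p t)) (z - y)) (at t)"
    if d: "d \<in> A" "\<gamma> t \<in> chart_dom d" and t: "t \<in> {0..1}" for d t
  proof -
    have "?p t \<in> chart_map c ` (chart_dom c \<inter> chart_dom d)"
      using p[OF t] seg d(2) chart_map_inv[OF c, of "?p t"] chart_inv_dom[OF c, of "?p t"]
      by (intro image_eqI[of _ _ "\<gamma> t"]) (auto simp: \<gamma>_def)
    from C1_onD(1)[OF transition_C1_on[OF c d(1)] this]
    have "(transition c d has_derivative frechet_derivative (transition c d) (at (?p t))) (at (?p t))" .
    from vector_derivative_diff_chain_within[OF has_vector_derivative_at_within[OF der] has_derivative_at_withinI[OF this], of UNIV]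
    show ?thesis by (simp add: o_def \<gamma>_def)
  qed
  show "piecewise_C1_curve A \<gamma>"
    unfolding piecewise_C1_curve_def
  proof (intro conjI ballI allI impI)
    show "continuous_on {0..1} \<gamma>" unfolding \<gamma>_def
      by (rule continuous_on_compose2[OF chart_inv_cont[OF c] cp]) (use p seg in auto)
    fix d a b assume d: "d \<in> A" and ab: "{a..b} \<subseteq> {0..1} \<and> \<gamma> ` {a..b} \<subseteq> chart_dom d"
    have "continuous_on {a..b} (\<lambda>t. frechet_derivative (transition c d) (at (?p t)) (z - y))"
    proof (rule C1_on_continuous_on_pair[OF transition_C1_on[OF c d] cp])
      show "?p ` {a..b} \<subseteq> chart_map c ` (chart_dom c \<inter> chart_dom d)"
      proof clarify
        fix t assume t: "t \<in> {a..b}"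
        then have "?p t \<in> chart_im c" "\<gamma> t \<in> chart_dom d" using p seg ab by blast+
        then show "?p t \<in> chart_map c ` (chart_dom c \<inter> chart_dom d)"
          using chart_map_inv[OF c, of "?p t"] chart_inv_dom[OF c, of "?p t"]
          by (intro image_eqI[of _ _ "\<gamma> t"]) (auto simp: \<gamma>_def)
      qed
    qed auto
    moreover have "\<forall>t\<in>{a..b}. ((chart_map d \<circ> \<gamma>) has_vector_derivative frechet_derivative (transition c d) (at (?p t)) (z - y)) (at t)"
      using chain[OF d] ab by blast
    ultimately have "(chart_map d \<circ> \<gamma>) C1_differentiable_on {a..b}"
      unfolding C1_differentiable_on_def
      by (intro exI[of _ "\<lambda>t. frechet_derivative (transition c d) (at (?p t)) (z - y)"] conjI)
    then show "(chart_map d \<circ> \<gamma>) piecewise_C1_differentiable_on {a..b}"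
      by (rule C1_differentiable_imp_piecewise)
  qed
  have "speed \<gamma> t \<le> K" if t: "t \<in> {0..1}" for t
  proof -
    let ?d = "chart_at A (\<gamma> t)"
    have d: "?d \<in> A" "\<gamma> t \<in> chart_dom ?d" by (rule chart_at)+
    have im: "?p t \<in> chart_im c" using p[OF t] seg by blast
    have gc: "\<gamma> t \<in> chart_dom c" "chart_map c (\<gamma> t) = ?p t"
      using chart_inv_dom[OF c im] chart_map_inv[OF c im] by (simp_all add: \<gamma>_def)
    have "frechet_derivative (transition c ?d) (at (?p t)) (z - y) = transition_jacobian c ?d (\<gamma> t) *v (z - y)"
      using frechet_derivative_at[OF transition_has_derivative[OF c d(1) gc(1) d(2)]] unfolding gc(2) by metis
    then have "vector_derivative (chart_map ?d \<circ> \<gamma>) (at t) = transition_jacobian c ?d (\<gamma> t) *v (z - y)"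
      using vector_derivative_at[OF chain[OF d t]] by simp
    then have "speed \<gamma> t = sqrt ((z - y) \<bullet> (g c (\<gamma> t) *v (z - y)))"
      unfolding speed_def Let_def using metric_form_transform[OF c d(1) gc(1) d(2)] by simp
    also have "\<dots> \<le> sqrt (K\<^sup>2)" using bd[OF p[OF t]] unfolding \<gamma>_def by (rule real_sqrt_le_mono)
    finally show ?thesis using K by simp
  qed
  note le_K = this
  have "curve_length A g \<gamma> \<le> (\<integral>\<^sup>+t. ennreal K * indicator {0..1::real} t \<partial>lborel)"
    unfolding curve_length_speed
  proof (rule Nonnegative_Lebesgue_Integration.nn_integral_mono)
    fix t
    show "ennreal (speed \<gamma> t) * indicator {0..1} t \<le> ennreal K * indicator {0..1} t"
      using le_K[of t] by (cases "t \<in> {0..1}") (auto intro: ennreal_leI)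
  qed
  also have "\<dots> = ennreal K" by (simp add: nn_integral_cmult_indicator)
  finally show "curve_length A g \<gamma> \<le> ennreal K" .
qed

text \<open>The infimum before \<open>enn2real\<close> is applied. That map sends infinity to 0, so
  the metric laws are proved for this extended distance and passed to \<open>d\<close> once it is
  known to be finite.\<close>

definition ext_dist :: "'a \<Rightarrow> 'a \<Rightarrow> ennreal" where
  "ext_dist x y = (INF \<gamma> \<in> {\<gamma>. piecewise_C1_curve A \<gamma> \<and> \<gamma> 0 = x \<and> \<gamma> 1 = y}. curve_length A g \<gamma>)"

abbreviation d :: "'a \<Rightarrow> 'a \<Rightarrow> real" where
  "d \<equiv> riemannian_distance A g"

lemma d_ext_dist: "d x y = enn2real (ext_dist x y)"
  by (simp add: riemannian_distance_def ext_dist_def)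

lemma ext_dist_le: "piecewise_C1_curve A \<gamma> \<Longrightarrow> ext_dist (\<gamma> 0) (\<gamma> 1) \<le> curve_length A g \<gamma>"
  unfolding ext_dist_def by (rule INF_lower) simp

lemma ext_dist_less:
  assumes "ext_dist x y < K"
  obtains \<gamma> where "piecewise_C1_curve A \<gamma>" "\<gamma> 0 = x" "\<gamma> 1 = y" "curve_length A g \<gamma> < K"
  using assms unfolding ext_dist_def INF_less_iff by blast

lemma ext_dist_chart:
  assumes c: "c \<in> A" and seg: "closed_segment y z \<subseteq> chart_im c" and K: "0 \<le> K"
    and bd: "\<And>w. w \<in> closed_segment y z \<Longrightarrow> (z - y) \<bullet> (g c (chart_inv c w) *v (z - y)) \<le> K\<^sup>2"
  shows "ext_dist (chart_inv c y) (chart_inv c z) \<le> ennreal K"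
  using ext_dist_le[OF segment_curve(1)[OF assms]] segment_curve(2)[OF assms] by simp

lemma ext_dist_refl [simp]: "ext_dist x x = 0"
proof -
  have c: "chart_at A x \<in> A" "x \<in> chart_dom (chart_at A x)" by (rule chart_at)+
  have "ext_dist (chart_inv (chart_at A x) (chart_map (chart_at A x) x)) (chart_inv (chart_at A x) (chart_map (chart_at A x) x)) \<le> ennreal 0"
    by (rule ext_dist_chart[OF c(1)]) (use c in auto)
  then show ?thesis using c by (simp add: chart_inv_map)
qed

lemma ext_dist_sym_le: "ext_dist y x \<le> ext_dist x y"
proof -
  have "ext_dist y x \<le> curve_length A g \<gamma>" if \<gamma>: "piecewise_C1_curve A \<gamma>" "\<gamma> 0 = x" "\<gamma> 1 = y" for \<gamma>
  proof -
    have im: "(\<lambda>t. -1 * t + 1) ` {0..1} = {0..1::real}"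
      unfolding image_affinity_atLeastAtMost by auto
    have r: "piecewise_C1_curve A (\<lambda>t. \<gamma> (-1 * t + 1))" "curve_length A g (\<lambda>t. \<gamma> (-1 * t + 1)) = arc_length \<gamma> {0..1}"
      using curve_affine[OF \<gamma>(1), of "-1" 1] im by auto
    then show ?thesis using ext_dist_le[OF r(1)] \<gamma> curve_length_arc[OF \<gamma>(1)] by simp
  qed
  then show ?thesis unfolding ext_dist_def[of x y] by (intro INF_greatest) auto
qed

lemma ext_dist_sym: "ext_dist x y = ext_dist y x"
  by (rule antisym) (rule ext_dist_sym_le)+

lemma ext_dist_triangle: "ext_dist x z \<le> ext_dist x y + ext_dist y z"
proof (rule ennreal_le_epsilon)
  fix e :: real assume fin: "ext_dist x y + ext_dist y z < top" and e: "0 < e"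
  have lt: "u < u + ennreal (e/2)" if "u < top" for u :: ennreal
    using that e by (cases u rule: ennreal_cases) (auto simp flip: ennreal_plus simp: ennreal_lessI)
  have "ext_dist x y < top" "ext_dist y z < top" using fin by auto
  obtain \<gamma> where \<gamma>: "piecewise_C1_curve A \<gamma>" "\<gamma> 0 = x" "\<gamma> 1 = y" "curve_length A g \<gamma> < ext_dist x y + ennreal (e/2)"
    using ext_dist_less[OF lt[OF \<open>ext_dist x y < top\<close>]] by blast
  obtain \<delta> where \<delta>: "piecewise_C1_curve A \<delta>" "\<delta> 0 = y" "\<delta> 1 = z" "curve_length A g \<delta> < ext_dist y z + ennreal (e/2)"
    using ext_dist_less[OF lt[OF \<open>ext_dist y z < top\<close>]] by blast
  have eq: "\<gamma> 1 = \<delta> 0" using \<gamma> \<delta> by simp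
  have "ext_dist x z \<le> curve_length A g (\<gamma> +++ \<delta>)"
    using ext_dist_le[OF curve_join(1)[OF \<gamma>(1) \<delta>(1) eq]] \<gamma> \<delta> by (simp add: joinpaths_def)
  also have "\<dots> = curve_length A g \<gamma> + curve_length A g \<delta>" by (rule curve_join(2)[OF \<gamma>(1) \<delta>(1) eq])
  also have "\<dots> \<le> (ext_dist x y + ennreal (e/2)) + (ext_dist y z + ennreal (e/2))"
    using \<gamma>(4) \<delta>(4) by (intro add_mono) auto
  also have "\<dots> = ext_dist x y + ext_dist y z + (ennreal (e/2) + ennreal (e/2))" by (simp add: add_ac)
  also have "ennreal (e/2) + ennreal (e/2) = ennreal e" using e by (simp flip: ennreal_plus)
  finally show "ext_dist x z \<le> ext_dist x y + ext_dist y z + ennreal e" .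
qed

text \<open>On a compact coordinate ball continuity and positivity squeeze \<open>g\<close> between
  two multiples of the Euclidean metric. The constants are squared so that m and M compare lengths
  directly.\<close>

lemma local_bounds:
  assumes c: "c \<in> A" and p: "p \<in> chart_dom c" and U: "open U" "p \<in> U"
  obtains \<rho> m M where "\<rho> > 0" "m > 0" "M > 0" "cball (chart_map c p) \<rho> \<subseteq> chart_im c" 
    "chart_inv c ` cball (chart_map c p) \<rho> \<subseteq> U"
    "\<And>y v. y \<in> cball (chart_map c p) \<rho> \<Longrightarrow> m\<^sup>2 * (v \<bullet> v) \<le> v \<bullet> (g c (chart_inv c y) *v v)"
    "\<And>y v. y \<in> cball (chart_map c p) \<rho> \<Longrightarrow> v \<bullet> (g c (chart_inv c y) *v v) \<le> M\<^sup>2 * (v \<bullet> v)"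
proof -
  let ?y = "chart_map c p"
  have "open (chart_map c ` (chart_dom c \<inter> U))"
    by (rule open_chart_image[OF c]) (use U chart_open(1)[OF c] in auto)
  moreover have "?y \<in> chart_map c ` (chart_dom c \<inter> U)" using p U by auto
  ultimately obtain \<rho> where \<rho>: "\<rho> > 0" "cball ?y \<rho> \<subseteq> chart_map c ` (chart_dom c \<inter> U)"
    unfolding open_contains_cball by blast
  let ?K = "cball ?y \<rho>" and ?G = "\<lambda>y. g c (chart_inv c y)"
  have im: "?K \<subseteq> chart_im c" using \<rho>(2) by blast
  have dm: "chart_inv c y \<in> chart_dom c" if "y \<in> ?K" for y using chart_inv_dom[OF c] im that by blast
  have cG: "continuous_on ?K ?G"
    using continuous_on_subset[OF C1_on_imp_continuous_on[OF metric_C1_on[OF c]] im] by (simp add: o_def)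
  obtain m where m: "m > 0" "\<And>y v. y \<in> ?K \<Longrightarrow> m * (v \<bullet> v) \<le> v \<bullet> (?G y *v v)"
    by (rule pos_def_lower_bound[OF compact_cball cG]) (use metric_pos[OF c dm] in auto)
  have "bounded (?G ` ?K)" by (intro compact_imp_bounded compact_continuous_image cG compact_cball)
  then obtain B where B: "\<And>y. y \<in> ?K \<Longrightarrow> norm (?G y) \<le> B" unfolding bounded_iff by blast
  define M where "M = sqrt (max 1 B)"
  have M: "M > 0" "M\<^sup>2 = max 1 B" by (auto simp: M_def)
  show ?thesis
  proof (rule that[OF \<rho>(1) _ M(1) im])
    show "sqrt m > 0" using m by simp
    show "chart_inv c ` ?K \<subseteq> U" using \<rho>(2) by (auto simp: chart_inv_map[OF c] dest!: subsetD)
    show "(sqrt m)\<^sup>2 * (v \<bullet> v) \<le> v \<bullet> (?G y *v v)" if "y \<in> ?K" for y v using m that by simp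
    show "v \<bullet> (?G y *v v) \<le> M\<^sup>2 * (v \<bullet> v)" if y: "y \<in> ?K" for y v
    proof -
      have "v \<bullet> (?G y *v v) \<le> norm (?G y) * (v \<bullet> v)" using abs_quadratic_form_le[of v "?G y"] by linarith
      also have "\<dots> \<le> M\<^sup>2 * (v \<bullet> v)" unfolding M(2) using B[OF y] by (intro mult_right_mono) auto
      finally show ?thesis .
    qed
  qed
qed

text \<open>A curve that leaves the coordinate ball is cut off at its exit time.\<close>
lemma ext_dist_escape:
  assumes c: "c \<in> A" and y: "cball y \<rho> \<subseteq> chart_im c" and \<rho>: "\<rho> > 0" and m: "m > 0"
    and low: "\<And>w v. w \<in> cball y \<rho> \<Longrightarrow> m\<^sup>2 * (v \<bullet> v) \<le> v \<bullet> (g c (chart_inv c w) *v v)"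
    and q: "q \<notin> chart_inv c ` ball y \<rho>"
  shows "ennreal (m * \<rho>) \<le> ext_dist (chart_inv c y) q"
  unfolding ext_dist_def
proof (rule INF_greatest, clarify)
  fix \<gamma> assume \<gamma>: "piecewise_C1_curve A \<gamma>" and g0: "\<gamma> 0 = chart_inv c y" and q1: "q = \<gamma> 1"
  have cont: "continuous_on {0..1} \<gamma>" using \<gamma> by (simp add: piecewise_C1_curve_def)
  let ?B = "chart_inv c ` ball y \<rho>" and ?C = "chart_inv c ` cball y \<rho>"
  have bc: "ball y \<rho> \<subseteq> chart_im c" using y ball_subset_cball by blast
  have "open ?B" by (rule open_chart_inv_image[OF c open_ball bc])
  have BC: "?B \<subseteq> ?C" by (rule image_mono[OF ball_subset_cball])
  have "compact ?C" by (intro compact_continuous_image continuous_on_subset[OF chart_inv_cont[OF c] y] compact_cball)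
  then have "closed ?C" by (rule compact_imp_closed)
  \<comment> \<open>The times at which the curve is outside the open coordinate ball. This set is
    closed and contains 1, so its infimum is attained and is the exit time.\<close>
  define Z where "Z = {0..1} \<inter> \<gamma> -` (- ?B)"
  have "closed Z" unfolding Z_def
    using continuous_on_closed_vimage[of "{0..1::real}" \<gamma>] cont \<open>open ?B\<close> by (auto simp: Int_commute)
  have "1 \<in> Z" using q q1 by (simp add: Z_def)
  have bdd: "bdd_below Z" by (auto simp: Z_def bdd_below_def)
  define T where "T = Inf Z"
  have TZ: "T \<in> Z" unfolding T_def by (rule closed_contains_Inf) (use \<open>1 \<in> Z\<close> bdd \<open>closed Z\<close> in auto)
  then have T: "0 \<le> T" "T \<le> 1" "\<gamma> T \<notin> ?B" by (auto simp: Z_def)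
  have "0 \<notin> Z" using g0 \<rho> by (auto simp: Z_def)
  then have T0: "0 < T" using T TZ by (cases "T = 0") auto
  have before: "\<gamma> t \<in> ?B" if "0 \<le> t" "t < T" for t
  proof (rule ccontr)
    assume "\<gamma> t \<notin> ?B"
    then have "t \<in> Z" using that T by (auto simp: Z_def)
    then have "T \<le> t" unfolding T_def using bdd by (rule cInf_lower)
    then show False using that by simp
  qed
  \<comment> \<open>The times before \<open>T\<close> are dense in \<open>{0..T}\<close>, so the
    exit point still lies in the closed coordinate ball, where the lower metric bound is
    available.\<close>
  have "\<gamma> T \<in> ?C"
  proof -
    have "closed ({0..T} \<inter> \<gamma> -` ?C)"
      by (rule continuous_closed_preimage[OF continuous_on_subset[OF cont]]) (use T \<open>closed ?C\<close> in auto)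
    moreover have "{0..<T} \<subseteq> {0..T} \<inter> \<gamma> -` ?C"
    proof
      fix t assume "t \<in> {0..<T}"
      then show "t \<in> {0..T} \<inter> \<gamma> -` ?C" using before[of t] BC by auto
    qed
    ultimately have "closure {0..<T} \<subseteq> {0..T} \<inter> \<gamma> -` ?C" by (rule closure_minimal[rotated])
    moreover have "closure {0..<T} = {0..T}" using T0 by simp
    ultimately show ?thesis using T by auto
  qed
  have inC: "\<gamma> t \<in> ?C" if "t \<in> {0..T}" for t
    using before[of t] BC \<open>\<gamma> T \<in> ?C\<close> that by (cases "t = T") auto
  have inC': "\<gamma> t \<in> chart_dom c" "chart_map c (\<gamma> t) \<in> cball y \<rho>" if t: "t \<in> {0..T}" for t
  proof -
    obtain w where w: "w \<in> cball y \<rho>" "\<gamma> t = chart_inv c w" using inC[OF t] by blast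
    then have "w \<in> chart_im c" using y by blast
    then show "\<gamma> t \<in> chart_dom c" "chart_map c (\<gamma> t) \<in> cball y \<rho>"
      using w chart_inv_dom[OF c] chart_map_inv[OF c] by simp_all
  qed
  then have gdom: "\<gamma> ` {0..T} \<subseteq> chart_dom c" by (intro image_subsetI)
  define f where "f = chart_map c \<circ> \<gamma>"
  have cf: "continuous_on {0..T} f" unfolding f_def
    by (rule continuous_on_compose[OF continuous_on_subset[OF cont] continuous_on_subset[OF chart_map_cont[OF c] gdom]])
      (use T in auto)
  have fC: "f t \<in> cball y \<rho>" if "t \<in> {0..T}" for t
    using inC'(2)[OF that] by (simp add: f_def)
  have "y \<in> cball y \<rho>" using \<rho> by simp
  then have "y \<in> chart_im c" using y by blast
  then have f0: "f 0 = y" by (simp add: f_def g0 chart_map_inv[OF c])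
  have "f T \<notin> ball y \<rho>"
  proof
    assume "f T \<in> ball y \<rho>"
    then have "chart_inv c (f T) \<in> ?B" by blast
    moreover have "chart_inv c (f T) = \<gamma> T" using inC'(1)[of T] T by (simp add: f_def chart_inv_map[OF c])
    ultimately show False using T by simp
  qed
  then have nf: "\<rho> \<le> norm (f T - f 0)" unfolding f0 by (simp add: dist_norm norm_minus_commute)
  have "ennreal (norm (f T - f 0)) \<le> (\<integral>\<^sup>+t. ennreal (rspeed \<gamma> t / m) * indicator {0..T} t \<partial>lborel)"
  proof (rule norm_increment_le_nn_integral[OF finite_irregular[OF \<gamma>] T(1) cf])
    fix t assume t: "t \<in> {0<..<T} - ({0..1} - regular \<gamma>)"
    then have tr: "t \<in> regular \<gamma>" "t \<in> {0..T}" using T by auto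
    then have gt: "\<gamma> t \<in> chart_dom c" using inC'(1) by blast
    let ?v = "vector_derivative f (at t)"
    show "(f has_vector_derivative ?v) (at t)"
      unfolding f_def by (rule speed_chart(1)[OF tr(1) c gt])
    have sp: "speed \<gamma> t = sqrt (?v \<bullet> (g c (\<gamma> t) *v ?v))"
      unfolding f_def by (rule speed_chart(2)[OF tr(1) c gt])
    have "m\<^sup>2 * (?v \<bullet> ?v) \<le> ?v \<bullet> (g c (chart_inv c (f t)) *v ?v)" by (rule low[OF fC[OF tr(2)]])
    moreover have "chart_inv c (f t) = \<gamma> t" using gt by (simp add: f_def chart_inv_map[OF c])
    ultimately have "sqrt ((m * norm ?v)\<^sup>2) \<le> speed \<gamma> t"
      unfolding sp by (intro real_sqrt_le_mono) (simp add: power_mult_distrib dot_square_norm)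
    then have "m * norm ?v \<le> speed \<gamma> t" using m by simp
    then show "norm ?v \<le> rspeed \<gamma> t / m" using m tr(1) by (simp add: rspeed_def field_simps)
  qed (use m rspeed_nonneg in auto)
  also have "\<dots> \<le> (\<integral>\<^sup>+t. ennreal (1/m) * (ennreal (rspeed \<gamma> t) * indicator {0..1} t) \<partial>lborel)"
  proof (rule nn_integral_mono)
    fix t
    show "ennreal (rspeed \<gamma> t / m) * indicator {0..T} t \<le> ennreal (1/m) * (ennreal (rspeed \<gamma> t) * indicator {0..1} t)"
      using T m ennreal_mult'[of "1/m" "rspeed \<gamma> t"] by (cases "t \<in> {0..T}") auto
  qed
  also have "\<dots> = ennreal (1/m) * curve_length A g \<gamma>"
    unfolding curve_length_arc[OF \<gamma>] arc_length_def by (rule nn_integral_cmult) measurable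
  finally have "ennreal \<rho> \<le> ennreal (1/m) * curve_length A g \<gamma>" using nf by (meson ennreal_leI order_trans)
  then have "ennreal m * ennreal \<rho> \<le> ennreal m * (ennreal (1/m) * curve_length A g \<gamma>)" by (rule mult_left_mono) simp
  also have "\<dots> = curve_length A g \<gamma>" using m by (simp add: mult.assoc[symmetric] ennreal_mult'[symmetric])
  finally show "ennreal (m * \<rho>) \<le> curve_length A g \<gamma>" using m by (simp add: ennreal_mult')
qed

text \<open>A coordinate segment near \<open>p\<close> has length at most M times its Euclidean
  length, so a coordinate ball of radius e / M is close enough.\<close>

lemma ext_dist_near:
  assumes p: "p \<in> U" and U: "open U" and e: "e > 0"
  obtains V where "open V" "p \<in> V" "V \<subseteq> U" "\<And>q. q \<in> V \<Longrightarrow> ext_dist p q < ennreal e"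
proof -
  let ?c = "chart_at A p"
  have c: "?c \<in> A" "p \<in> chart_dom ?c" by (rule chart_at)+
  obtain \<rho> m M where b: "\<rho> > 0" "M > 0" "cball (chart_map ?c p) \<rho> \<subseteq> chart_im ?c" 
    "chart_inv ?c ` cball (chart_map ?c p) \<rho> \<subseteq> U"
    "\<And>y v. y \<in> cball (chart_map ?c p) \<rho> \<Longrightarrow> v \<bullet> (g ?c (chart_inv ?c y) *v v) \<le> M\<^sup>2 * (v \<bullet> v)"
    using local_bounds[OF c U p] by metis
  define r where "r = min \<rho> (e / M)"
  have r: "r > 0" "r \<le> \<rho>" "r \<le> e / M" using b e by (auto simp: r_def)
  define V where "V = chart_dom ?c \<inter> chart_map ?c -` ball (chart_map ?c p) r"
  show ?thesis
  proof (rule that[of V])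
    show "open V" unfolding V_def
      by (rule continuous_open_preimage[OF chart_map_cont[OF c(1)] chart_open(1)[OF c(1)] open_ball])
    show "p \<in> V" using c r by (simp add: V_def)
    show "V \<subseteq> U"
    proof
      fix q assume "q \<in> V"
      then have "q \<in> chart_dom ?c" "chart_map ?c q \<in> cball (chart_map ?c p) \<rho>" using r by (auto simp: V_def)
      then show "q \<in> U" using b(4) chart_inv_map[OF c(1), of q] by force
    qed
    fix q assume q: "q \<in> V"
    define w where "w = chart_map ?c q - chart_map ?c p"
    have nw: "norm w < r" using q by (simp add: V_def w_def dist_norm norm_minus_commute)
    have seg: "closed_segment (chart_map ?c p) (chart_map ?c q) \<subseteq> cball (chart_map ?c p) \<rho>"
      using q r b(1) by (intro closed_segment_subset) (auto simp: V_def)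
    have "ext_dist (chart_inv ?c (chart_map ?c p)) (chart_inv ?c (chart_map ?c q)) \<le> ennreal (M * norm w)"
    proof (rule ext_dist_chart[OF c(1)])
      show "closed_segment (chart_map ?c p) (chart_map ?c q) \<subseteq> chart_im ?c" using seg b by blast
      show "(chart_map ?c q - chart_map ?c p) \<bullet> (g ?c (chart_inv ?c u) *v (chart_map ?c q - chart_map ?c p)) \<le> (M * norm w)\<^sup>2"
        if "u \<in> closed_segment (chart_map ?c p) (chart_map ?c q)" for u
        using b(5)[of u w] that seg by (auto simp: w_def[symmetric] power_mult_distrib dot_square_norm)
    qed (use b in auto)
    moreover have "M * norm w < e"
    proof -
      have "M * norm w < M * r" using nw b by simp
      also have "\<dots> \<le> e" using r b by (simp add: field_simps)
      finally show ?thesis .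
    qed
    ultimately show "ext_dist p q < ennreal e"
      using c q by (simp add: chart_inv_map V_def e ennreal_lessI le_less_trans)
  qed
qed

text \<open>The points at finite distance from \<open>x\<close> form an open set by local finiteness
  and the triangle inequality, and so do the others; connectedness leaves the whole space.\<close>

lemma ext_dist_finite: "ext_dist x y < top"
proof -
  let ?S = "{y. ext_dist x y < top}"
  have o: "open ?S"
    unfolding open_subopen[of ?S]
  proof clarify
    fix y assume y: "ext_dist x y < top"
    obtain V where V: "open V" "y \<in> V" "\<And>q. q \<in> V \<Longrightarrow> ext_dist y q < ennreal 1"
      by (rule ext_dist_near[of y UNIV 1]) auto
    have "ext_dist x q < top" if "q \<in> V" for q
    proof -
      have "ext_dist y q < top" using V(3)[OF that] by (rule less_trans) simp
      then have "ext_dist x y + ext_dist y q < top" using y by simp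
      then show ?thesis by (rule le_less_trans[OF ext_dist_triangle])
    qed
    then show "\<exists>T. open T \<and> y \<in> T \<and> T \<subseteq> ?S" using V by blast
  qed
  have o': "open (- ?S)"
    unfolding open_subopen[of "- ?S"]
  proof
    fix y assume "y \<in> - ?S"
    then have y: "\<not> ext_dist x y < top" by blast
    obtain V where V: "open V" "y \<in> V" "\<And>q. q \<in> V \<Longrightarrow> ext_dist y q < ennreal 1"
      by (rule ext_dist_near[of y UNIV 1]) auto
    have "\<not> ext_dist x q < top" if "q \<in> V" for q
    proof
      assume a: "ext_dist x q < top"
      have "ext_dist q y < top" unfolding ext_dist_sym[of q] using V(3)[OF that] by (rule less_trans) simp
      then have "ext_dist x q + ext_dist q y < top" using a by simp
      then have "ext_dist x y < top" by (rule le_less_trans[OF ext_dist_triangle])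
      with y show False by simp
    qed
    then show "\<exists>T. open T \<and> y \<in> T \<and> T \<subseteq> - ?S" using V by blast
  qed
  have "connected (UNIV :: 'a set)" using manifold by (simp add: smooth_manifold_def)
  then have "?S = {} \<or> ?S = UNIV"
    using o o' connected_clopen[of "UNIV :: 'a set"] by (auto simp: closed_def)
  moreover have "x \<in> ?S" by simp
  ultimately show ?thesis by blast
qed

section \<open>The distance as a metric that induces the manifold topology\<close>

lemma ennreal_d: "ennreal (d x y) = ext_dist x y"
  unfolding d_ext_dist using ext_dist_finite[of x y] by simp

lemma d_less_iff: "e > 0 \<Longrightarrow> ext_dist x y < ennreal e \<longleftrightarrow> d x y < e"
  unfolding ennreal_d[symmetric] by (simp add: ennreal_less_iff d_ext_dist)

lemma d_le_iff: "0 \<le> e \<Longrightarrow> ext_dist x y \<le> ennreal e \<longleftrightarrow> d x y \<le> e"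
  unfolding ennreal_d[symmetric] by (simp add: d_ext_dist)

text \<open>A point outside \<open>U\<close> is outside a coordinate ball around \<open>p\<close>,
  and leaving that ball costs length at least m \<rho>.\<close>

lemma d_ball_subset:
  assumes U: "open U" "p \<in> U"
  obtains e where "e > 0" "\<And>q. d p q < e \<Longrightarrow> q \<in> U"
proof -
  let ?c = "chart_at A p"
  have c: "?c \<in> A" "p \<in> chart_dom ?c" by (rule chart_at)+
  obtain \<rho> m M where b: "\<rho> > 0" "m > 0" "cball (chart_map ?c p) \<rho> \<subseteq> chart_im ?c" 
    "chart_inv ?c ` cball (chart_map ?c p) \<rho> \<subseteq> U"
    "\<And>y v. y \<in> cball (chart_map ?c p) \<rho> \<Longrightarrow> m\<^sup>2 * (v \<bullet> v) \<le> v \<bullet> (g ?c (chart_inv ?c y) *v v)"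
    using local_bounds[OF c U] by metis
  show ?thesis
  proof (rule that[of "m * \<rho>"])
    show "m * \<rho> > 0" using b by simp
    fix q assume q: "d p q < m * \<rho>"
    show "q \<in> U"
    proof (rule ccontr)
      assume "q \<notin> U"
      then have "q \<notin> chart_inv ?c ` ball (chart_map ?c p) \<rho>" using b(4) ball_subset_cball by blast
      from ext_dist_escape[OF c(1) b(3,1,2,5) this]
      have "ennreal (m * \<rho>) \<le> ext_dist p q" using c by (simp add: chart_inv_map)
      then have "m * \<rho> \<le> d p q" unfolding ennreal_d[symmetric] by (simp add: d_ext_dist)
      with q show False by simp
    qed
  qed
qed

text \<open>For definiteness, the complement of a point \<open>y\<close> different from
  \<open>x\<close> is an open neighbourhood of \<open>x\<close> and hence contains a distance ball
  around \<open>x\<close>. The other laws come from the extended distance.\<close>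

lemma metric_space_d: "Metric_space UNIV d"
proof
  fix x y z :: 'a
  show "0 \<le> d x y" by (simp add: d_ext_dist)
  show "d x y = d y x" by (simp add: d_ext_dist ext_dist_sym)
  have "ennreal (d x z) \<le> ennreal (d x y) + ennreal (d y z)"
    unfolding ennreal_d by (rule ext_dist_triangle)
  also have "\<dots> = ennreal (d x y + d y z)" by (rule ennreal_plus[symmetric]) (simp_all add: d_ext_dist)
  finally have "ennreal (d x z) \<le> ennreal (d x y + d y z)" .
  then show "d x z \<le> d x y + d y z" by (subst (asm) ennreal_le_iff) (auto simp: d_ext_dist)
  show "d x y = 0 \<longleftrightarrow> x = y"
  proof
    assume "d x y = 0"
    show "x = y"
    proof (rule ccontr)
      assume "x \<noteq> y"
      then obtain e where "e > 0" "\<And>q. d x q < e \<Longrightarrow> q \<in> - {y}" 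
        using d_ball_subset[of "- {y}" x] by (metis Compl_iff open_Compl closed_singleton singletonD)
      then show False using \<open>d x y = 0\<close> by (metis ComplD insertI1)
    qed
  qed (simp add: d_ext_dist)
qed

end

sublocale riemannian_manifold \<subseteq> M: Metric_space UNIV "riemannian_distance A g"
  by (rule metric_space_d)

context riemannian_manifold
begin

lemma mtopology_d: "M.mtopology = euclidean"
  unfolding topology_eq M.openin_mtopology open_openin[symmetric]
proof (intro allI iffI)
  fix U :: "'a set"
  assume U: "open U"
  show "U \<subseteq> UNIV \<and> (\<forall>x. x \<in> U \<longrightarrow> (\<exists>r>0. M.mball x r \<subseteq> U))"
  proof (intro conjI allI impI)
    fix x assume "x \<in> U"
    then obtain e where "e > 0" "\<And>q. d x q < e \<Longrightarrow> q \<in> U" using d_ball_subset[OF U] by blast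
    then show "\<exists>r>0. M.mball x r \<subseteq> U" by (intro exI[of _ e]) auto
  qed simp
next
  fix U :: "'a set"
  assume U: "U \<subseteq> UNIV \<and> (\<forall>x. x \<in> U \<longrightarrow> (\<exists>r>0. M.mball x r \<subseteq> U))"
  show "open U" unfolding open_subopen[of U]
  proof
    fix x assume "x \<in> U"
    then obtain r where r: "r > 0" "M.mball x r \<subseteq> U" using U by blast
    obtain V where V: "open V" "x \<in> V" "\<And>q. q \<in> V \<Longrightarrow> ext_dist x q < ennreal r"
      by (rule ext_dist_near[of x UNIV r]) (use r in auto)
    then have "V \<subseteq> U" using r by (auto simp: d_less_iff)
    then show "\<exists>T. open T \<and> x \<in> T \<and> T \<subseteq> U" using V by blast
  qed
qed

lemma continuous_on_d: "continuous_on S (d x)"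
proof -
  have "isCont (d x) p" for p
    unfolding continuous_at
  proof (rule tendstoI)
    fix e :: real assume e: "e > 0"
    obtain V where V: "open V" "p \<in> V" "\<And>q. q \<in> V \<Longrightarrow> ext_dist p q < ennreal e"
      by (rule ext_dist_near[of p UNIV e]) (use e in auto)
    have "dist (d x q) (d x p) < e" if "q \<in> V" for q
    proof -
      have "d p q < e" using V(3)[OF that] e by (simp add: d_less_iff)
      then show ?thesis using M.triangle[of x p q] M.triangle[of x q p] M.commute[of p q]
        by (auto simp: dist_real_def abs_less_iff)
    qed
    then show "\<forall>\<^sub>F q in at p. dist (d x q) (d x p) < e"
      unfolding eventually_at_topological using V(1,2) by blast
  qed
  then show ?thesis by (simp add: continuous_at_imp_continuous_on)
qed

end

section \<open>The Hopf--Rinow theorem\<close>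

context riemannian_manifold
begin

text \<open>The length space property: a curve shorter than s + t is cut where its distance from
  \<open>x\<close> equals \<open>s\<close>, by the intermediate value theorem. In the compactness
  argument it takes the place of a minimising geodesic.\<close>

lemma d_intermediate:
  assumes s: "0 \<le> s" and t: "0 < t" and xy: "d x y < s + t"
  obtains z where "d x z \<le> s" "d z y < t"
proof -
  consider "d x y \<le> s" | "s = 0" | "s < d x y" "0 < s" using s by linarith
  then show ?thesis
  proof cases
    case 1
    show ?thesis by (rule that[of y]) (use 1 t in auto)
  next
    case 2
    show ?thesis by (rule that[of x]) (use 2 xy in auto)
  next
    case 3
    have "ext_dist x y < ennreal (s + t)" using xy s t by (subst d_less_iff) auto
    then obtain \<gamma> where \<gamma>: "piecewise_C1_curve A \<gamma>" "\<gamma> 0 = x" "\<gamma> 1 = y" "curve_length A g \<gamma> < ennreal (s + t)"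
      by (rule ext_dist_less)
    have "continuous_on {0..1} (\<lambda>u. d x (\<gamma> u))"
      using \<gamma>(1) by (intro continuous_on_compose2[OF continuous_on_d[of UNIV]]) (auto simp: piecewise_C1_curve_def)
    then obtain u where u: "0 \<le> u" "u \<le> 1" "d x (\<gamma> u) = s"
      using IVT'[of "\<lambda>u. d x (\<gamma> u)" 0 s 1] 3 \<gamma> by auto
    have u0: "u \<noteq> 0" using u 3 \<gamma> by (intro notI) simp
    have u1: "u \<noteq> 1" using u 3 \<gamma> by (intro notI) simp
    have i1: "(\<lambda>v. u * v + 0) ` {0..1} = {0..u}" using u by (subst image_affinity_atLeastAtMost) auto
    have i2: "(\<lambda>v. (1 - u) * v + u) ` {0..1} = {u..1}" using u by (subst image_affinity_atLeastAtMost) auto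
    have c1: "piecewise_C1_curve A (\<lambda>v. \<gamma> (u * v + 0))" "curve_length A g (\<lambda>v. \<gamma> (u * v + 0)) = arc_length \<gamma> {0..u}"
      using curve_affine[OF \<gamma>(1) u0, of 0] u unfolding i1 by auto
    have c2: "piecewise_C1_curve A (\<lambda>v. \<gamma> ((1 - u) * v + u))" "curve_length A g (\<lambda>v. \<gamma> ((1 - u) * v + u)) = arc_length \<gamma> {u..1}"
      using curve_affine[OF \<gamma>(1), of "1 - u" u] u u1 unfolding i2 by auto
    have "ennreal (s + d (\<gamma> u) y) = ext_dist x (\<gamma> u) + ext_dist (\<gamma> u) y"
      unfolding ennreal_d[symmetric] u(3) using s by (intro ennreal_plus) auto
    also have "\<dots> \<le> arc_length \<gamma> {0..u} + arc_length \<gamma> {u..1}"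
      using ext_dist_le[OF c1(1)] ext_dist_le[OF c2(1)] \<gamma> c1(2) c2(2) by (intro add_mono) auto
    also have "\<dots> = curve_length A g \<gamma>"
      unfolding curve_length_arc[OF \<gamma>(1)] using u by (intro arc_length_split[symmetric]) auto
    finally have "ennreal (s + d (\<gamma> u) y) < ennreal (s + t)" using \<gamma>(4) by (rule le_less_trans)
    then have "s + d (\<gamma> u) y < s + t" using s by (subst (asm) ennreal_less_iff) auto
    then show ?thesis using that[of "\<gamma> u"] u(3) by simp
  qed
qed

text \<open>A compact coordinate ball contains a distance ball around its centre.\<close>

lemma locally_totally_bounded: "\<exists>e>0. M.mtotally_bounded (M.mcball p e)"
proof -
  let ?c = "chart_at A p"
  have c: "?c \<in> A" "p \<in> chart_dom ?c" by (rule chart_at)+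
  obtain \<rho> where b: "\<rho> > 0" "cball (chart_map ?c p) \<rho> \<subseteq> chart_im ?c"
    using local_bounds[OF c, of UNIV] by (metis UNIV_I open_UNIV)
  let ?C = "chart_inv ?c ` cball (chart_map ?c p) \<rho>"
  have "compact ?C"
    by (intro compact_continuous_image continuous_on_subset[OF chart_inv_cont[OF c(1)] b(2)] compact_cball)
  then have tb: "M.mtotally_bounded ?C"
    by (intro M.compactin_imp_mtotally_bounded) (simp add: mtopology_d)
  have "open (chart_inv ?c ` ball (chart_map ?c p) \<rho>)"
    by (rule open_chart_inv_image[OF c(1)]) (use b ball_subset_cball in auto)
  moreover have "p \<in> chart_inv ?c ` ball (chart_map ?c p) \<rho>"
    using b c by (intro image_eqI[of _ _ "chart_map ?c p"]) (auto simp: chart_inv_map)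
  ultimately obtain e where e: "e > 0" "\<And>q. d p q < e \<Longrightarrow> q \<in> chart_inv ?c ` ball (chart_map ?c p) \<rho>"
    using d_ball_subset by blast
  have "M.mcball p (e/2) \<subseteq> ?C"
  proof
    fix q assume "q \<in> M.mcball p (e/2)"
    then have "d p q < e" using e(1) by auto
    from e(2)[OF this] show "q \<in> ?C" using ball_subset_cball by blast
  qed
  then show ?thesis using M.mtotally_bounded_subset[OF tb] e(1) half_gt_zero by blast
qed

lemma compact_mcball:
  assumes "M.mcomplete" "M.mtotally_bounded (M.mcball x R)"
  shows "compact (M.mcball x R)"
proof -
  have "compactin M.mtopology (M.mtopology closure_of M.mcball x R)"
    using M.mtotally_bounded_eq_compact_closure_of[OF assms(1), of "M.mcball x R"] assms(2) by blast
  moreover have "M.mtopology closure_of M.mcball x R = M.mcball x R"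
    by (rule closure_of_closedin) (rule M.closedin_mcball)
  ultimately show ?thesis by (simp add: mtopology_d)
qed

text \<open>The Hopf--Rinow theorem in the form of Cohn-Vossen: the set of radii of totally bounded balls
  is open and closed.\<close>
lemma totally_bounded_mcball:
  assumes complete: "M.mcomplete"
  shows "M.mtotally_bounded (M.mcball x R)"
proof -
  define T where "T = (\<lambda>r. M.mtotally_bounded (M.mcball x r))"
  have mono: "T r" if "T s" "r \<le> s" for r s
    using that unfolding T_def by (meson M.mcball_subset_concentric M.mtotally_bounded_subset)
  have T0: "T 0"
  proof -
    have "y = x" if "d x y \<le> 0" for y using that M.nonneg[of x y] M.zero[of x y] by auto
    then have "M.mcball x 0 = {x}" by (auto simp: M.mcball_def)
    then show ?thesis by (simp add: T_def)
  qed
  \<comment> \<open>Openness: finitely many small balls cover the compact ball of radius r, and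
    their doubles are totally bounded. A point slightly farther out is within \<delta> of the
    compact ball and so lies in one of the doubles.\<close>
  have step: "\<exists>\<delta>>0. T (r + \<delta>)" if r: "T r" "0 \<le> r" for r
  proof -
    have K: "compact (M.mcball x r)" using compact_mcball[OF complete] r by (simp add: T_def)
    obtain e where e: "\<And>p. e p > 0" "\<And>p. M.mtotally_bounded (M.mcball p (e p))"
      using locally_totally_bounded by metis
    have op: "open (M.mball p (e p / 2))" for p
      using M.openin_mball[of p "e p / 2"] by (simp add: mtopology_d)
    have "M.mcball x r \<subseteq> (\<Union>p\<in>M.mcball x r. M.mball p (e p / 2))" using e(1) by auto
    from compactE_image[OF K _ this] op
    obtain D where D: "D \<subseteq> M.mcball x r" "finite D" "M.mcball x r \<subseteq> (\<Union>p\<in>D. M.mball p (e p / 2))" by blast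
    define \<delta> where "\<delta> = Min (insert 1 ((\<lambda>p. e p / 2) ` D))"
    have \<delta>: "\<delta> > 0" "\<And>p. p \<in> D \<Longrightarrow> \<delta> \<le> e p / 2"
    proof -
      show "\<delta> > 0" using D(2) e(1) unfolding \<delta>_def by (subst Min_gr_iff) auto
      show "\<delta> \<le> e p / 2" if "p \<in> D" for p unfolding \<delta>_def by (rule Min_le) (use D(2) that in auto)
    qed
    \<comment> \<open>Half of \<delta> turns the weak inequality of the closed ball into the strict
      one that \<open>d_intermediate\<close> asks for.\<close>
    have "M.mcball x (r + \<delta>/2) \<subseteq> \<Union>((\<lambda>p. M.mcball p (e p)) ` D)"
    proof
      fix y assume "y \<in> M.mcball x (r + \<delta>/2)"
      then have "d x y < r + \<delta>" using \<delta>(1) by auto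
      then obtain z where z: "d x z \<le> r" "d z y < \<delta>" using d_intermediate[OF r(2) \<delta>(1)] by blast
      then obtain p where p: "p \<in> D" "d p z < e p / 2" using D(3) by auto
      have "d p y \<le> e p" using M.triangle[of p z y] p z \<delta>(2)[OF p(1)] by simp
      then show "y \<in> \<Union>((\<lambda>p. M.mcball p (e p)) ` D)" using p by auto
    qed
    moreover have "M.mtotally_bounded (\<Union>((\<lambda>p. M.mcball p (e p)) ` D))"
      using D(2) e(2) by (intro M.mtotally_bounded_Union) auto
    ultimately have "T (r + \<delta>/2)" unfolding T_def by (rule M.mtotally_bounded_subset[rotated])
    then show ?thesis using \<delta>(1) half_gt_zero by blast
  qed
  have limit: "T r" if r: "\<And>s. s < r \<Longrightarrow> T s" "0 < r" for r
    unfolding T_def M.mtotally_bounded_def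
  proof (intro allI impI)
    fix \<epsilon> :: real assume \<epsilon>: "\<epsilon> > 0"
    \<comment> \<open>Truncation at 0 keeps \<open>s\<close> an admissible radius for
      \<open>d_intermediate\<close>, and \<epsilon> / 4 instead of \<epsilon> / 2 leaves the strict
      inequality that it needs.\<close>
    define s where "s = max 0 (r - \<epsilon>/4)"
    have s: "0 \<le> s" "s < r" "r < s + \<epsilon>/2" using \<epsilon> r(2) by (auto simp: s_def)
    obtain K where K: "finite K" "K \<subseteq> M.mcball x s" "M.mcball x s \<subseteq> (\<Union>k\<in>K. M.mball k (\<epsilon>/2))"
      using r(1)[OF s(2)] \<epsilon> unfolding T_def M.mtotally_bounded_def by (meson half_gt_zero)
    have "M.mcball x r \<subseteq> (\<Union>k\<in>K. M.mball k \<epsilon>)"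
    proof
      fix y assume "y \<in> M.mcball x r"
      then have "d x y < s + \<epsilon>/2" using s by auto
      then obtain z where z: "d x z \<le> s" "d z y < \<epsilon>/2" using d_intermediate[OF s(1) half_gt_zero[OF \<epsilon>]] by blast
      then obtain k where k: "k \<in> K" "d k z < \<epsilon>/2" using K(3) by auto
      have "d k y < \<epsilon>" using M.triangle[of k z y] k z by simp
      then show "y \<in> (\<Union>k\<in>K. M.mball k \<epsilon>)" using k by auto
    qed
    moreover have "K \<subseteq> M.mcball x r" using K(2) s(2) by auto
    ultimately show "\<exists>K. finite K \<and> K \<subseteq> M.mcball x r \<and> M.mcball x r \<subseteq> (\<Union>x\<in>K. M.mball x \<epsilon>)"
      using K(1) by blast
  qed
  have "T R"
  proof (rule ccontr)
    assume R: "\<not> T R"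
    define S where "S = {r. 0 \<le> r \<and> T r}"
    have ub: "r \<le> R" if "r \<in> S" for r
      using that mono[of r R] R by (auto simp: S_def) (meson le_cases)
    have S0: "0 \<in> S" using T0 by (simp add: S_def)
    have bdd: "bdd_above S" using ub by (auto simp: bdd_above_def)
    define s where "s = Sup S"
    have s0: "0 \<le> s" unfolding s_def by (rule cSup_upper[OF S0 bdd])
    have "T r" if ru: "r < s" for r
    proof -
      obtain u where "u \<in> S" "r < u" using less_cSupD[of S r] ru S0 unfolding s_def by blast
      then show ?thesis using mono[of u r] by (auto simp: S_def)
    qed
    then have "T s" using limit[of s] T0 s0 by (cases "s = 0") auto
    then obtain \<delta> where "\<delta> > 0" "T (s + \<delta>)" using step s0 by blast
    then have "s + \<delta> \<in> S" using s0 by (simp add: S_def)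
    then have "s + \<delta> \<le> s" unfolding s_def using bdd by (rule cSup_upper)
    then show False using \<open>\<delta> > 0\<close> by simp
  qed
  then show ?thesis by (simp add: T_def)
qed

lemma compact_closed_ball: "M.mcomplete \<Longrightarrow> compact (M.mcball x R)"
  using compact_mcball totally_bounded_mcball by blast

end

section \<open>Conformal vector fields\<close>

context riemannian_manifold
begin

section \<open>C1 functions and bump functions on the manifold\<close>

definition C1_fun :: "('a \<Rightarrow> real) \<Rightarrow> bool" where
  "C1_fun f \<longleftrightarrow> (\<forall>c\<in>A. C1_on (chart_im c) (f \<circ> chart_inv c))"

lemma C1_funD: "C1_fun f \<Longrightarrow> c \<in> A \<Longrightarrow> C1_on (chart_im c) (f \<circ> chart_inv c)"
  unfolding C1_fun_def by blast

lemma C1_fun_const: "C1_fun (\<lambda>_. k)"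
  unfolding C1_fun_def o_def using C1_on_const by blast

lemma C1_fun_mult: "C1_fun f \<Longrightarrow> C1_fun h \<Longrightarrow> C1_fun (\<lambda>q. f q * h q)"
  unfolding C1_fun_def o_def using C1_on_mult by blast

lemma C1_fun_diff: "C1_fun f \<Longrightarrow> C1_fun h \<Longrightarrow> C1_fun (\<lambda>q. f q - h q)"
  unfolding C1_fun_def o_def using C1_on_diff by blast

lemma C1_fun_prod: "(\<And>i. i \<in> I \<Longrightarrow> C1_fun (f i)) \<Longrightarrow> C1_fun (\<lambda>q. \<Prod>i\<in>I. f i q)"
  unfolding C1_fun_def o_def by (intro ballI C1_on_prod) blast

lemma continuous_on_UNIV_charts:
  assumes "\<And>c. c \<in> A \<Longrightarrow> continuous_on (chart_dom c) f"
  shows "continuous_on UNIV f"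
proof -
  have "continuous_on (\<Union>c\<in>A. chart_dom c) f"
    by (rule continuous_on_open_UN) (auto intro: assms chart_open(1))
  moreover have "(\<Union>c\<in>A. chart_dom c) = UNIV" using manifold unfolding smooth_manifold_def by blast
  ultimately show ?thesis by simp
qed

lemma continuous_on_chartI:
  assumes c: "c \<in> A" and f: "continuous_on (chart_im c) (f \<circ> chart_inv c)"
  shows "continuous_on (chart_dom c) f"
proof -
  have "continuous_on (chart_dom c) (\<lambda>p. (f \<circ> chart_inv c) (chart_map c p))"
    by (rule continuous_on_compose2[OF f chart_map_cont[OF c]]) simp
  then show ?thesis by (rule continuous_on_eq) (simp add: chart_inv_map[OF c])
qed

lemma C1_fun_continuous: "C1_fun f \<Longrightarrow> continuous_on UNIV f"
  using C1_on_imp_continuous_on C1_funD by (intro continuous_on_UNIV_charts continuous_on_chartI) blast+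

text \<open>A Euclidean bump is pulled back by a chart and extended by zero. It vanishes off the
  image of a compact coordinate ball, which is closed since the space is Hausdorff, so the extension
  is C1 in every chart.\<close>

lemma manifold_bump:
  assumes U: "open U" "p \<in> U"
  obtains b K N where "C1_fun b" "\<And>q. 0 \<le> b q" "\<And>q. b q \<le> 1" "compact K" "K \<subseteq> U" "\<And>q. q \<notin> K \<Longrightarrow> b q = 0"
    "open N" "p \<in> N" "\<And>q. q \<in> N \<Longrightarrow> b q = 1"
proof -
  let ?c = "chart_at A p"
  have c: "?c \<in> A" "p \<in> chart_dom ?c" by (rule chart_at)+
  let ?y = "chart_map ?c p"
  obtain \<rho> where \<rho>: "\<rho> > 0" "cball ?y \<rho> \<subseteq> chart_im ?c" "chart_inv ?c ` cball ?y \<rho> \<subseteq> U"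
    using local_bounds[OF c U] by metis
  obtain \<beta> :: "real^'n \<Rightarrow> real" where \<beta>: "C1_on UNIV \<beta>" "\<And>x. 0 \<le> \<beta> x" "\<And>x. \<beta> x \<le> 1"
    "\<And>x. x \<notin> ball ?y \<rho> \<Longrightarrow> \<beta> x = 0" "\<And>x. x \<in> ball ?y (\<rho>/2) \<Longrightarrow> \<beta> x = 1"
    by (rule C1_bump[OF \<rho>(1), of ?y]) blast
  define K where "K = chart_inv ?c ` cball ?y \<rho>"
  define b where "b = (\<lambda>q. if q \<in> chart_dom ?c then \<beta> (chart_map ?c q) else 0)"
  define N where "N = chart_inv ?c ` ball ?y (\<rho>/2)"
  have K: "compact K" unfolding K_def
    by (intro compact_continuous_image continuous_on_subset[OF chart_inv_cont[OF c(1)] \<rho>(2)] compact_cball)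
  have bK: "b q = 0" if "q \<notin> K" for q
  proof (cases "q \<in> chart_dom ?c")
    case True
    have "chart_map ?c q \<notin> cball ?y \<rho>"
    proof
      assume "chart_map ?c q \<in> cball ?y \<rho>"
      then have "chart_inv ?c (chart_map ?c q) \<in> K" unfolding K_def by blast
      then show False using that True by (simp add: chart_inv_map[OF c(1)])
    qed
    then show ?thesis using \<beta>(4) True by (simp add: b_def)
  qed (simp add: b_def)
  have half: "ball ?y (\<rho>/2) \<subseteq> chart_im ?c"
  proof -
    have "ball ?y (\<rho>/2) \<subseteq> cball ?y \<rho>" using \<rho>(1) by auto
    then show ?thesis using \<rho>(2) by blast
  qed
  show ?thesis
  proof (rule that[of b K N])
    show "C1_fun b" unfolding C1_fun_def
    proof
      fix d assume d: "d \<in> A"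
      \<comment> \<open>Two open sets that cover the image of the chart \<open>d\<close>: on the
        overlap with the chart of \<open>p\<close> the function is a composition with a transition
        map, and off \<open>K\<close> it is 0.\<close>
      let ?V = "chart_map d ` (chart_dom d \<inter> chart_dom ?c)" and ?W = "chart_map d ` (chart_dom d - K)"
      have oV: "open ?V" by (rule open_chart_image[OF d open_Int[OF chart_open(1)[OF d] chart_open(1)[OF c(1)]]]) auto
      have oW: "open ?W"
        by (rule open_chart_image[OF d open_Diff[OF chart_open(1)[OF d] compact_imp_closed[OF K]]]) auto
      have "K \<subseteq> chart_dom ?c" unfolding K_def using chart_inv_dom[OF c(1)] \<rho>(2) by blast
      then have im: "chart_im d = ?V \<union> ?W" by blast
      have "C1_on ?V (\<lambda>y. \<beta> (transition d ?c y))"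
        by (rule C1_on_compose[OF transition_C1_on[OF d c(1)] \<beta>(1)]) simp
      then have 1: "C1_on ?V (b \<circ> chart_inv d)"
        by (rule C1_on_cong[OF _ oV]) (auto simp: b_def chart_inv_map[OF d])
      have 2: "C1_on ?W (b \<circ> chart_inv d)"
        by (rule C1_on_cong[OF C1_on_const[of _ 0] oW]) (auto simp: bK chart_inv_map[OF d])
      show "C1_on (chart_im d) (b \<circ> chart_inv d)"
        unfolding im by (rule C1_on_Un[OF 1 2 oV oW])
    qed
    show "open N" unfolding N_def by (rule open_chart_inv_image[OF c(1) open_ball half])
    show "p \<in> N" unfolding N_def using \<rho>(1) c by (intro image_eqI[of _ _ ?y]) (auto simp: chart_inv_map)
    show "b q = 1" if q: "q \<in> N" for q
    proof -
      obtain y where y: "y \<in> ball ?y (\<rho>/2)" "q = chart_inv ?c y" using q unfolding N_def by blast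
      then have "y \<in> chart_im ?c" using half by blast
      then show ?thesis using y \<beta>(5) chart_inv_dom[OF c(1)] chart_map_inv[OF c(1)] by (simp add: b_def)
    qed
    show "K \<subseteq> U" using \<rho>(3) by (simp add: K_def)
  qed (use bK K \<beta> in \<open>auto simp: b_def\<close>)
qed

lemma chart_partial_eq:
  assumes "((f \<circ> chart_inv c) has_derivative f') (at (chart_map c p))"
  shows "chart_partial c i f p = f' (axis i 1)"
  unfolding chart_partial_def using frechet_derivative_at[OF assms] by simp

end

text \<open>The soliton equation in the form used for the analysis, with \<phi> any function for
  which it holds; continuity of \<phi> is derived from the equation itself.\<close>

locale conformal_field = riemannian_manifold A g
  for A :: "('a::{second_countable_topology, t2_space}, 'n::finite) chart set" and g :: "('a, 'n) tensor2" +
  fixes X :: "('a, 'n) vfield" and \<phi> :: "'a \<Rightarrow> real"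
  assumes field: "smooth_vector_field A X"
    and conformal: "c \<in> A \<Longrightarrow> p \<in> chart_dom c \<Longrightarrow> lie_derivative X g c p = (2 * \<phi> p) *\<^sub>R g c p"
begin

lemma field_C1_on: "c \<in> A \<Longrightarrow> C1_on (chart_im c) (X c \<circ> chart_inv c)"
  using field smooth_on_imp_C1_on unfolding smooth_vector_field_def by blast

lemma field_transform:
  "c \<in> A \<Longrightarrow> e \<in> A \<Longrightarrow> p \<in> chart_dom c \<Longrightarrow> p \<in> chart_dom e \<Longrightarrow> X e p = transition_jacobian c e p *v X c p"
  using field unfolding smooth_vector_field_def by blast

lemma field_cont: "c \<in> A \<Longrightarrow> continuous_on (chart_dom c) (X c)"
  by (rule continuous_on_chartI[OF _ C1_on_imp_continuous_on[OF field_C1_on]])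

text \<open>The coordinate divergence, taken with respect to Lebesgue measure; the derivative of the
  density \<open>vol\<close> has to be added to obtain the Riemannian divergence.\<close>

definition divX :: "('a, 'n) chart \<Rightarrow> real ^ 'n \<Rightarrow> real" where
  "divX c y = (\<Sum>i\<in>UNIV. frechet_derivative (X c \<circ> chart_inv c) (at y) (axis i 1) $ i)"

text \<open>The trace of the conformal Killing equation, by Jacobi's formula for the derivative of a determinant.\<close>
lemma divergence_identity:
  assumes c: "c \<in> A" and y: "y \<in> chart_im c"
  shows "frechet_derivative (vol c) (at y) (X c (chart_inv c y)) + vol c y * divX c y
    = real CARD('n) * \<phi> (chart_inv c y) * vol c y"
proof -
  define p where "p = chart_inv c y"
  have p: "p \<in> chart_dom c" "chart_map c p = y" using chart_inv_dom[OF c y] chart_map_inv[OF c y] by (simp_all add: p_def)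
  define G where "G = g c \<circ> chart_inv c"
  define G' where "G' = frechet_derivative G (at y)"
  define V where "V = X c \<circ> chart_inv c"
  define V' where "V' = frechet_derivative V (at y)"
  have dG: "(G has_derivative G') (at y)" unfolding G_def G'_def by (rule C1_onD(1)[OF metric_C1_on[OF c] y])
  have dV: "(V has_derivative V') (at y)" unfolding V_def V'_def by (rule C1_onD(1)[OF field_C1_on[OF c] y])
  have lG: "linear G'" "linear V'" using dG dV has_derivative_linear by auto
  have Gy: "G y = g c p" by (simp add: G_def p_def)
  define B where "B = matrix V'"
  have B: "B $ m $ i = V' (axis i 1) $ m" for m i by (simp add: B_def matrix_def)
  have cpg: "chart_partial c m (\<lambda>q. g c q $ i $ j) p = G' (axis m 1) $ i $ j" for m i j
  proof (rule chart_partial_eq)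
    have "((\<lambda>z. G z $ i $ j) has_derivative (\<lambda>v. G' v $ i $ j)) (at y)"
      by (intro bounded_linear.has_derivative[OF bounded_linear_vec_nth] dG)
    then show "((\<lambda>q. g c q $ i $ j) \<circ> chart_inv c has_derivative (\<lambda>v. G' v $ i $ j)) (at (chart_map c p))"
      unfolding p(2) by (simp add: G_def o_def)
  qed
  have cpX: "chart_partial c i (\<lambda>q. X c q $ m) p = V' (axis i 1) $ m" for i m
  proof (rule chart_partial_eq)
    have "((\<lambda>z. V z $ m) has_derivative (\<lambda>v. V' v $ m)) (at y)"
      by (intro bounded_linear.has_derivative[OF bounded_linear_vec_nth] dV)
    then show "((\<lambda>q. X c q $ m) \<circ> chart_inv c has_derivative (\<lambda>v. V' v $ m)) (at (chart_map c p))"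
      unfolding p(2) by (simp add: V_def o_def)
  qed
  have GX: "G' (X c p) = (\<Sum>m\<in>UNIV. X c p $ m *\<^sub>R G' (axis m 1))"
  proof -
    have "G' (X c p) = G' (\<Sum>m\<in>UNIV. X c p $ m *\<^sub>R axis m 1)"
      using basis_expansion[of "X c p"] by (simp add: scalar_mult_eq_scaleR)
    then show ?thesis by (simp add: linear_sum[OF lG(1)] linear_cmul[OF lG(1)])
  qed
  \<comment> \<open>With \<open>B\<close> the matrix of partial derivatives of the components of X,
    the coordinate formula for the Lie derivative becomes a matrix identity.\<close>
  have "lie_derivative X g c p = G' (X c p) + transpose B ** G y + G y ** B"
    unfolding GX by (simp add: vec_eq_iff lie_derivative_def cpg cpX Gy matrix_matrix_mult_def transpose_def B
      sum.distrib sum_component mult.commute)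
  then have eq: "G' (X c p) + transpose B ** G y + G y ** B = (2 * \<phi> p) *\<^sub>R G y"
    using conformal[OF c p(1)] Gy by simp
  have inv: "invertible (G y)" unfolding Gy by (rule pos_def_invertible[OF metric_pos[OF c p(1)]])
  let ?I = "matrix_inv (G y)"
  have I: "?I ** G y = mat 1" "G y ** ?I = mat 1" using matrix_inv_mult[OF inv] by auto
  \<comment> \<open>Contraction with the inverse metric: both terms containing \<open>B\<close> have
    trace equal to that of \<open>B\<close>, by cyclicity, and the right side gives 2 n
    \<phi>.\<close>
  have "trace (?I ** (G' (X c p) + transpose B ** G y + G y ** B)) = trace (?I ** ((2 * \<phi> p) *\<^sub>R G y))"
    unfolding eq ..
  moreover have "trace (?I ** (transpose B ** G y)) = trace B"
  proof -
    have "trace (?I ** (transpose B ** G y)) = trace ((transpose B ** G y) ** ?I)" by (rule trace_mul_sym)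
    also have "\<dots> = trace (transpose B)" by (simp add: matrix_mul_assoc[symmetric] I)
    finally show ?thesis by (simp add: trace_def transpose_def)
  qed
  moreover have "trace (?I ** (G y ** B)) = trace B" by (simp add: matrix_mul_assoc I)
  moreover have "?I ** ((2 * \<phi> p) *\<^sub>R G y) = (2 * \<phi> p) *\<^sub>R mat 1"
  proof -
    have "?I ** ((2 * \<phi> p) *\<^sub>R G y) = (2 * \<phi> p) *\<^sub>R (?I ** G y)"
      by (simp add: vec_eq_iff matrix_matrix_mult_def sum_distrib_left mult_ac)
    then show ?thesis using I(1) by simp
  qed
  moreover have "trace ((2 * \<phi> p) *\<^sub>R (mat 1 :: real^'n^'n)) = 2 * \<phi> p * real CARD('n)"
    by (simp add: trace_def mat_def)
  ultimately have tr: "trace (?I ** G' (X c p)) = 2 * (real CARD('n) * \<phi> p - trace B)"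
    by (simp add: matrix_add_ldistrib trace_add algebra_simps)
  have det: "det (G y) > 0" unfolding Gy by (rule metric_det_pos[OF c p(1)])
  have dvol: "(vol c has_derivative (\<lambda>v. (det (G y) * trace (?I ** G' v)) * (inverse (sqrt (det (G y))) / 2))) (at y)"
  proof -
    have "((\<lambda>z. sqrt (det (G z))) has_derivative (\<lambda>v. (det (G y) * trace (?I ** G' v)) * (inverse (sqrt (det (G y))) / 2))) (at y)"
      by (rule DERIV_compose_FDERIV[OF DERIV_real_sqrt[OF det] has_derivative_det[OF dG inv]])
    moreover have "vol c = (\<lambda>z. sqrt (det (G z)))" by (simp add: vol_def[abs_def] G_def)
    ultimately show ?thesis by simp
  qed
  have vs: "vol c y = sqrt (det (G y))" by (simp add: vol_def G_def)
  have "frechet_derivative (vol c) (at y) (X c p) = (det (G y) * trace (?I ** G' (X c p))) * (inverse (sqrt (det (G y))) / 2)"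
    using frechet_derivative_at[OF dvol] by metis
  also have "\<dots> = vol c y * (real CARD('n) * \<phi> p - trace B)"
  proof -
    have "det (G y) * inverse (sqrt (det (G y))) = sqrt (det (G y))" using det by (simp add: field_simps)
    moreover have "det (G y) * (2 * q) * (inverse (sqrt (det (G y))) / 2) = (det (G y) * inverse (sqrt (det (G y)))) * q" for q
      by simp
    ultimately show ?thesis unfolding tr vs by (simp only:)
  qed
  finally have "frechet_derivative (vol c) (at y) (X c p) = vol c y * (real CARD('n) * \<phi> p - trace B)" .
  moreover have "divX c y = trace B" by (simp add: divX_def trace_def B V'_def V_def)
  ultimately show ?thesis unfolding p_def[symmetric] by (simp add: algebra_simps)
qed

section \<open>The derivative of a function along X, and continuity of \<phi> and |X|\<close>

definition deriv_along :: "('a \<Rightarrow> real) \<Rightarrow> 'a \<Rightarrow> real" where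
  "deriv_along f p = (let c = chart_at A p in frechet_derivative (f \<circ> chart_inv c) (at (chart_map c p)) (X c p))"

lemma deriv_along_chart:
  assumes f: "C1_fun f" and c: "c \<in> A" "p \<in> chart_dom c"
  shows "deriv_along f p = frechet_derivative (f \<circ> chart_inv c) (at (chart_map c p)) (X c p)"
proof -
  let ?d = "chart_at A p"
  have d: "?d \<in> A" "p \<in> chart_dom ?d" by (rule chart_at)+
  let ?D = "frechet_derivative (f \<circ> chart_inv c) (at (chart_map c p))"
  have "(f \<circ> chart_inv c has_derivative ?D) (at (chart_map c p))"
    by (rule C1_onD(1)[OF C1_funD[OF f c(1)]]) (use c in simp)
  moreover have "chart_map c p = transition ?d c (chart_map ?d p)" using d by (simp add: chart_inv_map)
  ultimately have D: "(f \<circ> chart_inv c has_derivative ?D) (at (transition ?d c (chart_map ?d p)))" by simp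
  have "((f \<circ> chart_inv c) \<circ> transition ?d c has_derivative ?D \<circ> (\<lambda>v. transition_jacobian ?d c p *v v)) (at (chart_map ?d p))"
    by (rule diff_chain_at[OF transition_has_derivative[OF d(1) c(1) d(2) c(2)] D])
  then have "(f \<circ> chart_inv ?d has_derivative ?D \<circ> (\<lambda>v. transition_jacobian ?d c p *v v)) (at (chart_map ?d p))"
  proof (rule has_derivative_transform_within_open)
    show "open (chart_map ?d ` (chart_dom ?d \<inter> chart_dom c))"
      by (rule open_chart_image[OF d(1) open_Int[OF chart_open(1)[OF d(1)] chart_open(1)[OF c(1)]]]) auto
    show "chart_map ?d p \<in> chart_map ?d ` (chart_dom ?d \<inter> chart_dom c)" using c d by auto
    show "((f \<circ> chart_inv c) \<circ> transition ?d c) y = (f \<circ> chart_inv ?d) y" if "y \<in> chart_map ?d ` (chart_dom ?d \<inter> chart_dom c)" for y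
      using that c d by (auto simp: chart_inv_map)
  qed
  from frechet_derivative_at[OF this]
  have "frechet_derivative (f \<circ> chart_inv ?d) (at (chart_map ?d p)) (X ?d p) = ?D (transition_jacobian ?d c p *v X ?d p)"
    by (metis comp_apply)
  also have "transition_jacobian ?d c p *v X ?d p = X c p" by (rule field_transform[OF d(1) c(1) d(2) c(2), symmetric])
  finally show ?thesis unfolding deriv_along_def Let_def .
qed

lemma deriv_along_locally_const:
  assumes "open U" "p \<in> U" "\<And>q. q \<in> U \<Longrightarrow> f q = k"
  shows "deriv_along f p = 0"
proof -
  let ?c = "chart_at A p"
  have c: "?c \<in> A" "p \<in> chart_dom ?c" by (rule chart_at)+
  have "((\<lambda>_. k) has_derivative (\<lambda>v. 0)) (at (chart_map ?c p))" by simp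
  then have "(f \<circ> chart_inv ?c has_derivative (\<lambda>v. 0)) (at (chart_map ?c p))"
  proof (rule has_derivative_transform_within_open)
    show "open (chart_map ?c ` (chart_dom ?c \<inter> U))"
      by (rule open_chart_image[OF c(1) open_Int[OF chart_open(1)[OF c(1)] assms(1)]]) auto
    show "chart_map ?c p \<in> chart_map ?c ` (chart_dom ?c \<inter> U)" using c assms by auto
    show "k = (f \<circ> chart_inv ?c) y" if "y \<in> chart_map ?c ` (chart_dom ?c \<inter> U)" for y
      using that c assms(3) by (auto simp: chart_inv_map)
  qed
  from frechet_derivative_at[OF this, symmetric] show ?thesis by (simp add: deriv_along_def Let_def)
qed

lemma deriv_along_sum:
  assumes f: "\<And>i. i \<in> I \<Longrightarrow> C1_fun (f i)"
  shows "deriv_along (\<lambda>q. \<Sum>i\<in>I. f i q) p = (\<Sum>i\<in>I. deriv_along (f i) p)"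
proof -
  let ?c = "chart_at A p"
  have c: "?c \<in> A" "p \<in> chart_dom ?c" by (rule chart_at)+
  have "(f i \<circ> chart_inv ?c has_derivative frechet_derivative (f i \<circ> chart_inv ?c) (at (chart_map ?c p))) (at (chart_map ?c p))"
    if "i \<in> I" for i
    by (rule C1_onD(1)[OF C1_funD[OF f[OF that] c(1)]]) (use c in simp)
  from has_derivative_sum[of I "\<lambda>i. f i \<circ> chart_inv ?c", OF this]
  have "((\<lambda>q. \<Sum>i\<in>I. f i q) \<circ> chart_inv ?c has_derivative (\<lambda>v. \<Sum>i\<in>I. frechet_derivative (f i \<circ> chart_inv ?c) (at (chart_map ?c p)) v)) (at (chart_map ?c p))"
    by (simp add: o_def)
  from frechet_derivative_at[OF this, symmetric] show ?thesis by (simp add: deriv_along_def Let_def)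
qed

lemma deriv_along_continuous:
  assumes f: "C1_fun f" shows "continuous_on UNIV (deriv_along f)"
proof (rule continuous_on_UNIV_charts)
  fix c assume c: "c \<in> A"
  have "continuous_on (chart_dom c) (\<lambda>p. frechet_derivative (f \<circ> chart_inv c) (at (chart_map c p)) (X c p))"
    by (rule C1_on_continuous_on_pair[OF C1_funD[OF f c] chart_map_cont[OF c] field_cont[OF c]]) simp
  then show "continuous_on (chart_dom c) (deriv_along f)"
    by (rule continuous_on_eq) (simp add: deriv_along_chart[OF f c])
qed

text \<open>The divergence identity can be solved for \<phi>, because n and \<open>vol\<close> are
  positive; every other term in it is continuous by C1 regularity of X and \<open>g\<close>.\<close>

lemma \<phi>_continuous: "continuous_on UNIV \<phi>"
proof (rule continuous_on_UNIV_charts, rule continuous_on_chartI)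
  fix c assume c: "c \<in> A"
  let ?h = "\<lambda>y. (frechet_derivative (vol c) (at y) (X c (chart_inv c y)) + vol c y * divX c y) / (real CARD('n) * vol c y)"
  have "continuous_on (chart_im c) (X c \<circ> chart_inv c)" by (rule C1_on_imp_continuous_on[OF field_C1_on[OF c]])
  then have "continuous_on (chart_im c) ?h"
    unfolding divX_def using vol_pos[OF c]
    by (intro continuous_intros C1_on_continuous_on_pair[OF vol_C1_on[OF c]] vol_cont[OF c] continuous_on_component
        C1_onD(2)[OF field_C1_on[OF c]]) (auto simp: o_def less_imp_neq[symmetric])
  then show "continuous_on (chart_im c) (\<phi> \<circ> chart_inv c)"
  proof (rule continuous_on_eq)
    fix y assume y: "y \<in> chart_im c"
    show "?h y = (\<phi> \<circ> chart_inv c) y"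
      unfolding divergence_identity[OF c y] using vol_pos[OF c y] by simp
  qed
qed

lemma vector_norm_chart:
  assumes c: "c \<in> A" "p \<in> chart_dom c"
  shows "vector_norm A g X p = sqrt (X c p \<bullet> (g c p *v X c p))"
proof -
  let ?d = "chart_at A p"
  have d: "?d \<in> A" "p \<in> chart_dom ?d" by (rule chart_at)+
  show ?thesis unfolding vector_norm_def Let_def field_transform[OF c(1) d(1) c(2) d(2)]
    by (simp only: metric_form_transform[OF c(1) d(1) c(2) d(2)])
qed

lemma vector_norm_nonneg: "0 \<le> vector_norm A g X p"
  unfolding vector_norm_def Let_def by (intro real_sqrt_ge_zero metric_nonneg chart_at)

lemma vector_norm_continuous: "continuous_on UNIV (vector_norm A g X)"
proof (rule continuous_on_UNIV_charts)
  fix c assume c: "c \<in> A"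
  have "continuous_on (chart_dom c) (\<lambda>p. sqrt (X c p \<bullet> (g c p *v X c p)))"
    by (intro continuous_on_real_sqrt continuous_on_quadratic_form metric_cont[OF c] field_cont[OF c])
  then show "continuous_on (chart_dom c) (vector_norm A g X)"
    by (rule continuous_on_eq) (simp add: vector_norm_chart[OF c])
qed

end

section \<open>The divergence estimate in a chart\<close>

context conformal_field
begin

text \<open>The divergence theorem for \<open>u X\<close>, tested against a Lipschitz function \<open>\<eta>\<close>. In an Auerbach
  frame \<open>E\<close> of the metric at the centre, the divergence is the sum of the derivatives along the rows of \<open>E\<close>
  of the coefficients \<open>W a\<close> of \<open>u X\<close> times the volume density.\<close>
lemma chart_estimate:
  assumes c: "c \<in> A" and \<rho>: "\<rho> > 0" "ball y0 \<rho> \<subseteq> chart_im c"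
    and cmp: "\<And>y v. y \<in> ball y0 \<rho> \<Longrightarrow> v \<bullet> (g c (chart_inv c y) *v v) \<le> 2 * (v \<bullet> (g c (chart_inv c y0) *v v))
        \<and> v \<bullet> (g c (chart_inv c y0) *v v) \<le> 2 * (v \<bullet> (g c (chart_inv c y) *v v))"
    and u: "C1_fun u" "\<And>q. 0 \<le> u q" "compact K" "K \<subseteq> chart_inv c ` ball y0 \<rho>" "\<And>q. q \<notin> K \<Longrightarrow> u q = 0"
    and \<eta>: "\<eta> \<in> borel_measurable borel" "\<And>q. \<bar>\<eta> q\<bar> \<le> 1"
    and L: "0 \<le> L" "\<And>q q'. \<bar>\<eta> q - \<eta> q'\<bar> \<le> L * d q q'"
    and S: "S \<in> sets borel" "0 < \<delta>" "\<And>q q'. q \<notin> S \<Longrightarrow> d q q' < \<delta> \<Longrightarrow> \<eta> q = \<eta> q'"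
  shows "integrable \<mu> (\<lambda>q. \<eta> q * (u q * (real CARD('n) * \<phi> q) + deriv_along u q))"
    and "integrable \<mu> (\<lambda>q. u q * vector_norm A g X q * indicator S q)"
    and "\<bar>\<integral>q. \<eta> q * (u q * (real CARD('n) * \<phi> q) + deriv_along u q) \<partial>\<mu>\<bar>
      \<le> 2 * real CARD('n) * L * (\<integral>q. u q * vector_norm A g X q * indicator S q \<partial>\<mu>)"
proof -
  define P where "P = g c (chart_inv c y0)"
  have y0: "y0 \<in> chart_im c" using \<rho> by auto
  have Ppos: "v \<noteq> 0 \<Longrightarrow> v \<bullet> (P *v v) > 0" for v
    unfolding P_def by (rule metric_pos[OF c chart_inv_dom[OF c y0]])
  obtain E :: "real^'n^'n" where E: "invertible E" "\<And>a. E $ a \<bullet> (P *v E $ a) \<le> 1"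
    "\<And>x a. \<bar>x $ a\<bar> \<le> sqrt ((transpose E *v x) \<bullet> (P *v (transpose E *v x)))"
    by (rule auerbach_basis[of P]) (use Ppos in blast)+
  \<comment> \<open>\<open>transpose E *v x\<close> is the combination of the rows of
    \<open>E\<close> with coefficients \<open>x\<close>, so \<open>\<Theta> *v v\<close> lists the
    coefficients of \<open>v\<close> in this frame.\<close>
  define \<Theta> where "\<Theta> = matrix_inv (transpose E)"
  have \<Theta>: "transpose E ** \<Theta> = mat 1" "\<Theta> ** transpose E = mat 1"
    unfolding \<Theta>_def by (rule matrix_inv_mult[OF transpose_invertible[OF E(1)]])+
  have coeff: "\<bar>(\<Theta> *v v) $ a\<bar> \<le> sqrt (v \<bullet> (P *v v))" for v a
    using E(3)[of "\<Theta> *v v" a] by (simp only: matrix_vector_mul_assoc \<Theta> matrix_vector_mul_lid)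
  have Kdom: "q \<in> chart_dom c" "chart_map c q \<in> ball y0 \<rho>" if q: "q \<in> K" for q
  proof -
    obtain y where y: "y \<in> ball y0 \<rho>" "q = chart_inv c y" using u(4) q by blast
    then have "y \<in> chart_im c" using \<rho> by blast
    then show "q \<in> chart_dom c" "chart_map c q \<in> ball y0 \<rho>"
      using y chart_inv_dom[OF c] chart_map_inv[OF c] by simp_all
  qed
  define K' where "K' = chart_map c ` K"
  have K': "compact K'" unfolding K'_def
    by (intro compact_continuous_image continuous_on_subset[OF chart_map_cont[OF c]] u(3)) (use Kdom in blast)
  have K'ball: "K' \<subseteq> ball y0 \<rho>" unfolding K'_def using Kdom by blast
  have K'im: "K' \<subseteq> chart_im c" using K'ball \<rho> by blast
  have un: "u (chart_inv c y) = 0" if "y \<in> chart_im c" "y \<notin> K'" for y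
  proof -
    have "chart_inv c y \<notin> K"
    proof
      assume "chart_inv c y \<in> K"
      then have "chart_map c (chart_inv c y) \<in> K'" unfolding K'_def by blast
      then show False using that by (simp add: chart_map_inv[OF c])
    qed
    then show ?thesis by (rule u(5))
  qed
  have oK': "open (- K')" using compact_imp_closed[OF K'] by blast
  have cover: "chart_im c \<union> - K' = UNIV" using K'im by blast
  define w where "w = (\<lambda>y. (u \<circ> chart_inv c) y * vol c y)"
  \<comment> \<open>The components of \<open>u X\<close> times the volume density, extended by zero;
    the result is C1 on the whole space since it vanishes off the compact set \<open>K'\<close>
    inside the chart image.\<close>
  define V where "V = (\<lambda>y. if y \<in> chart_im c then w y *\<^sub>R (X c \<circ> chart_inv c) y else 0)"
  have V0: "V y = 0" if "y \<notin> K'" for y using un that by (auto simp: V_def w_def)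
  have C1w: "C1_on (chart_im c) w" unfolding w_def by (rule C1_on_mult[OF C1_funD[OF u(1) c] vol_C1_on[OF c]])
  have C1V: "C1_on UNIV V"
  proof -
    have "C1_on (chart_im c) V"
      by (rule C1_on_cong[OF C1_on_scaleR[OF C1w field_C1_on[OF c]] chart_open(2)[OF c]]) (simp add: V_def)
    moreover have "C1_on (- K') V"
      by (rule C1_on_cong[OF C1_on_const[of _ 0] oK']) (simp add: V0)
    ultimately have "C1_on (chart_im c \<union> - K') V" by (rule C1_on_Un[OF _ _ chart_open(2)[OF c] oK'])
    then show ?thesis unfolding cover .
  qed
  \<comment> \<open>\<open>V\<close> is the sum of the rows of \<open>E\<close> with coefficients
    \<open>W a\<close>, so its coordinate divergence is the sum of the derivatives of
    \<open>W a\<close> along row \<open>a\<close>.\<close>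
  define W where "W = (\<lambda>a y. (\<Theta> *v V y) $ a)"
  have blW: "bounded_linear (\<lambda>v. (\<Theta> *v v) $ a)" for a
    by (rule bounded_linear_compose[OF bounded_linear_vec_nth matrix_vector_mul_bounded_linear])
  have C1W: "C1_on UNIV (W a)" for a unfolding W_def by (rule C1_on_linear_compose[OF C1V blW])
  have W0: "W a y = 0" if "y \<notin> K'" for a y using V0[OF that] by (simp add: W_def)
  define \<eta>' where "\<eta>' = (\<lambda>y. indicator (chart_im c) y * \<eta> (param c y))"
  have im_borel: "chart_im c \<in> sets borel" using chart_open(2)[OF c] by simp
  have \<eta>': "\<eta>' \<in> borel_measurable borel"
    unfolding \<eta>'_def using im_borel measurable_compose[OF param_measurable[OF c] \<eta>(1)] by measurable
  have \<eta>'1: "\<bar>\<eta>' y\<bar> \<le> 1" for y using \<eta>(2) by (auto simp: \<eta>'_def indicator_def)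
  have \<eta>'im: "\<eta>' y = \<eta> (chart_inv c y)" if "y \<in> chart_im c" for y using that by (simp add: \<eta>'_def param_def)
  define S' where "S' = {y \<in> chart_im c. chart_inv c y \<in> S}"
  have S': "S' \<in> sets borel"
  proof -
    have "S' = chart_im c \<inter> param c -` S" by (auto simp: S'_def param_def)
    then show ?thesis using measurable_sets[OF param_measurable[OF c] S(1)] im_borel by auto
  qed
  \<comment> \<open>A step h along a row of \<open>E\<close> covers distance at most sqrt 2 * h,
    because the row has length at most 1 for \<open>P\<close> and \<open>g\<close> is at most 2
    \<open>P\<close>. At points outside \<open>S\<close> a small step does not change \<eta> at
    all.\<close>
  define B where "B = (\<lambda>y. sqrt 2 * L * indicator S' y)"
  have B0: "0 \<le> B y" for y using L(1) by (simp add: B_def)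
  obtain e where e: "e > 0" "(\<Union>y\<in>K'. ball y e) \<subseteq> ball y0 \<rho>"
    by (rule compact_subset_open_imp_ball_epsilon_subset[OF K' open_ball K'ball]) blast
  \<comment> \<open>The first bound keeps the whole segment in the comparison ball, with 1 added to
    make the denominator positive; the second ensures sqrt 2 * h < \<delta>.\<close>
  define \<delta>' where "\<delta>' = (\<lambda>a. min (e / (norm (E $ a) + 1)) (\<delta> / 2))"
  have \<delta>': "0 < \<delta>' a" for a using e(1) S(2) by (simp add: \<delta>'_def add_nonneg_pos)
  have shift: "\<bar>\<eta>' (y + h *\<^sub>R E $ a) - \<eta>' y\<bar> \<le> h * B y" if h: "0 < h" "h < \<delta>' a" and y: "y \<in> K'" for a h y
  proof -
    have "h * (norm (E $ a) + 1) < e"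
    proof -
      have "h < e / (norm (E $ a) + 1)" using h(2) by (simp add: \<delta>'_def)
      then show ?thesis by (simp add: pos_less_divide_eq add_nonneg_pos)
    qed
    then have nh: "h * norm (E $ a) < e" using h(1) by (simp add: distrib_left)
    have "closed_segment y (y + h *\<^sub>R E $ a) \<subseteq> ball y e"
      by (rule closed_segment_subset) (use nh h(1) e(1) in \<open>auto simp: dist_norm\<close>)
    then have seg: "closed_segment y (y + h *\<^sub>R E $ a) \<subseteq> ball y0 \<rho>" using e(2) y by blast
    have ends: "y \<in> chart_im c" "y + h *\<^sub>R E $ a \<in> chart_im c" using seg \<rho>(2) by auto
    have "ext_dist (chart_inv c y) (chart_inv c (y + h *\<^sub>R E $ a)) \<le> ennreal (sqrt 2 * h)"
    proof (rule ext_dist_chart[OF c])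
      show "closed_segment y (y + h *\<^sub>R E $ a) \<subseteq> chart_im c" using seg \<rho>(2) by blast
      show "(y + h *\<^sub>R E $ a - y) \<bullet> (g c (chart_inv c z) *v (y + h *\<^sub>R E $ a - y)) \<le> (sqrt 2 * h)\<^sup>2"
        if "z \<in> closed_segment y (y + h *\<^sub>R E $ a)" for z
      proof -
        have "E $ a \<bullet> (g c (chart_inv c z) *v E $ a) \<le> 2 * (E $ a \<bullet> (P *v E $ a))"
          using cmp[of z "E $ a"] that seg unfolding P_def by blast
        also have "\<dots> \<le> 2" using E(2)[of a] by simp
        finally have "h\<^sup>2 * (E $ a \<bullet> (g c (chart_inv c z) *v E $ a)) \<le> h\<^sup>2 * 2" by (rule mult_left_mono) simp
        moreover have "(sqrt 2 * h)\<^sup>2 = h\<^sup>2 * 2" by (simp add: power_mult_distrib)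
        ultimately show ?thesis by (simp only: add_diff_cancel_left' quadratic_form_scaleR)
      qed
    qed (use h in simp)
    then have dd: "d (chart_inv c y) (chart_inv c (y + h *\<^sub>R E $ a)) \<le> sqrt 2 * h"
      using h(1) by (subst (asm) d_le_iff) auto
    show ?thesis
    proof (cases "y \<in> S'")
      case True
      have "\<bar>\<eta> (chart_inv c (y + h *\<^sub>R E $ a)) - \<eta> (chart_inv c y)\<bar> \<le> L * d (chart_inv c y) (chart_inv c (y + h *\<^sub>R E $ a))"
        using L(2)[of "chart_inv c y" "chart_inv c (y + h *\<^sub>R E $ a)"] by (simp add: abs_minus_commute)
      also have "\<dots> \<le> L * (sqrt 2 * h)" using dd L(1) by (rule mult_left_mono)
      finally show ?thesis using True ends by (simp add: \<eta>'im B_def mult_ac)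
    next
      case False
      then have "chart_inv c y \<notin> S" using ends by (simp add: S'_def)
      moreover have "sqrt 2 * h < \<delta>"
      proof -
        have "sqrt 2 \<le> sqrt (2\<^sup>2)" by (rule real_sqrt_le_mono) simp
        then have "sqrt 2 * h \<le> 2 * h" using h(1) by simp
        also have "\<dots> < \<delta>" using h(2) by (simp add: \<delta>'_def)
        finally show ?thesis .
      qed
      ultimately have "\<eta> (chart_inv c y) = \<eta> (chart_inv c (y + h *\<^sub>R E $ a))" using dd S(3) by fastforce
      then show ?thesis using ends B0 h(1) by (simp add: \<eta>'im)
    qed
  qed
  \<comment> \<open>The coordinate form of \<open>u |X|\<close> times the density, which dominates
    every \<open>W a\<close> up to sqrt 2.\<close>
  define T where "T = (\<lambda>y. if y \<in> chart_im c then u (chart_inv c y) * vol c y * vector_norm A g X (chart_inv c y) else 0)"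
  have T0: "T y = 0" if "y \<notin> K'" for y using un that by (auto simp: T_def)
  have cT: "continuous_on UNIV T"
  proof -
    have cX: "continuous_on (chart_im c) (\<lambda>y. vector_norm A g X (chart_inv c y))"
      by (rule continuous_on_compose2[OF vector_norm_continuous chart_inv_cont[OF c]]) simp
    have cu: "continuous_on (chart_im c) (\<lambda>y. u (chart_inv c y))"
      by (rule continuous_on_compose2[OF C1_fun_continuous[OF u(1)] chart_inv_cont[OF c]]) simp
    have "continuous_on (chart_im c) T"
      by (rule continuous_on_eq[OF continuous_on_mult[OF continuous_on_mult[OF cu vol_cont[OF c]] cX]]) (simp add: T_def)
    moreover have "continuous_on (- K') T" by (rule continuous_on_eq[OF continuous_on_const[of _ 0]]) (simp add: T0)
    ultimately have "continuous_on (chart_im c \<union> - K') T"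
      by (intro continuous_on_open_Un chart_open(2)[OF c] oK')
    then show ?thesis unfolding cover .
  qed
  obtain C where C: "\<And>y. \<bar>T y\<bar> \<le> C"
  proof -
    have "bounded (T ` K')" by (intro compact_imp_bounded compact_continuous_image K' continuous_on_subset[OF cT]) simp
    then obtain C where C: "\<And>y. y \<in> K' \<Longrightarrow> \<bar>T y\<bar> \<le> C" unfolding bounded_iff by auto
    have "\<bar>T y\<bar> \<le> max C 0" for y using C[of y] T0[of y] by (cases "y \<in> K'") auto
    then show thesis by (rule that)
  qed
  define F where "F = (\<lambda>y. T y * indicator S' y)"
  have iF: "integrable lborel F"
  proof (rule integrable_compact_support[OF _ K'])
    show "F \<in> borel_measurable borel" unfolding F_def
      using S' borel_measurable_continuous_onI[OF cT] by measurable
    show "F y = 0" if "y \<notin> K'" for y using T0[OF that] by (simp add: F_def)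
    show "\<bar>F y\<bar> \<le> C" for y using C[of y] by (auto simp: F_def indicator_def)
  qed
  have Feq: "F = (\<lambda>y. indicator (chart_im c) y * (vol c y * (u (chart_inv c y) * vector_norm A g X (chart_inv c y) * indicator S (chart_inv c y))))"
    by (auto simp: F_def T_def S'_def indicator_def)
  have uvS: "(\<lambda>q. u q * vector_norm A g X q * indicator S q) \<in> borel_measurable borel"
    using borel_measurable_continuous_onI[OF C1_fun_continuous[OF u(1)]]
      borel_measurable_continuous_onI[OF vector_norm_continuous] S(1) by measurable
  have off: "q \<notin> K" if "q \<notin> chart_dom c" for q using Kdom that by blast
  have uv0: "u q * vector_norm A g X q * indicator S q = 0" if "q \<notin> chart_dom c" for q
    using u(5)[OF off[OF that]] by simp
  have "integrable \<mu> (\<lambda>q. u q * vector_norm A g X q * indicator S q) \<longleftrightarrow> integrable lborel F"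
    unfolding Feq by (rule integral_\<mu>_chart(2)[OF c uvS]) (rule uv0)
  then show "integrable \<mu> (\<lambda>q. u q * vector_norm A g X q * indicator S q)" using iF by simp
  have IF: "(\<integral>q. u q * vector_norm A g X q * indicator S q \<partial>\<mu>) = integral\<^sup>L lborel F"
    unfolding Feq by (rule integral_\<mu>_chart(1)[OF c uvS]) (rule uv0)
  \<comment> \<open>The frame coefficients of X are bounded by its length for \<open>P\<close>,
    which on the ball is at most sqrt 2 times its length for \<open>g\<close>.\<close>
  have WT: "\<bar>W a y\<bar> \<le> sqrt 2 * T y" for a y
  proof (cases "y \<in> K'")
    case True
    then have yim: "y \<in> chart_im c" and yb: "y \<in> ball y0 \<rho>" using K'im K'ball by auto
    let ?x = "X c (chart_inv c y)"
    have "?x \<bullet> (P *v ?x) \<le> 2 * (?x \<bullet> (g c (chart_inv c y) *v ?x))" using cmp[OF yb, of ?x] by (simp add: P_def)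
    then have "sqrt (?x \<bullet> (P *v ?x)) \<le> sqrt 2 * vector_norm A g X (chart_inv c y)"
      unfolding vector_norm_chart[OF c chart_inv_dom[OF c yim]] real_sqrt_mult[symmetric] by (rule real_sqrt_le_mono)
    then have "\<bar>(\<Theta> *v ?x) $ a\<bar> \<le> sqrt 2 * vector_norm A g X (chart_inv c y)" using coeff[of ?x a] by linarith
    moreover have w0: "0 \<le> w y" 
      unfolding w_def using u(2) vol_pos[OF c yim] by (intro mult_nonneg_nonneg) (auto simp: less_imp_le)
    ultimately have "w y * \<bar>(\<Theta> *v ?x) $ a\<bar> \<le> w y * (sqrt 2 * vector_norm A g X (chart_inv c y))" by (rule mult_left_mono)
    moreover have "\<bar>W a y\<bar> = w y * \<bar>(\<Theta> *v ?x) $ a\<bar>"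
      using w0 yim by (simp add: W_def V_def matrix_vector_mult_scaleR abs_mult)
    ultimately show ?thesis using yim by (simp add: T_def w_def mult_ac)
  qed (simp add: W0 T0)
  \<comment> \<open>One factor sqrt 2 comes from the distance covered by a step and one from the
    frame coefficients; together they make the 2 in the conclusion.\<close>
  have WB: "\<bar>W a y\<bar> * B y \<le> 2 * L * F y" for a y
  proof -
    have "\<bar>W a y\<bar> * B y \<le> (sqrt 2 * T y) * B y" using WT B0 by (rule mult_right_mono)
    also have "\<dots> = (sqrt 2 * sqrt 2) * L * F y" by (simp add: B_def F_def)
    also have "\<dots> = 2 * L * F y" by simp
    finally show ?thesis .
  qed
  have iWB: "integrable lborel (\<lambda>y. \<bar>W a y\<bar> * B y)" for a
  proof (rule Bochner_Integration.integrable_bound)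
    show "integrable lborel (\<lambda>y. 2 * L * F y)" using iF by simp
    have "W a \<in> borel_measurable borel" by (rule borel_measurable_continuous_onI[OF C1_on_imp_continuous_on[OF C1W]])
    then show "(\<lambda>y. \<bar>W a y\<bar> * B y) \<in> borel_measurable lborel" unfolding B_def using S' by measurable
    show "AE y in lborel. norm (\<bar>W a y\<bar> * B y) \<le> norm (2 * L * F y)"
    proof (rule AE_I2)
      fix y
      have "0 \<le> \<bar>W a y\<bar> * B y" using B0[of y] by simp
      then show "norm (\<bar>W a y\<bar> * B y) \<le> norm (2 * L * F y)"
        unfolding real_norm_def using order_trans[OF WB abs_ge_self] by (simp only: abs_of_nonneg)
    qed
  qed
  have est: "integrable lborel (\<lambda>y. \<eta>' y * frechet_derivative (W a) (at y) (E $ a))"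
      "\<bar>\<integral>y. \<eta>' y * frechet_derivative (W a) (at y) (E $ a) \<partial>lborel\<bar> \<le> (\<integral>y. \<bar>W a y\<bar> * B y \<partial>lborel)" for a
  proof -
    have sh: "\<bar>\<eta>' (y + h *\<^sub>R E $ a) - \<eta>' y\<bar> \<le> h * B y" if "0 < h" "h < \<delta>' a" "W a y \<noteq> 0" for h y
      using shift[OF that(1,2)] W0[of y a] that(3) by blast
    show "integrable lborel (\<lambda>y. \<eta>' y * frechet_derivative (W a) (at y) (E $ a))"
      by (rule integral_directional_derivative_bound(1)[OF C1W K' W0 \<eta>' \<eta>'1 \<delta>' sh iWB])
    show "\<bar>\<integral>y. \<eta>' y * frechet_derivative (W a) (at y) (E $ a) \<partial>lborel\<bar> \<le> (\<integral>y. \<bar>W a y\<bar> * B y \<partial>lborel)"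
      by (rule integral_directional_derivative_bound(2)[OF C1W K' W0 \<eta>' \<eta>'1 \<delta>' sh iWB])
  qed
  have div: "(\<Sum>a\<in>UNIV. frechet_derivative (W a) (at y) (E $ a))
     = vol c y * (u (chart_inv c y) * (real CARD('n) * \<phi> (chart_inv c y)) + deriv_along u (chart_inv c y))"
    if y: "y \<in> chart_im c" for y
  proof -
    define DV where "DV = frechet_derivative V (at y)"
    have dV: "(V has_derivative DV) (at y)" unfolding DV_def by (rule C1_onD(1)[OF C1V]) simp
    have fW: "frechet_derivative (W a) (at y) = (\<lambda>v. (\<Theta> *v DV v) $ a)" for a
      unfolding W_def by (rule frechet_derivative_at[symmetric]) (rule bounded_linear.has_derivative[OF blW dV])
    define D where "D = matrix DV"
    have DVD: "DV v = D *v v" for v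
      unfolding D_def using matrix_works[of DV v] has_derivative_linear[OF dV] by (simp add: linear_matrix_vector_mul_eq)
    \<comment> \<open>The divergence is a trace, and passing to the frame conjugates the derivative
      matrix, which leaves the trace unchanged.\<close>
    have "(\<Sum>a\<in>UNIV. frechet_derivative (W a) (at y) (E $ a)) = trace (\<Theta> ** (D ** transpose E))"
      by (simp add: fW DVD trace_def matrix_matrix_mult_def matrix_vector_mult_def transpose_def)
    also have "\<dots> = trace ((D ** transpose E) ** \<Theta>)" by (rule trace_mul_sym)
    also have "\<dots> = trace D" by (simp add: matrix_mul_assoc[symmetric] \<Theta>)
    also have "\<dots> = (\<Sum>i\<in>UNIV. DV (axis i 1) $ i)" by (simp add: trace_def D_def matrix_def)
    finally have e1: "(\<Sum>a\<in>UNIV. frechet_derivative (W a) (at y) (E $ a)) = (\<Sum>i\<in>UNIV. DV (axis i 1) $ i)" .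
    define Du where "Du = frechet_derivative (u \<circ> chart_inv c) (at y)"
    define Dv where "Dv = frechet_derivative (vol c) (at y)"
    define DX where "DX = frechet_derivative (X c \<circ> chart_inv c) (at y)"
    let ?p = "chart_inv c y"
    have p: "?p \<in> chart_dom c" "chart_map c ?p = y" using chart_inv_dom[OF c y] chart_map_inv[OF c y] by auto
    have ders: "(u \<circ> chart_inv c has_derivative Du) (at y)" "(vol c has_derivative Dv) (at y)"
      "(X c \<circ> chart_inv c has_derivative DX) (at y)"
      unfolding Du_def Dv_def DX_def
      by (rule C1_onD(1)[OF C1_funD[OF u(1) c] y] C1_onD(1)[OF vol_C1_on[OF c] y] C1_onD(1)[OF field_C1_on[OF c] y])+
    define Dw where "Dw = (\<lambda>v. u ?p * Dv v + Du v * vol c y)"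
    have dw: "(w has_derivative Dw) (at y)"
      using has_derivative_mult[OF ders(1,2)] unfolding w_def Dw_def by simp
    have "(V has_derivative (\<lambda>v. w y *\<^sub>R DX v + Dw v *\<^sub>R X c ?p)) (at y)"
      using has_derivative_scaleR[OF dw ders(3)] unfolding o_apply
      by (rule has_derivative_transform_within_open[OF _ chart_open(2)[OF c] y]) (auto simp: V_def)
    then have DV: "DV = (\<lambda>v. w y *\<^sub>R DX v + Dw v *\<^sub>R X c ?p)"
      by (rule has_derivative_unique[OF dV])
    have lin: "(\<Sum>i\<in>UNIV. l (axis i 1) * X c ?p $ i) = l (X c ?p)" if "linear l" for l :: "real^'n \<Rightarrow> real"
    proof -
      have "l (X c ?p) = l (\<Sum>i\<in>UNIV. X c ?p $ i *\<^sub>R axis i 1)"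
        using basis_expansion[of "X c ?p"] by (simp add: scalar_mult_eq_scaleR)
      then show ?thesis by (simp add: linear_sum[OF that] linear_cmul[OF that] mult.commute)
    qed
    \<comment> \<open>Leibniz rule for the product of \<open>u\<close>, \<open>vol\<close> and X.
      The terms that differentiate \<open>vol\<close> or X combine by
      \<open>divergence_identity\<close>; the remaining one is the derivative of \<open>u\<close>
      along X.\<close>
    have "(\<Sum>i\<in>UNIV. DV (axis i 1) $ i) = w y * divX c y + Dw (X c ?p)"
      unfolding lin[OF has_derivative_linear[OF dw], symmetric]
      by (simp add: DV divX_def DX_def sum.distrib sum_distrib_left)
    also have "\<dots> = u ?p * (Dv (X c ?p) + vol c y * divX c y) + vol c y * Du (X c ?p)"
      by (simp add: w_def Dw_def algebra_simps)
    also have "Dv (X c ?p) + vol c y * divX c y = real CARD('n) * \<phi> ?p * vol c y"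
      unfolding Dv_def by (rule divergence_identity[OF c y])
    also have "Du (X c ?p) = deriv_along u ?p"
      unfolding Du_def using deriv_along_chart[OF u(1) c p(1)] p(2) by simp
    finally show ?thesis unfolding e1 by (simp add: algebra_simps)
  qed
  define F1 where "F1 = (\<lambda>q. \<eta> q * (u q * (real CARD('n) * \<phi> q) + deriv_along u q))"
  have F1: "F1 \<in> borel_measurable borel"
    unfolding F1_def using \<eta>(1) borel_measurable_continuous_onI[OF C1_fun_continuous[OF u(1)]]
      borel_measurable_continuous_onI[OF \<phi>_continuous] borel_measurable_continuous_onI[OF deriv_along_continuous[OF u(1)]]
    by measurable
  have F10: "F1 q = 0" if "q \<notin> chart_dom c" for q
  proof -
    have "deriv_along u q = 0"
      by (rule deriv_along_locally_const[of "- K" _ _ 0]) (use u(3,5) off[OF that] compact_imp_closed in auto)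
    then show ?thesis using u(5)[OF off[OF that]] by (simp add: F1_def)
  qed
  have F1eq: "(\<lambda>y. indicator (chart_im c) y * (vol c y * F1 (chart_inv c y)))
    = (\<lambda>y. \<Sum>a\<in>UNIV. \<eta>' y * frechet_derivative (W a) (at y) (E $ a))"
  proof
    fix y
    show "indicator (chart_im c) y * (vol c y * F1 (chart_inv c y)) = (\<Sum>a\<in>UNIV. \<eta>' y * frechet_derivative (W a) (at y) (E $ a))"
    proof (cases "y \<in> chart_im c")
      case True
      show ?thesis unfolding sum_distrib_left[symmetric] div[OF True]
        using True by (simp add: F1_def \<eta>'im)
    qed (simp add: \<eta>'_def)
  qed
  have "integrable \<mu> F1 \<longleftrightarrow> integrable lborel (\<lambda>y. \<Sum>a\<in>UNIV. \<eta>' y * frechet_derivative (W a) (at y) (E $ a))"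
    unfolding F1eq[symmetric] by (rule integral_\<mu>_chart(2)[OF c F1]) (rule F10)
  then show "integrable \<mu> (\<lambda>q. \<eta> q * (u q * (real CARD('n) * \<phi> q) + deriv_along u q))"
    unfolding F1_def[symmetric] using est(1) by (simp add: Bochner_Integration.integrable_sum)
  have "integral\<^sup>L \<mu> F1 = (\<integral>y. (\<Sum>a\<in>UNIV. \<eta>' y * frechet_derivative (W a) (at y) (E $ a)) \<partial>lborel)"
    unfolding F1eq[symmetric] by (rule integral_\<mu>_chart(1)[OF c F1]) (rule F10)
  also have "\<dots> = (\<Sum>a\<in>UNIV. \<integral>y. \<eta>' y * frechet_derivative (W a) (at y) (E $ a) \<partial>lborel)"
    by (intro Bochner_Integration.integral_sum est(1))
  also have "\<bar>\<dots>\<bar> \<le> (\<Sum>a\<in>UNIV. \<bar>\<integral>y. \<eta>' y * frechet_derivative (W a) (at y) (E $ a) \<partial>lborel\<bar>)" by (rule sum_abs)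
  \<comment> \<open>One summand for each row of the frame, which is where the factor n
    enters.\<close>
  also have "\<dots> \<le> (\<Sum>a\<in>(UNIV::'n set). 2 * L * integral\<^sup>L lborel F)"
  proof (rule sum_mono)
    fix a
    have "(\<integral>y. \<bar>W a y\<bar> * B y \<partial>lborel) \<le> (\<integral>y. 2 * L * F y \<partial>lborel)"
      by (rule integral_mono[OF iWB _ WB]) (use iF in simp)
    then show "\<bar>\<integral>y. \<eta>' y * frechet_derivative (W a) (at y) (E $ a) \<partial>lborel\<bar> \<le> 2 * L * integral\<^sup>L lborel F"
      using est(2)[of a] by simp
  qed
  also have "\<dots> = 2 * real CARD('n) * L * integral\<^sup>L lborel F" by simp
  finally show "\<bar>\<integral>q. \<eta> q * (u q * (real CARD('n) * \<phi> q) + deriv_along u q) \<partial>\<mu>\<bar>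
      \<le> 2 * real CARD('n) * L * (\<integral>q. u q * vector_norm A g X q * indicator S q \<partial>\<mu>)"
    unfolding F1_def IF .
qed

end

section \<open>Cutoff functions and vanishing of the conformal factor\<close>

context conformal_field
begin

text \<open>The neighbourhood is chosen before \<open>u\<close>, \<eta>, \<open>L\<close>,
  \<open>S\<close> and \<delta>, and the constant 2 n does not depend on it; such estimates can
  therefore be added with the same constant for every R.\<close>

lemma local_estimate:
  obtains N where "open N" "p \<in> N"
    "\<And>u K \<eta> L S \<delta>. C1_fun u \<Longrightarrow> (\<And>q. 0 \<le> u q) \<Longrightarrow> compact K \<Longrightarrow> K \<subseteq> N \<Longrightarrow> (\<And>q. q \<notin> K \<Longrightarrow> u q = 0) \<Longrightarrow>
       \<eta> \<in> borel_measurable borel \<Longrightarrow> (\<And>q. \<bar>\<eta> q\<bar> \<le> 1) \<Longrightarrow> 0 \<le> L \<Longrightarrow> (\<And>q q'. \<bar>\<eta> q - \<eta> q'\<bar> \<le> L * d q q') \<Longrightarrow>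
       S \<in> sets borel \<Longrightarrow> 0 < \<delta> \<Longrightarrow> (\<And>q q'. q \<notin> S \<Longrightarrow> d q q' < \<delta> \<Longrightarrow> \<eta> q = \<eta> q') \<Longrightarrow>
       integrable \<mu> (\<lambda>q. \<eta> q * (u q * (real CARD('n) * \<phi> q) + deriv_along u q)) \<and>
       integrable \<mu> (\<lambda>q. u q * vector_norm A g X q * indicator S q) \<and>
       \<bar>\<integral>q. \<eta> q * (u q * (real CARD('n) * \<phi> q) + deriv_along u q) \<partial>\<mu>\<bar>
         \<le> 2 * real CARD('n) * L * (\<integral>q. u q * vector_norm A g X q * indicator S q \<partial>\<mu>)"
proof -
  let ?c = "chart_at A p"
  have c: "?c \<in> A" "p \<in> chart_dom ?c" by (rule chart_at)+
  define y0 where "y0 = chart_map ?c p"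
  have y0: "y0 \<in> chart_im ?c" "chart_inv ?c y0 = p" using c by (auto simp: y0_def chart_inv_map)
  have cG: "continuous_on (chart_im ?c) (\<lambda>y. g ?c (chart_inv ?c y))"
    using C1_on_imp_continuous_on[OF metric_C1_on[OF c(1)]] by (simp add: o_def)
  obtain \<rho> where \<rho>: "\<rho> > 0" "ball y0 \<rho> \<subseteq> chart_im ?c"
    "\<And>y v. y \<in> ball y0 \<rho> \<Longrightarrow> v \<bullet> (g ?c (chart_inv ?c y) *v v) \<le> 2 * (v \<bullet> (g ?c (chart_inv ?c y0) *v v))
        \<and> v \<bullet> (g ?c (chart_inv ?c y0) *v v) \<le> 2 * (v \<bullet> (g ?c (chart_inv ?c y) *v v))"
  proof (rule pos_def_locally_comparable[OF chart_open(2)[OF c(1)] y0(1) cG])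
    show "v \<bullet> (g ?c (chart_inv ?c y0) *v v) > 0" if "v \<noteq> 0" for v
      unfolding y0(2) by (rule metric_pos[OF c that])
  qed blast
  show ?thesis
  proof (rule that)
    show "open (chart_inv ?c ` ball y0 \<rho>)" by (rule open_chart_inv_image[OF c(1) open_ball \<rho>(2)])
    show "p \<in> chart_inv ?c ` ball y0 \<rho>" using \<rho>(1) y0(2) by (intro image_eqI[of _ _ y0]) auto
  qed (intro conjI; rule chart_estimate[OF c(1) \<rho>(1,2) \<rho>(3)]; assumption)
qed

text \<open>Completeness enters through compactness of the closed ball of radius 2 R, which carries
  the cutoff and needs finitely many neighbourhoods. Nonnegativity of \<phi> permits the passage to
  nonnegative integrals.\<close>

lemma cutoff_estimate:
  assumes complete: "M.mcomplete" and R: "R > 0" and nonneg: "\<And>q. 0 \<le> \<phi> q"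
  shows "(\<integral>\<^sup>+q. ennreal (max 0 (min 1 (2 - d x0 q / R)) * (real CARD('n) * \<phi> q)) \<partial>\<mu>)
    \<le> (\<integral>\<^sup>+q. ennreal (6 * real CARD('n)) * (ennreal (vector_norm A g X q / d q x0) * indicator {q. R / 2 \<le> d x0 q} q) \<partial>\<mu>)"
proof -
  define \<eta> where "\<eta> = (\<lambda>q. max 0 (min 1 (2 - d x0 q / R)))"
  \<comment> \<open>The annulus between R and 2 R, enlarged because difference quotients compare
    nearby points: if a point is outside \<open>S\<close>, everything within R / 2 of it lies on the
    same constant piece of \<eta>.\<close>
  define S where "S = {q. R / 2 \<le> d x0 q \<and> d x0 q \<le> 3 * R}"
  have cd: "continuous_on UNIV (d x0)" by (rule continuous_on_d)
  have \<eta>m: "\<eta> \<in> borel_measurable borel" unfolding \<eta>_def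
    using borel_measurable_continuous_onI[OF cd] by measurable
  have \<eta>1: "\<bar>\<eta> q\<bar> \<le> 1" for q by (auto simp: \<eta>_def)
  have \<eta>L: "\<bar>\<eta> q - \<eta> q'\<bar> \<le> 1 / R * d q q'" for q q'
  proof -
    have "\<bar>d x0 q' - d x0 q\<bar> \<le> d q q'"
      using M.triangle[of x0 q q'] M.triangle[of x0 q' q] M.commute[of q q'] by (auto simp: abs_le_iff)
    then have "\<bar>(2 - d x0 q / R) - (2 - d x0 q' / R)\<bar> \<le> 1 / R * d q q'"
      using R by (simp add: diff_divide_distrib[symmetric] abs_divide divide_right_mono)
    moreover have "\<bar>max 0 (min 1 a) - max 0 (min 1 b)\<bar> \<le> \<bar>a - b\<bar>" for a b :: real by (auto simp: max_def min_def)
    ultimately show ?thesis unfolding \<eta>_def using order_trans by blast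
  qed
  have Sm: "S \<in> sets borel"
  proof -
    have "closed {q. R / 2 \<le> d x0 q}" "closed {q. d x0 q \<le> 3 * R}"
      using cd by (auto intro!: closed_Collect_le continuous_intros)
    moreover have "S = {q. R / 2 \<le> d x0 q} \<inter> {q. d x0 q \<le> 3 * R}" by (auto simp: S_def)
    ultimately show ?thesis by auto
  qed
  have \<eta>const: "\<eta> q = \<eta> q'" if qS: "q \<notin> S" and dq: "d q q' < R / 2" for q q'
  proof -
    have tr: "d x0 q' \<le> d x0 q + d q q'" "d x0 q \<le> d x0 q' + d q q'"
      using M.triangle[of x0 q q'] M.triangle[of x0 q' q] M.commute[of q q'] by auto
    consider "d x0 q < R / 2" | "3 * R < d x0 q" using qS by (fastforce simp: S_def)
    then show ?thesis
    proof cases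
      case 1
      then have "d x0 q / R \<le> 1" "d x0 q' / R \<le> 1" using tr dq R by auto
      then show ?thesis by (auto simp: \<eta>_def)
    next
      case 2
      then have "2 \<le> d x0 q / R" "2 \<le> d x0 q' / R" using tr dq R by (auto simp: pos_le_divide_eq)
      then show ?thesis by (auto simp: \<eta>_def)
    qed
  qed
  define C where "C = M.mcball x0 (2 * R)"
  have cC: "compact C" unfolding C_def by (rule compact_closed_ball[OF complete])
  have \<eta>0: "\<eta> q = 0" if "q \<notin> C" for q
  proof -
    have "2 * R < d x0 q" using that by (simp add: C_def)
    then have "2 \<le> d x0 q / R" using R by (simp add: pos_le_divide_eq)
    then show ?thesis by (simp add: \<eta>_def)
  qed
  define E where "E u \<longleftrightarrow>
       integrable \<mu> (\<lambda>q. \<eta> q * (u q * (real CARD('n) * \<phi> q) + deriv_along u q)) \<and>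
       integrable \<mu> (\<lambda>q. u q * vector_norm A g X q * indicator S q) \<and>
       \<bar>\<integral>q. \<eta> q * (u q * (real CARD('n) * \<phi> q) + deriv_along u q) \<partial>\<mu>\<bar>
         \<le> 2 * real CARD('n) * (1 / R) * (\<integral>q. u q * vector_norm A g X q * indicator S q \<partial>\<mu>)" for u
  \<comment> \<open>A bump \<open>b\<close>, equal to 1 on the neighbourhood \<open>W\<close>, such
    that every nonnegative C1 function vanishing wherever \<open>b\<close> does satisfies the
    estimate. In this form the members of the partition of unity inherit it.\<close>
  define P where "P p b W \<longleftrightarrow> C1_fun b \<and> (\<forall>q. 0 \<le> b q) \<and> (\<forall>q. b q \<le> 1) \<and> open W \<and> p \<in> W \<and> (\<forall>q\<in>W. b q = 1) \<and>
     (\<forall>u. C1_fun u \<longrightarrow> (\<forall>q. 0 \<le> u q) \<longrightarrow> (\<forall>q. b q = 0 \<longrightarrow> u q = 0) \<longrightarrow> E u)" for p b W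
  have "\<exists>b W. P p b W" for p
  proof -
    obtain N where N: "open N" "p \<in> N"
      and est: "\<And>u K \<eta> L S \<delta>. C1_fun u \<Longrightarrow> (\<And>q. 0 \<le> u q) \<Longrightarrow> compact K \<Longrightarrow> K \<subseteq> N \<Longrightarrow> (\<And>q. q \<notin> K \<Longrightarrow> u q = 0) \<Longrightarrow>
       \<eta> \<in> borel_measurable borel \<Longrightarrow> (\<And>q. \<bar>\<eta> q\<bar> \<le> 1) \<Longrightarrow> 0 \<le> L \<Longrightarrow> (\<And>q q'. \<bar>\<eta> q - \<eta> q'\<bar> \<le> L * d q q') \<Longrightarrow>
       S \<in> sets borel \<Longrightarrow> 0 < \<delta> \<Longrightarrow> (\<And>q q'. q \<notin> S \<Longrightarrow> d q q' < \<delta> \<Longrightarrow> \<eta> q = \<eta> q') \<Longrightarrow>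
       integrable \<mu> (\<lambda>q. \<eta> q * (u q * (real CARD('n) * \<phi> q) + deriv_along u q)) \<and>
       integrable \<mu> (\<lambda>q. u q * vector_norm A g X q * indicator S q) \<and>
       \<bar>\<integral>q. \<eta> q * (u q * (real CARD('n) * \<phi> q) + deriv_along u q) \<partial>\<mu>\<bar>
         \<le> 2 * real CARD('n) * L * (\<integral>q. u q * vector_norm A g X q * indicator S q \<partial>\<mu>)"
      by (rule local_estimate[of p]) blast
    obtain b K W where b: "C1_fun b" "\<And>q. 0 \<le> b q" "\<And>q. b q \<le> 1" "compact K" "K \<subseteq> N" "\<And>q. q \<notin> K \<Longrightarrow> b q = 0"
      "open W" "p \<in> W" "\<And>q. q \<in> W \<Longrightarrow> b q = 1"
      by (rule manifold_bump[OF N]) blast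
    have R0: "0 \<le> 1 / R" "0 < R / 2" using R by auto
    have Eu: "E u" if u: "C1_fun u" "\<forall>q. 0 \<le> u q" "\<forall>q. b q = 0 \<longrightarrow> u q = 0" for u
      unfolding E_def
    proof (rule est[OF u(1) _ b(4,5) _ \<eta>m \<eta>1 R0(1) \<eta>L Sm R0(2) \<eta>const])
      show "0 \<le> u q" for q using u(2) by blast
      show "u q = 0" if "q \<notin> K" for q using u(3) b(6)[OF that] by blast
    qed
    have "P p b W" unfolding P_def using b(1,2,3,7,8,9) Eu by simp
    then show ?thesis by blast
  qed
  then have "\<forall>p. \<exists>b W. P p b W" by blast
  then obtain b W where bW: "\<And>p. P p (b p) (W p)" by metis
  have b: "C1_fun (b p)" "0 \<le> b p q" "b p q \<le> 1" "open (W p)" "p \<in> W p" "q \<in> W p \<Longrightarrow> b p q = 1" for p q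
    using bW[of p] unfolding P_def by blast+
  have est: "E u" if "C1_fun u" "\<forall>q. 0 \<le> u q" "\<forall>q. b p q = 0 \<longrightarrow> u q = 0" for p u
    using bW[of p] that unfolding P_def by blast
  have CW: "C \<subseteq> (\<Union>p\<in>C. W p)" using b(5) by blast
  obtain D where D: "finite D" "C \<subseteq> (\<Union>p\<in>D. W p)"
    by (rule compactE_image[OF cC b(4) CW])
  obtain h :: "nat \<Rightarrow> 'a" where h: "bij_betw h {0..<card D} D" using ex_bij_betw_nat_finite[OF D(1)] by blast
  let ?m = "card D"
  \<comment> \<open>The telescoping partition of unity: partial sums equal 1 minus a product, so no
    normalising division occurs, and each member vanishes where its own bump does.\<close>
  define \<psi> where "\<psi> = (\<lambda>j q. b (h j) q * (\<Prod>i<j. 1 - b (h i) q))"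
  have \<psi>C1: "C1_fun (\<psi> j)" for j unfolding \<psi>_def
    by (intro C1_fun_mult C1_fun_prod C1_fun_diff C1_fun_const b(1))
  have \<psi>0: "0 \<le> \<psi> j q" for j q unfolding \<psi>_def
    by (intro mult_nonneg_nonneg prod_nonneg b(2)) (simp add: b(3))
  have \<psi>sum: "(\<Sum>j<k. \<psi> j q) = 1 - (\<Prod>i<k. 1 - b (h i) q)" for k q
    by (induction k) (simp_all add: \<psi>_def algebra_simps)
  have \<psi>le: "(\<Sum>j<?m. \<psi> j q) \<le> 1" for q
    unfolding \<psi>sum using prod_nonneg[of "{..<?m}" "\<lambda>i. 1 - b (h i) q"] b(3) by simp
  \<comment> \<open>An open set around \<open>C\<close> on which the sum is 1. Openness matters: the
    sum is then locally constant there, so its derivative along X is 0.\<close>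
  define O' where "O' = (\<Union>p\<in>D. W p)"
  have O': "open O'" "C \<subseteq> O'" unfolding O'_def using D(2) b(4) by auto
  have \<psi>one: "(\<Sum>j<?m. \<psi> j q) = 1" if "q \<in> O'" for q
  proof -
    obtain p where "p \<in> D" "q \<in> W p" using \<open>q \<in> O'\<close> unfolding O'_def by blast
    moreover from \<open>p \<in> D\<close> h obtain i where "i < ?m" "p = h i" unfolding bij_betw_def by force
    ultimately have i: "i < ?m" "q \<in> W (h i)" by simp_all
    then have "1 - b (h i) q = 0" using b(6) by simp
    then have "(\<Prod>i<?m. 1 - b (h i) q) = 0" using i(1) by (intro prod_zero) auto
    then show ?thesis unfolding \<psi>sum by simp
  qed
  define f where "f = (\<lambda>j q. \<eta> q * (\<psi> j q * (real CARD('n) * \<phi> q) + deriv_along (\<psi> j) q))"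
  define G where "G = (\<lambda>j q. \<psi> j q * vector_norm A g X q * indicator S q)"
  have fj: "integrable \<mu> (f j)" "integrable \<mu> (G j)"
    "\<bar>integral\<^sup>L \<mu> (f j)\<bar> \<le> 2 * real CARD('n) * (1 / R) * integral\<^sup>L \<mu> (G j)" for j
    using est[OF \<psi>C1, of j "h j"] \<psi>0 unfolding E_def f_def G_def by (auto simp: \<psi>_def)
  have sum_f: "(\<Sum>j<?m. f j q) = \<eta> q * (real CARD('n) * \<phi> q)" for q
  proof (cases "q \<in> C")
    case True
    then have qO: "q \<in> O'" using O' by blast
    have "(\<Sum>j<?m. deriv_along (\<psi> j) q) = deriv_along (\<lambda>q. \<Sum>j<?m. \<psi> j q) q"
      by (rule deriv_along_sum[symmetric]) (rule \<psi>C1)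
    also have "\<dots> = 0" by (rule deriv_along_locally_const[OF O'(1) qO \<psi>one])
    finally have "(\<Sum>j<?m. deriv_along (\<psi> j) q) = 0" .
    then show ?thesis
      unfolding f_def sum_distrib_left[symmetric] sum.distrib sum_distrib_right[symmetric] \<psi>one[OF qO] by simp
  qed (simp add: f_def \<eta>0)
  define H where "H = (\<lambda>q. 2 * real CARD('n) * (1 / R) * (\<Sum>j<?m. G j q))"
  have iH: "integrable \<mu> H" unfolding H_def by (intro integrable_mult_right Bochner_Integration.integrable_sum fj)
  have G0: "0 \<le> G j q" for j q unfolding G_def
    by (intro mult_nonneg_nonneg \<psi>0 vector_norm_nonneg) simp
  have H0: "0 \<le> H q" for q unfolding H_def using R by (intro mult_nonneg_nonneg sum_nonneg G0) auto
  have i\<eta>: "integrable \<mu> (\<lambda>q. \<eta> q * (real CARD('n) * \<phi> q))"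
    unfolding sum_f[symmetric] by (intro Bochner_Integration.integrable_sum fj)
  have \<eta>nn: "0 \<le> \<eta> q * (real CARD('n) * \<phi> q)" for q
    by (intro mult_nonneg_nonneg nonneg) (auto simp: \<eta>_def)
  have "(\<integral>q. \<eta> q * (real CARD('n) * \<phi> q) \<partial>\<mu>) = (\<Sum>j<?m. integral\<^sup>L \<mu> (f j))"
    unfolding sum_f[symmetric] by (intro Bochner_Integration.integral_sum fj)
  also have "\<dots> \<le> (\<Sum>j<?m. 2 * real CARD('n) * (1 / R) * integral\<^sup>L \<mu> (G j))"
    by (rule sum_mono) (use fj(3) abs_le_D1 in blast)
  also have "\<dots> = integral\<^sup>L \<mu> H"
    unfolding H_def sum_distrib_left[symmetric] using fj(2) by (simp add: Bochner_Integration.integral_sum)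
  finally have le: "(\<integral>q. \<eta> q * (real CARD('n) * \<phi> q) \<partial>\<mu>) \<le> integral\<^sup>L \<mu> H" .
  have "(\<integral>\<^sup>+q. ennreal (\<eta> q * (real CARD('n) * \<phi> q)) \<partial>\<mu>) = ennreal (\<integral>q. \<eta> q * (real CARD('n) * \<phi> q) \<partial>\<mu>)"
    by (rule nn_integral_eq_integral[OF i\<eta>]) (simp add: \<eta>nn)
  also have "\<dots> \<le> ennreal (integral\<^sup>L \<mu> H)" by (rule ennreal_leI[OF le])
  also have "\<dots> = (\<integral>\<^sup>+q. ennreal (H q) \<partial>\<mu>)"
    by (rule nn_integral_eq_integral[OF iH, symmetric]) (simp add: H0)
  also have "\<dots> \<le> (\<integral>\<^sup>+q. ennreal (6 * real CARD('n)) * (ennreal (vector_norm A g X q / d q x0) * indicator {q. R / 2 \<le> d x0 q} q) \<partial>\<mu>)"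
  proof (rule nn_integral_mono)
    fix q
    show "ennreal (H q) \<le> ennreal (6 * real CARD('n)) * (ennreal (vector_norm A g X q / d q x0) * indicator {q. R / 2 \<le> d x0 q} q)"
    proof (cases "q \<in> S")
      case True
      then have dq: "0 < d x0 q" "d x0 q \<le> 3 * R" "R / 2 \<le> d x0 q" using R by (auto simp: S_def)
      have v0: "0 \<le> vector_norm A g X q" by (rule vector_norm_nonneg)
      have "(\<Sum>j<?m. G j q) = (\<Sum>j<?m. \<psi> j q) * vector_norm A g X q"
        using True by (simp add: G_def sum_distrib_right)
      also have "\<dots> \<le> 1 * vector_norm A g X q" by (rule mult_right_mono[OF \<psi>le v0])
      finally have "H q \<le> 2 * real CARD('n) * (1 / R) * vector_norm A g X q"
        unfolding H_def using R by (intro mult_left_mono) auto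
      also have "\<dots> \<le> 2 * real CARD('n) * (3 / d x0 q) * vector_norm A g X q"
        using dq R v0 by (intro mult_right_mono mult_left_mono) (auto simp: field_simps)
      also have "\<dots> = 6 * real CARD('n) * (vector_norm A g X q / d q x0)" by (simp add: M.commute[of q x0])
      finally have "ennreal (H q) \<le> ennreal (6 * real CARD('n) * (vector_norm A g X q / d q x0))" by (rule ennreal_leI)
      also have "\<dots> = ennreal (6 * real CARD('n)) * ennreal (vector_norm A g X q / d q x0)" by (rule ennreal_mult') simp
      finally show ?thesis using dq(3) by simp
    next
      case False
      then have "H q = 0" by (simp add: H_def G_def)
      then show ?thesis by simp
    qed
  qed
  finally show ?thesis unfolding \<eta>_def .
qed

text \<open>In a chart the measure has a positive density with respect to Lebesgue measure, and
  nonempty open sets are not negligible.\<close>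

lemma emeasure_\<mu>_open_pos:
  assumes U: "open U" "U \<noteq> {}"
  shows "emeasure \<mu> U > 0"
proof -
  obtain p where p: "p \<in> U" using U by blast
  let ?c = "chart_at A p"
  have c: "?c \<in> A" "p \<in> chart_dom ?c" by (rule chart_at)+
  define U' where "U' = U \<inter> chart_dom ?c"
  have oU': "open U'" "U' \<subseteq> chart_dom ?c" unfolding U'_def using U chart_open(1)[OF c(1)] by auto
  define Y where "Y = chart_map ?c ` U'"
  have oY: "open Y" unfolding Y_def by (rule open_chart_image[OF c(1) oU'])
  have Yne: "Y \<noteq> {}" using p c by (auto simp: Y_def U'_def)
  have Yim: "Y \<subseteq> chart_im ?c" unfolding Y_def using oU'(2) by blast
  have "emeasure \<mu> U' \<noteq> 0"
  proof
    assume 0: "emeasure \<mu> U' = 0"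
    have "emeasure \<mu> U' = (\<integral>\<^sup>+x\<in>Y. ennreal (vol ?c x) \<partial>lborel)"
      using is_volume_\<mu> c(1) oU' unfolding is_volume_def Y_def vol_def by auto
    also have "\<dots> = (\<integral>\<^sup>+x. ennreal (indicator (chart_im ?c) x * vol ?c x) * indicator Y x \<partial>lborel)"
      using Yim by (intro nn_integral_cong) (auto simp: indicator_def)
    finally have "(\<integral>\<^sup>+x. ennreal (indicator (chart_im ?c) x * vol ?c x) * indicator Y x \<partial>lborel) = 0" using 0 by simp
    moreover have "(\<lambda>x. ennreal (indicator (chart_im ?c) x * vol ?c x) * indicator Y x) \<in> borel_measurable lborel"
      using vol_measurable[OF c(1)] oY
      by (intro borel_measurable_times_ennreal measurable_compose[OF _ measurable_ennreal] borel_measurable_indicator) auto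
    ultimately have "AE x in lborel. ennreal (indicator (chart_im ?c) x * vol ?c x) * indicator Y x = 0"
      by (simp add: nn_integral_0_iff_AE)
    then have "AE x in lborel. x \<notin> Y"
    proof eventually_elim
      case (elim x)
      show ?case
      proof
        assume "x \<in> Y"
        then show False using elim Yim vol_pos[OF c(1), of x] by auto
      qed
    qed
    then have "Y \<in> null_sets lborel" using oY by (subst AE_iff_null_sets) auto
    then have "negligible Y" unfolding negligible_iff_null_sets by (rule null_sets_completionI)
    then show False using open_not_negligible[OF oY Yne] by blast
  qed
  then have "0 < emeasure \<mu> U'" by (simp add: zero_less_iff_neq_zero)
  also have "\<dots> \<le> emeasure \<mu> U" using U(1) by (intro emeasure_mono) (auto simp: U'_def)
  finally show ?thesis .
qed

lemma factor_zero:
  assumes complete: "M.mcomplete" and nonneg: "\<And>q. 0 \<le> \<phi> q"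
    and fin: "(\<integral>\<^sup>+q\<in>UNIV - M.mball x0 r. ennreal (vector_norm A g X q / d q x0) \<partial>\<mu>) < \<infinity>"
  shows "\<phi> p = 0"
proof (rule ccontr)
  assume "\<phi> p \<noteq> 0"
  then have pos: "\<phi> p > 0" using nonneg[of p] by simp
  \<comment> \<open>A neighbourhood of \<open>p\<close> where \<phi> exceeds half its value at
    \<open>p\<close>. The distance bound places it in every ball of radius \<open>s k\<close> below,
    where the cutoff equals 1.\<close>
  define U where "U = {q. \<phi> p / 2 < \<phi> q} \<inter> {q. d x0 q < d x0 p + 1}"
  have oU: "open U" unfolding U_def
    by (intro open_Int open_Collect_less continuous_intros \<phi>_continuous continuous_on_d)
  have "p \<in> U" using pos by (simp add: U_def)
  then have Upos: "emeasure \<mu> U > 0" using emeasure_\<mu>_open_pos[OF oU] by blast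
  have Um: "U \<in> sets \<mu>" using oU by simp
  define n where "n = real CARD('n)"
  have n: "n > 0" by (simp add: n_def)
  define \<kappa> where "\<kappa> = ennreal (n * (\<phi> p / 2)) * emeasure \<mu> U"
  have \<kappa>: "\<kappa> > 0" unfolding \<kappa>_def using Upos pos n by (simp add: ennreal_zero_less_mult_iff)
  define w where "w = (\<lambda>q. ennreal (6 * n) * (ennreal (vector_norm A g X q / d q x0) * indicator (UNIV - M.mball x0 r) q))"
  \<comment> \<open>At least \<open>r\<close>, so that the tail stays in the region of
    integrability; at least \<open>d x0 p + 1\<close>, so that \<open>U\<close> is enclosed; the
    summand k drives it to infinity.\<close>
  define s where "s = (\<lambda>k::nat. max r (d x0 p + 1) + real k)"
  define v where "v = (\<lambda>k q. ennreal (6 * n) * (ennreal (vector_norm A g X q / d q x0) * indicator {q. s k \<le> d x0 q} q))"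
  have md: "d x0 \<in> borel_measurable borel" by (rule borel_measurable_continuous_onI[OF continuous_on_d])
  have mX: "vector_norm A g X \<in> borel_measurable borel" by (rule borel_measurable_continuous_onI[OF vector_norm_continuous])
  have mquot: "(\<lambda>q. ennreal (vector_norm A g X q / d q x0)) \<in> borel_measurable borel"
  proof -
    have "(\<lambda>q. ennreal (vector_norm A g X q / d x0 q)) \<in> borel_measurable borel" using md mX by measurable
    then show ?thesis using M.commute by simp
  qed
  have mball: "M.mball x0 r \<in> sets borel"
  proof -
    have "M.mball x0 r = {q. d x0 q < r}" by auto
    then show ?thesis using open_Collect_less[OF continuous_on_d continuous_on_const, of x0 r] by simp
  qed
  have cl: "{q. s k \<le> d x0 q} \<in> sets borel" for k
    using closed_Collect_le[OF continuous_on_const continuous_on_d, of "s k" x0] by simp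
  have mw: "w \<in> borel_measurable \<mu>" unfolding w_def
    by (intro borel_measurable_times_ennreal borel_measurable_const borel_measurable_indicator)
      (use mquot mball in \<open>auto cong: measurable_cong_sets\<close>)
  have mv: "v k \<in> borel_measurable \<mu>" for k unfolding v_def
    by (intro borel_measurable_times_ennreal borel_measurable_const borel_measurable_indicator)
      (use mquot cl[of k] in \<open>auto cong: measurable_cong_sets\<close>)
  have vw: "v k q \<le> w q" for k q
    unfolding v_def w_def by (intro mult_left_mono) (auto simp: indicator_def s_def)
  have wfin: "(\<integral>\<^sup>+q. w q \<partial>\<mu>) < \<infinity>"
  proof -
    have "(\<integral>\<^sup>+q. w q \<partial>\<mu>) = ennreal (6 * n) * (\<integral>\<^sup>+q\<in>UNIV - M.mball x0 r. ennreal (vector_norm A g X q / d q x0) \<partial>\<mu>)"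
      unfolding w_def using mquot mball 
      by (intro nn_integral_cmult borel_measurable_times_ennreal borel_measurable_indicator)
        (auto cong: measurable_cong_sets)
    then show ?thesis using fin by (simp add: ennreal_mult_less_top)
  qed
  have lim: "(\<lambda>k. v k q) \<longlonglongrightarrow> 0" for q
  proof -
    obtain k0 where k0: "d x0 q < real k0 + max r (d x0 p + 1)"
      using reals_Archimedean2[of "d x0 q - max r (d x0 p + 1)"] by (metis diff_less_eq)
    have "v k q = 0" if "k0 \<le> k" for k
    proof -
      have "\<not> s k \<le> d x0 q" using k0 that by (simp add: s_def)
      then show ?thesis by (simp add: v_def)
    qed
    then have "eventually (\<lambda>k. v k q = 0) sequentially" unfolding eventually_sequentially by blast
    then show ?thesis by (rule tendsto_eventually)
  qed
  \<comment> \<open>Every point drops out of the tails eventually, and all of them are dominated by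
    the integrable \<open>w\<close>.\<close>
  have "(\<lambda>k. \<integral>\<^sup>+q. v k q \<partial>\<mu>) \<longlonglongrightarrow> (\<integral>\<^sup>+q. 0 \<partial>\<mu>)"
    by (rule nn_integral_dominated_convergence[where w=w]) (use mv mw vw wfin lim in auto)
  then have v0: "(\<lambda>k. \<integral>\<^sup>+q. v k q \<partial>\<mu>) \<longlonglongrightarrow> 0" by simp
  have "\<kappa> \<le> (\<integral>\<^sup>+q. v k q \<partial>\<mu>)" for k
  proof -
    \<comment> \<open>\<open>cutoff_estimate\<close> integrates over the points at distance at least
      R / 2, which is \<open>s k\<close> for this choice.\<close>
    define R where "R = 2 * s k"
    have sk: "d x0 p + 1 \<le> s k" by (simp add: s_def le_max_iff_disj add_increasing2)
    have R: "R > 0" using sk M.nonneg[of x0 p] unfolding R_def by linarith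
    have "\<kappa> = (\<integral>\<^sup>+q. ennreal (n * (\<phi> p / 2)) * indicator U q \<partial>\<mu>)"
      unfolding \<kappa>_def using Um by (simp add: nn_integral_cmult_indicator)
    also have "\<dots> \<le> (\<integral>\<^sup>+q. ennreal (max 0 (min 1 (2 - d x0 q / R)) * (n * \<phi> q)) \<partial>\<mu>)"
    proof (rule nn_integral_mono)
      fix q
      show "ennreal (n * (\<phi> p / 2)) * indicator U q \<le> ennreal (max 0 (min 1 (2 - d x0 q / R)) * (n * \<phi> q))"
      proof (cases "q \<in> U")
        case True
        then have "d x0 q < d x0 p + 1" by (simp add: U_def)
        then have "d x0 q \<le> R" using sk R unfolding R_def by linarith
        then have "d x0 q / R \<le> 1" using R by simp
        then have "max 0 (min 1 (2 - d x0 q / R)) = 1" by simp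
        moreover have "n * (\<phi> p / 2) \<le> n * \<phi> q" using True n by (simp add: U_def)
        ultimately show ?thesis using True by (simp add: ennreal_leI)
      qed simp
    qed
    also have "\<dots> \<le> (\<integral>\<^sup>+q. v k q \<partial>\<mu>)"
      using cutoff_estimate[OF complete R nonneg, of x0] unfolding v_def n_def R_def by simp
    finally show ?thesis .
  qed
  then have "\<kappa> \<le> 0" by (intro LIMSEQ_le_const[OF v0]) auto
  with \<kappa> show False by simp
qed

end

theorem theorem8:
  fixes A :: "('a::{second_countable_topology, t2_space}, 'n::finite) chart set"
    and g :: "('a, 'n) tensor2"
    and X :: "('a, 'n) vfield"
    and lam :: "'a \<Rightarrow> real"
    and k l :: nat
    and x\<^sub>0 :: 'a
    and r :: real
  assumes "CARD('n) \<ge> 3"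
    and "k \<le> CARD('n)" and "l \<le> CARD('n)"
    and "quotient_almost_Yamabe_soliton k l A g X lam"
    and "complete_metric A g"
    and "\<not> compact (UNIV :: 'a set)"
    and "r > 0"
    and "(\<integral>\<^sup>+ x \<in> UNIV - Metric_space.mball UNIV (riemannian_distance A g) x\<^sub>0 r.
            ennreal (vector_norm A g X x / riemannian_distance A g x x\<^sub>0) \<partial>riemannian_volume A g) < \<infinity>"
    and "positive_semidefinite_tensor A (lie_derivative X g)"
  shows "trivial_soliton A g X"
proof -
  note soliton = assms(4)[unfolded quotient_almost_Yamabe_soliton_def]
  define \<phi> where "\<phi> = (\<lambda>p. ln (sigma_curvature A g k p / sigma_curvature A g l p) - lam p)"
  have lie: "lie_derivative X g c p = (2 * \<phi> p) *\<^sub>R g c p" if "c \<in> A" "p \<in> chart_dom c" for c p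
  proof -
    have "(1/2) *\<^sub>R lie_derivative X g c p = \<phi> p *\<^sub>R g c p" using soliton that unfolding \<phi>_def by blast
    then have "2 *\<^sub>R ((1/2) *\<^sub>R lie_derivative X g c p) = 2 *\<^sub>R (\<phi> p *\<^sub>R g c p)" by simp
    then show ?thesis by simp
  qed
  interpret conformal_field A g X \<phi>
  proof
    show "smooth_manifold A" "riemannian_metric A g" "smooth_vector_field A X" using soliton by blast+
  qed (rule lie)
  \<comment> \<open>The Lie derivative is a multiple of the positive definite \<open>g\<close>, so
    the sign of the factor is visible on any single nonzero vector.\<close>
  have nonneg: "0 \<le> \<phi> p" for p
  proof -
    let ?c = "chart_at A p" and ?v = "axis undefined 1 :: real^'n"
    have c: "?c \<in> A" "p \<in> chart_dom ?c" by (rule chart_at)+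
    have "0 \<le> ?v \<bullet> (lie_derivative X g ?c p *v ?v)"
      using assms(9) c unfolding positive_semidefinite_tensor_def by blast
    also have "\<dots> = (2 * \<phi> p) * (?v \<bullet> (g ?c p *v ?v))"
      unfolding lie[OF c] by (simp add: scaleR_matrix_vector_assoc[symmetric])
    finally show ?thesis using metric_pos[OF c, of ?v] by (simp add: zero_le_mult_iff axis_eq_0_iff)
  qed
  have "M.mcomplete" using assms(5) unfolding complete_metric_def .
  then have "\<phi> p = 0" for p by (rule factor_zero[OF _ nonneg assms(8)])
  then show ?thesis unfolding trivial_soliton_def using lie by simp
qed

end
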